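(* Let $1\le m<d$, $n=d-m$, let $A\in\mathbb R^{d\times m}$ have full column rank, fix $B\in\mathscr B_A$, and let $\Sigma_\star=\Sigma_\star(B)\in\mathscr P_n$ be the unique minimizer of $f_B$. Let $\Delta_i(B,\cdot)$, $1\le i\le p$, be real functions on $\mathscr P_n$ that are $C^2$ near $\Sigma_\star$, and set $$F_B(\Sigma,u)=f_B(\Sigma)+\sum_{i=1}^pu_i\Delta_i(B,\Sigma),\qquad \Sigma\in\mathscr P_n,\ u\in\mathbb R^p.$$ Let $H_B=\operatorname{Hess}f_B(\Sigma_\star)$ and $G_Ba=\sum_ia_iD_\Sigma\Delta_i(B,\Sigma_\star)$ for $a\in\mathbb R^p$. For sufficiently small $u$ there is a unique critical point $\Sigma_\star(B,u)$ of $F_B(\cdot,u)$ near $\Sigma_\star$, and it is a strict local minimizer. For the local value branch $\bar F_B^{\rm loc}(u)=F_B(\Sigma_\star(B,u),u)$, $$D_u\Sigma_\star(B,0)=-H_B^{-1}G_B,\qquad D^2_{uu}\bar F_B^{\rm loc}(0)=-G_B^*H_B^{-1}G_B .$$ The same inverse vertical Hessian $H_B^{-1}$ governs the response of the hidden coordinate to the visible action: $D_B\Sigma_\star(B)=-H_B^{-1}E_{\Sigma B}$, where $E(B,\Sigma)=f_B(\Sigma)$ and $E_{\Sigma B}$ is its mixed derivative at $(B,\Sigma_\star(B))$. The full derivative of the canonical section is $$D_Bs_A=D_B\Phi_A+D_\Sigma\Phi_A[D_B\Sigma_\star],$$ evaluated at $(B,\Sigma_\star(B))$.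
   Context: $\mathbb S_{++}^d$ denotes real symmetric positive definite matrices with affine-invariant metric (AIRM) $\langle X,Y\rangle_P=\operatorname{tr}(P^{-1}XP^{-1}Y)$ and distance $d_{\mathrm{AI}}(P,P')=\|\log(P^{-1/2}P'P^{-1/2})\|_F$; $\mathscr P_d=\{P\in\mathbb S_{++}^d:\det P=1\}$. $\mathscr B_A=\{B\in\mathbb R^{d\times m}:A^\top B\in\mathbb S_{++}^m\}$, an open subset of the linear space $\{B:A^\top B\text{ symmetric}\}$. Fix $A=UC$ with $U^\top U=I_m$, $C$ invertible, and an orthogonal completion $Q=[U,V]\in O(d)$. For $B\in\mathscr B_A$ let $M=C^{-\top}A^\top BC^{-1}$, $N=V^\top BC^{-1}$, $T=NM^{-1}$, $L=\begin{pmatrix}I_m&0\\ T&I_n\end{pmatrix}$, $\rho=(\det M)^{-1/n}$, $\mathcal Q_\Sigma=\operatorname{diag}(M,\rho\Sigma)$, $R_0=L^{-1}L^{-\top}$, $f_B(\Sigma)=\tfrac12d_{\mathrm{AI}}(R_0,\mathcal Q_\Sigma)^2$, and $\Phi_A(B,\Sigma)=QL\mathcal Q_\Sigma L^\top Q^\top$. The canonical controller $s_A(B)$ is the unique minimizer of $d_{\mathrm{AI}}(I,P)$ over $\{P\in\mathscr P_d:PA=B\}$, and $s_A(B)=\Phi_A(B,\Sigma_\star(B))$. The Hessian $H_B$ is taken on $\mathscr P_n$ with the AIRM; it is viewed as the map $T_{\Sigma_\star}\mathscr P_n\to T^*_{\Sigma_\star}\mathscr P_n$ (or, via the metric, as a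 self-adjoint operator), and $G_B:\mathbb R^p\to T^*_{\Sigma_\star}\mathscr P_n$. The complement frame $V$ is fixed throughout; a perturbation is called intrinsic when its representatives satisfy the covariance $\Delta_{i,VR}(B,R^\top\Sigma R)=\Delta_{i,V}(B,\Sigma)$ for $R\in O(n)$, otherwise the chosen $\Delta_i$ simply selects a frame. *)

theory Defs
  imports "HOL-Analysis.Analysis"
begin

section \<open>Symmetric positive definite matrices and the affine-invariant distance\<close>

definition spd :: "real^'n^'n \<Rightarrow> bool" where
  "spd P \<longleftrightarrow> transpose P = P \<and> (\<forall>x. x \<noteq> 0 \<longrightarrow> x \<bullet> (P *v x) > 0)"

definition spd1 :: "(real^'n^'n) set" where
  "spd1 = {P. spd P \<and> det P = 1}"

definition diagm :: "real^'n \<Rightarrow> real^'n^'n" where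
  "diagm v = (\<chi> i j. if i = j then v $ i else 0)"

text \<open>Functional calculus of a real symmetric matrix: the value does not depend on the
  orthogonal diagonalization.\<close>

definition sym_fun :: "(real \<Rightarrow> real) \<Rightarrow> real^'n^'n \<Rightarrow> real^'n^'n" where
  "sym_fun g P = (THE Y. \<exists>R v. orthogonal_matrix R \<and> P = R ** diagm v ** transpose R \<and>
                              Y = R ** diagm (\<chi> i. g (v $ i)) ** transpose R)"

definition spd_log :: "real^'n^'n \<Rightarrow> real^'n^'n" where
  "spd_log P = sym_fun ln P"

definition spd_powr :: "real^'n^'n \<Rightarrow> real \<Rightarrow> real^'n^'n" where
  "spd_powr P s = sym_fun (\<lambda>x. x powr s) P"

text \<open>The norm of the type \<^typ>\<open>real^'n^'n\<close> is the Frobenius norm.\<close>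

definition dAI :: "real^'n^'n \<Rightarrow> real^'n^'n \<Rightarrow> real" where
  "dAI P P' = norm (spd_log (spd_powr P (-1/2) ** P' ** spd_powr P (-1/2)))"


section \<open>Riemannian calculus on the unit-determinant matrices\<close>

text \<open>\<^term>\<open>spd1\<close> is treated as an embedded submanifold of the space of all matrices, and
  derivatives on it are taken within \<^term>\<open>spd1\<close>. Such a derivative is determined only on the
  tangent space, and it is only ever evaluated there.\<close>

definition airm :: "real^'n^'n \<Rightarrow> real^'n^'n \<Rightarrow> real^'n^'n \<Rightarrow> real" where
  "airm P X Y = trace (matrix_inv P ** X ** matrix_inv P ** Y)"

definition tangent1 :: "real^'n^'n \<Rightarrow> (real^'n^'n) set" where
  "tangent1 P = {X. transpose X = X \<and> trace (matrix_inv P ** X) = 0}"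

definition is_critical1 :: "(real^'n^'n \<Rightarrow> real) \<Rightarrow> real^'n^'n \<Rightarrow> bool" where
  "is_critical1 g P \<longleftrightarrow> P \<in> spd1 \<and>
     (\<exists>D. (g has_derivative D) (at P within spd1) \<and> (\<forall>X\<in>tangent1 P. D X = 0))"

definition strict_local_min1 :: "(real^'n^'n \<Rightarrow> real) \<Rightarrow> real^'n^'n \<Rightarrow> bool" where
  "strict_local_min1 g P \<longleftrightarrow> P \<in> spd1 \<and>
     (\<exists>W. open W \<and> P \<in> W \<and> (\<forall>P'\<in>W \<inter> spd1. P' \<noteq> P \<longrightarrow> g P < g P'))"

definition grad1 :: "(real^'n^'n \<Rightarrow> real) \<Rightarrow> real^'n^'n \<Rightarrow> real^'n^'n" where
  "grad1 g P = (THE Y. Y \<in> tangent1 P \<and> (g has_derivative airm P Y) (at P within spd1))"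

text \<open>Levi-Civita connection of the affine-invariant metric on all positive definite matrices,
  \<open>\<nabla>\<^sub>X Y = DY[X] - (X P\<^sup>-\<^sup>1 Y + Y P\<^sup>-\<^sup>1 X)/2\<close>. The hypersurface \<open>det P = 1\<close> is totally geodesic:
  differentiating \<open>tr (P\<^sup>-\<^sup>1 Y(P)) = 0\<close> in the direction \<open>X\<close> gives \<open>tr (P\<^sup>-\<^sup>1 \<nabla>\<^sub>X Y) = 0\<close>.
  So for tangent fields the same formula is the Levi-Civita connection of \<^term>\<open>spd1\<close>.\<close>

definition cov_deriv1 ::
  "(real^'n^'n \<Rightarrow> real^'n^'n) \<Rightarrow> real^'n^'n \<Rightarrow> real^'n^'n \<Rightarrow> real^'n^'n" where
  "cov_deriv1 Y P X = frechet_derivative Y (at P within spd1) X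
     - (1/2) *\<^sub>R (X ** matrix_inv P ** Y P + Y P ** matrix_inv P ** X)"

text \<open>The Hessian as a map from tangent vectors to covectors, and its inverse. Covectors at
  \<open>P\<close> are functions on matrices that matter only on \<^term>\<open>tangent1 P\<close>.\<close>

definition hess1 :: "(real^'n^'n \<Rightarrow> real) \<Rightarrow> real^'n^'n \<Rightarrow> real^'n^'n \<Rightarrow> real^'n^'n \<Rightarrow> real" where
  "hess1 g P X = (\<lambda>Y. airm P (cov_deriv1 (grad1 g) P X) Y)"

definition hess_inv1 :: "(real^'n^'n \<Rightarrow> real) \<Rightarrow> real^'n^'n \<Rightarrow> (real^'n^'n \<Rightarrow> real) \<Rightarrow> real^'n^'n" where
  "hess_inv1 g P \<xi> = (THE X. X \<in> tangent1 P \<and> (\<forall>Y\<in>tangent1 P. hess1 g P X Y = \<xi> Y))"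

definition C2_on :: "('a::real_normed_vector \<Rightarrow> real) \<Rightarrow> 'a set \<Rightarrow> bool" where
  "C2_on g W \<longleftrightarrow> (\<exists>g' g''. (\<forall>x\<in>W. (g has_derivative blinfun_apply (g' x)) (at x)) \<and>
     (\<forall>x\<in>W. (g' has_derivative blinfun_apply (g'' x)) (at x)) \<and>
     continuous_on W (g'' :: 'a \<Rightarrow> 'a \<Rightarrow>\<^sub>L ('a \<Rightarrow>\<^sub>L real)))"

text \<open>A function on the submanifold is of class \<open>C\<^sup>2\<close> near a point if it has a local \<open>C\<^sup>2\<close>
  extension to an open set of the ambient space.\<close>

definition C2_near1 :: "(real^'n^'n \<Rightarrow> real) \<Rightarrow> real^'n^'n \<Rightarrow> bool" where
  "C2_near1 g P \<longleftrightarrow>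
     (\<exists>W h. open W \<and> P \<in> W \<and> C2_on h W \<and> (\<forall>P'\<in>W \<inter> spd1. h P' = g P'))"

definition has_second_derivative ::
  "('a::real_normed_vector \<Rightarrow> real) \<Rightarrow> ('a \<Rightarrow> 'a \<Rightarrow> real) \<Rightarrow> 'a \<Rightarrow> bool" where
  "has_second_derivative g K x \<longleftrightarrow>
     (\<exists>g' g''. (\<forall>\<^sub>F y in nhds x. (g has_derivative blinfun_apply (g' y)) (at y)) \<and>
        (g' has_derivative g'') (at x) \<and> K = (\<lambda>a b. blinfun_apply (g'' a) b))"


section \<open>Block decomposition\<close>

definition hcat :: "real^'m^'d \<Rightarrow> real^'n^'d \<Rightarrow> real^('m + 'n)^'d" where
  "hcat U V = (\<chi> i j. case j of Inl k \<Rightarrow> U $ i $ k | Inr k \<Rightarrow> V $ i $ k)"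

definition block ::
  "real^'m^'m \<Rightarrow> real^'n^'m \<Rightarrow> real^'m^'n \<Rightarrow> real^'n^'n \<Rightarrow> real^('m + 'n)^('m + 'n)" where
  "block P11 P12 P21 P22 =
     (\<chi> i j. case i of
        Inl k \<Rightarrow> (case j of Inl l \<Rightarrow> P11 $ k $ l | Inr l \<Rightarrow> P12 $ k $ l)
      | Inr k \<Rightarrow> (case j of Inl l \<Rightarrow> P21 $ k $ l | Inr l \<Rightarrow> P22 $ k $ l))"

definition actions :: "real^'m^'d \<Rightarrow> (real^'m^'d) set" where
  "actions A = {B. spd (transpose A ** B)}"

text \<open>The linear space in which \<^term>\<open>actions A\<close> is open; it is the tangent space of
  \<^term>\<open>actions A\<close> at each point.\<close>

definition action_space :: "real^'m^'d \<Rightarrow> (real^'m^'d) set" where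
  "action_space A = {B. transpose (transpose A ** B) = transpose A ** B}"

definition Mmat :: "real^'m^'d \<Rightarrow> real^'m^'m \<Rightarrow> real^'m^'d \<Rightarrow> real^'m^'m" where
  "Mmat A C B = transpose (matrix_inv C) ** transpose A ** B ** matrix_inv C"

definition Nmat :: "real^'m^'m \<Rightarrow> real^'n^'d \<Rightarrow> real^'m^'d \<Rightarrow> real^'m^'n" where
  "Nmat C V B = transpose V ** B ** matrix_inv C"

definition Tmat :: "real^'m^'d \<Rightarrow> real^'m^'m \<Rightarrow> real^'n^'d \<Rightarrow> real^'m^'d \<Rightarrow> real^'m^'n" where
  "Tmat A C V B = Nmat C V B ** matrix_inv (Mmat A C B)"

definition Lmat ::
  "real^'m^'d \<Rightarrow> real^'m^'m \<Rightarrow> real^'n^'d \<Rightarrow> real^'m^'d \<Rightarrow> real^('m + 'n)^('m + 'n)" where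
  "Lmat A C V B = block (mat 1) 0 (Tmat A C V B) (mat 1)"

definition rho :: "nat \<Rightarrow> real^'m^'m \<Rightarrow> real" where
  "rho n M = det M powr (- 1 / real n)"

definition Qmat ::
  "real^'m^'d \<Rightarrow> real^'m^'m \<Rightarrow> real^'m^'d \<Rightarrow> real^'n^'n \<Rightarrow> real^('m + 'n)^('m + 'n)" where
  "Qmat A C B \<Sigma> = block (Mmat A C B) 0 0 (rho CARD('n) (Mmat A C B) *\<^sub>R \<Sigma>)"

definition R0mat ::
  "real^'m^'d \<Rightarrow> real^'m^'m \<Rightarrow> real^'n^'d \<Rightarrow> real^'m^'d \<Rightarrow> real^('m + 'n)^('m + 'n)" where
  "R0mat A C V B = matrix_inv (Lmat A C V B) ** transpose (matrix_inv (Lmat A C V B))"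

definition fB ::
  "real^'m^'d \<Rightarrow> real^'m^'m \<Rightarrow> real^'n^'d \<Rightarrow> real^'m^'d \<Rightarrow> real^'n^'n \<Rightarrow> real" where
  "fB A C V B \<Sigma> = (1/2) * (dAI (R0mat A C V B) (Qmat A C B \<Sigma>))\<^sup>2"

definition Phi ::
  "real^'m^'d \<Rightarrow> real^'m^'d \<Rightarrow> real^'m^'m \<Rightarrow> real^'n^'d \<Rightarrow> real^'m^'d \<Rightarrow> real^'n^'n \<Rightarrow> real^'d^'d"
  where
  "Phi A U C V B \<Sigma> =
     hcat U V ** Lmat A C V B ** Qmat A C B \<Sigma> ** transpose (Lmat A C V B) ** transpose (hcat U V)"

definition the_minimizer :: "('a \<Rightarrow> real) \<Rightarrow> 'a set \<Rightarrow> 'a" where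
  "the_minimizer g S = (THE x. is_arg_min g (\<lambda>y. y \<in> S) x)"

definition Sigma_star ::
  "real^'m^'d \<Rightarrow> real^'m^'m \<Rightarrow> real^'n^'d \<Rightarrow> real^'m^'d \<Rightarrow> real^'n^'n" where
  "Sigma_star A C V B = the_minimizer (fB A C V B) spd1"

definition canonical_controller :: "real^'m^'d \<Rightarrow> real^'m^'d \<Rightarrow> real^'d^'d" where
  "canonical_controller A B = the_minimizer (dAI (mat 1)) {P \<in> spd1. P ** A = B}"

text \<open>Mixed second derivative of \<open>(B, \<Sigma>) \<mapsto> f\<^sub>B(\<Sigma>)\<close>, sending a direction in
  \<^term>\<open>action_space A\<close> to a covector at \<open>\<Sigma>\<close>.\<close>

definition mixed_deriv ::
  "real^'m^'d \<Rightarrow> real^'m^'m \<Rightarrow> real^'n^'d \<Rightarrow> real^'m^'d \<Rightarrow> real^'n^'n \<Rightarrow>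
   real^'m^'d \<Rightarrow> real^'n^'n \<Rightarrow> real" where
  "mixed_deriv A C V B \<Sigma> Z = (\<lambda>X.
     frechet_derivative (\<lambda>B'. frechet_derivative (fB A C V B') (at \<Sigma> within spd1) X)
       (at B within actions A) Z)"


section \<open>Perturbation\<close>

definition perturbed ::
  "(real^'n^'n \<Rightarrow> real) \<Rightarrow> ('p::finite \<Rightarrow> real^'n^'n \<Rightarrow> real) \<Rightarrow> real^'n^'n \<Rightarrow> real^'p \<Rightarrow> real" where
  "perturbed f \<Delta> \<Sigma> u = f \<Sigma> + (\<Sum>i\<in>UNIV. u $ i * \<Delta> i \<Sigma>)"

definition pert_G ::
  "('p::finite \<Rightarrow> real^'n^'n \<Rightarrow> real) \<Rightarrow> real^'n^'n \<Rightarrow> real^'p \<Rightarrow> real^'n^'n \<Rightarrow> real" where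
  "pert_G \<Delta> \<Sigma> a = (\<lambda>X. \<Sum>i\<in>UNIV. a $ i * frechet_derivative (\<Delta> i) (at \<Sigma> within spd1) X)"

text \<open>The dual map of \<^const>\<open>pert_G\<close>, from tangent vectors to functionals on the parameter
  space.\<close>

definition pert_G_dual ::
  "('p::finite \<Rightarrow> real^'n^'n \<Rightarrow> real) \<Rightarrow> real^'n^'n \<Rightarrow> real^'n^'n \<Rightarrow> real^'p \<Rightarrow> real" where
  "pert_G_dual \<Delta> \<Sigma> X = (\<lambda>a. pert_G \<Delta> \<Sigma> a X)"

end

theory Submission
  imports Defs
begin

text \<open>
  The idea is that \<open>f\<^sub>B(\<Sigma>)\<close> is half the squared distance from the identity to the controller
  \<open>\<Phi>\<^sub>A(B, \<Sigma>)\<close>, that \<open>\<Sigma> \<mapsto> \<Phi>\<^sub>A(B, \<Sigma>)\<close> sends geodesics to geodesics, and that the squared distance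
  is strictly convex along geodesics. Hence critical points are unique, the Hessian is positive
  definite, and everything else follows from the implicit function theorem.

  \<^emph>\<open>Smoothness.\<close> Write \<open>K = L Q L\<^sup>T\<close> for the controller in the frame \<open>[U, V]\<close>; it is affine in \<open>\<Sigma>\<close>,
  and \<open>f\<^sub>B(\<Sigma>) = tr (log K)\<^sup>2 / 2\<close> (\<open>dAI_R0mat\<close>, \<open>fB_eq_log_energy\<close>). The logarithm is represented by
  \<open>log K = \<integral>\<^sub>0\<^sup>1 (1 + t (K - 1))\<^sup>-\<^sup>1 (K - 1) dt\<close>. This is continuously differentiable on the open set of
  all matrices with positive definite quadratic form, with derivative
  \<open>E \<mapsto> \<integral>\<^sub>0\<^sup>1 J\<^sub>t E J\<^sub>t dt\<close> for the resolvents \<open>J\<^sub>t\<close>, and \<open>f\<^sub>B\<close> has the ambient gradient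
  \<open>energy_grad\<close>, which is continuously differentiable in \<open>(\<Sigma>, B)\<close>.

  \<^emph>\<open>Convexity.\<close> Along a geodesic the logarithmic velocity \<open>Z = K\<^sup>-\<^sup>1 K'\<close> is constant, so the first
  derivative of the energy is \<open>tr (log K Z)\<close> and the second is
  \<open>\<integral>\<^sub>0\<^sup>1 tr (J\<^sub>t K' J\<^sub>t K\<^sup>-\<^sup>1 K') dt\<close>. This is positive, being a sum of squares in an eigenbasis of \<open>K\<close>
  (\<open>dmlog_pos\<close>). Since any two points are joined by a geodesic, critical points are unique
  (\<open>critical_point_unique\<close>); since \<open>norm (log K)\<close> controls \<open>K\<close>, a minimizer exists.

  \<^emph>\<open>Critical branches.\<close> The Riemannian gradient is a polynomial in the point and the ambient gradient.
  Adding terms that detect \<open>det X = 1\<close> and the symmetry of \<open>X\<close> gives a map on the space of all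
  matrices whose zeros are the critical points. Its derivative is the Hessian on the tangent space,
  and modulo the tangent space it is injective on a complement; hence it is invertible. The implicit function
  theorem yields a branch of critical points whose derivative solves the linearized equation
  (\<open>critical_branch\<close>). With \<open>u\<close> as the parameter this is the perturbed branch, with \<open>B\<close> as the
  parameter it is \<open>\<Sigma>\<^sub>\<star>(B)\<close> itself, by uniqueness of critical points.

  \<^emph>\<open>Minimality and values.\<close> For small \<open>u\<close> a minimizer of the perturbed energy over a small closed
  ball lies in the interior, so it is critical and lies on the branch; this gives strict local
  minimality. The value branch is an infimum of functions affine in \<open>u\<close>, so its derivative in the
  direction \<open>b\<close> is \<open>\<Sum> b\<^sub>i \<Delta>\<^sub>i\<close> at the minimizer, and the second derivative is one more application of
  the chain rule. Finally, \<open>\<Phi>\<^sub>A(B, \<cdot>)\<close> parametrizes the feasible controllers by Schur complements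
  (\<open>feasible_controllers\<close>), so the canonical section is \<open>\<Phi>\<^sub>A(B, \<Sigma>\<^sub>\<star>(B))\<close>.
\<close>

\<comment> \<open>The default rules rewrite \<open>A\<^sup>T x\<close> to the row product \<open>x A\<close>; here the adjoint form is kept.\<close>
declare transpose_matrix_vector [simp del] vector_transpose_matrix [simp del]

section \<open>Matrices with the Frobenius inner product\<close>

lemma inner_matrix_trace: "A \<bullet> B = trace (transpose A ** B)" for A B :: "real^'n^'m"
proof -
  have "trace (transpose A ** B) = (\<Sum>j\<in>UNIV. \<Sum>i\<in>UNIV. A $ i $ j * B $ i $ j)"
    by (simp add: trace_def matrix_matrix_mult_def transpose_def)
  also have "\<dots> = A \<bullet> B"
    by (subst sum.swap) (simp add: inner_vec_def)
  finally show ?thesis by simp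
qed

lemma trace_transpose: "trace (transpose A) = trace A" for A :: "real^'n^'n"
  by (simp add: trace_def transpose_def)

lemma trace_scaleR: "trace (c *\<^sub>R A) = c * trace A" for A :: "real^'n^'n"
  by (simp add: trace_def sum_distrib_left)

lemma inner_matrix_mult_left: "(A ** B) \<bullet> C = B \<bullet> (transpose A ** C)"
  for A :: "real^'n^'m" and B :: "real^'k^'n"
  by (simp add: inner_matrix_trace matrix_transpose_mul matrix_mul_assoc)

lemma inner_transpose: "transpose A \<bullet> transpose B = A \<bullet> B" for A B :: "real^'n^'m"
  unfolding inner_matrix_trace transpose_transpose
  by (metis inner_commute inner_matrix_trace trace_mul_sym)

lemma inner_matrix_mult_right: "(A ** B) \<bullet> C = A \<bullet> (C ** transpose B)"
  for A :: "real^'n^'m" and B :: "real^'k^'n"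
  using trace_mul_sym[of "transpose B" "transpose A ** C"]
  by (simp add: inner_matrix_trace matrix_transpose_mul matrix_mul_assoc)

lemma transpose_add: "transpose (A + B) = transpose A + transpose B" for A B :: "real^'n^'m"
  by (simp add: transpose_def vec_eq_iff)

lemma transpose_diff: "transpose (A - B) = transpose A - transpose B" for A B :: "real^'n^'m"
  by (simp add: transpose_def vec_eq_iff)

lemma transpose_0 [simp]: "transpose (0 :: real^'n^'m) = 0"
  by (simp add: transpose_def vec_eq_iff)

lemma linear_transpose: "linear (transpose :: real^'n^'m \<Rightarrow> real^'m^'n)"
  by (rule linearI) (simp_all add: transpose_add transpose_scalar)

lemma linear_trace: "linear (trace :: real^'n^'n \<Rightarrow> real)"
  by (rule linearI) (simp_all add: trace_add trace_scaleR)

lemma bounded_bilinear_matrix_mult: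
  "bounded_bilinear ((**) :: real^'n^'m \<Rightarrow> real^'k^'n \<Rightarrow> real^'k^'m)"
  unfolding bilinear_conv_bounded_bilinear[symmetric] bilinear_def
  by (auto intro!: linearI simp: matrix_matrix_mult_def vec_eq_iff algebra_simps sum.distrib
      sum_distrib_left)

lemmas matrix_add_ldistrib = bounded_bilinear.add_right[OF bounded_bilinear_matrix_mult]
  and matrix_add_rdistrib = bounded_bilinear.add_left[OF bounded_bilinear_matrix_mult]
  and matrix_diff_ldistrib = bounded_bilinear.diff_right[OF bounded_bilinear_matrix_mult]
  and matrix_diff_rdistrib = bounded_bilinear.diff_left[OF bounded_bilinear_matrix_mult]
  and matrix_scaleR_left = bounded_bilinear.scaleR_left[OF bounded_bilinear_matrix_mult]
  and matrix_scaleR_right = bounded_bilinear.scaleR_right[OF bounded_bilinear_matrix_mult]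
  and matrix_mult_0_left = bounded_bilinear.zero_left[OF bounded_bilinear_matrix_mult]
  and matrix_mult_0_right = bounded_bilinear.zero_right[OF bounded_bilinear_matrix_mult]
  and matrix_minus_left = bounded_bilinear.minus_left[OF bounded_bilinear_matrix_mult]
  and matrix_minus_right = bounded_bilinear.minus_right[OF bounded_bilinear_matrix_mult]

lemma bounded_bilinear_matrix_vector_mult:
  "bounded_bilinear ((*v) :: real^'n^'m \<Rightarrow> real^'n \<Rightarrow> real^'m)"
  unfolding bilinear_conv_bounded_bilinear[symmetric] bilinear_def
  by (auto intro!: linearI simp: matrix_vector_mult_def vec_eq_iff algebra_simps sum.distrib
      sum_distrib_left)

lemma dot_matrix_vector_transpose: "x \<bullet> (A *v y) = (transpose A *v x) \<bullet> y"
  for A :: "real^'n^'m"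
  by (simp add: dot_lmul_matrix transpose_matrix_vector)

lemma matrix_inv_right: "A ** matrix_inv A = mat 1"
  and matrix_inv_left: "matrix_inv A ** A = mat 1" if "invertible A" for A :: "real^'n^'n"
proof -
  have "A ** matrix_inv A = mat 1 \<and> matrix_inv A ** A = mat 1"
    unfolding matrix_inv_def using that unfolding invertible_def by (rule someI_ex)
  then show "A ** matrix_inv A = mat 1" "matrix_inv A ** A = mat 1" by auto
qed

lemma invertibleI: "A ** B = mat 1 \<Longrightarrow> invertible A" for A :: "real^'n^'n"
  using invertible_right_inverse by blast

lemma matrix_inv_unique: "A ** B = mat 1 \<Longrightarrow> matrix_inv A = B" for A :: "real^'n^'n"
  by (metis invertibleI matrix_inv_left matrix_mul_assoc matrix_mul_lid matrix_mul_rid)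

lemma invertible_matrix_inv: "invertible A \<Longrightarrow> invertible (matrix_inv A)" for A :: "real^'n^'n"
  using invertibleI matrix_inv_left by blast

lemma invertible_transposeI: "invertible A \<Longrightarrow> invertible (transpose A)" for A :: "real^'n^'n"
  by (simp add: transpose_invertible)

lemma matrix_inv_transpose: "invertible A \<Longrightarrow> matrix_inv (transpose A) = transpose (matrix_inv A)"
  for A :: "real^'n^'n"
  by (metis matrix_inv_left matrix_inv_unique matrix_transpose_mul transpose_mat)

lemma matrix_inv_mult: "invertible A \<Longrightarrow> invertible B \<Longrightarrow>
    matrix_inv (A ** B) = matrix_inv B ** matrix_inv A" for A B :: "real^'n^'n"
  by (rule matrix_inv_unique) (metis matrix_inv_right matrix_mul_assoc matrix_mul_lid)

lemma matrix_inv_cancel: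
  fixes A :: "real^'n^'n" and X :: "real^'n^'m" and Y :: "real^'k^'n"
  assumes "invertible A"
  shows "X ** A ** matrix_inv A = X" "X ** matrix_inv A ** A = X"
    "A ** (matrix_inv A ** Y) = Y" "matrix_inv A ** (A ** Y) = Y"
  using matrix_inv_right[OF assms] matrix_inv_left[OF assms] matrix_mul_assoc[of X A "matrix_inv A"]
    matrix_mul_assoc[of X "matrix_inv A" A]
  by (simp_all add: matrix_mul_assoc)

lemma invertible_mult_eq_0: "invertible A \<Longrightarrow> A *v x = 0 \<Longrightarrow> x = 0" for A :: "real^'n^'n"
  by (metis matrix_inv_left matrix_vector_mul_assoc matrix_vector_mul_lid matrix_vector_mult_0_right)

lemma invertibleI_kernel: "(\<And>x. A *v x = 0 \<Longrightarrow> x = 0) \<Longrightarrow> invertible A" for A :: "real^'n^'n"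
  using invertible_left_inverse matrix_left_invertible_ker by blast


section \<open>Diagonal matrices\<close>

lemma diagm_mult: "diagm v ** diagm w = diagm (\<chi> i. v $ i * w $ i)"
  by (simp add: diagm_def matrix_matrix_mult_def vec_eq_iff if_distrib[of "\<lambda>x. x * _"] cong: if_cong)

lemma transpose_diagm [simp]: "transpose (diagm v) = diagm v"
  by (simp add: diagm_def transpose_def vec_eq_iff)

lemma det_diagm: "det (diagm v) = (\<Prod>i\<in>UNIV. v $ i)"
  by (subst det_diagonal) (simp_all add: diagm_def)

lemma trace_diagm: "trace (diagm v) = (\<Sum>i\<in>UNIV. v $ i)"
  by (simp add: trace_def diagm_def)

lemma diagm_one: "diagm (\<chi> i. 1) = mat 1"
  by (simp add: diagm_def mat_def vec_eq_iff)

lemma diagm_mult_vec: "diagm v *v x = (\<chi> i. v $ i * x $ i)"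
  by (simp add: diagm_def matrix_vector_mult_def vec_eq_iff if_distrib[of "\<lambda>x. x * _"] cong: if_cong)

lemma diagm_mult_left: "(diagm v ** A) $ i $ j = v $ i * A $ i $ j"
  by (simp add: diagm_def matrix_matrix_mult_def if_distrib[of "\<lambda>x. x * _"] cong: if_cong)

lemma diagm_mult_right: "(A ** diagm v) $ i $ j = A $ i $ j * v $ j"
  by (simp add: diagm_def matrix_matrix_mult_def if_distrib[of "\<lambda>x. _ * x"] cong: if_cong)

lemma linear_diagm: "linear (diagm :: real^'n \<Rightarrow> _)"
  by (rule linearI) (simp_all add: diagm_def vec_eq_iff)

lemma norm_diagm_power2: "(norm (diagm v))\<^sup>2 = (\<Sum>i\<in>UNIV. (v $ i)\<^sup>2)"
  unfolding power2_norm_eq_inner inner_matrix_trace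
  by (simp add: diagm_mult trace_diagm power2_eq_square)

lemma diagm_inv: "(\<And>i. v $ i \<noteq> 0) \<Longrightarrow> diagm v ** diagm (\<chi> i. inverse (v $ i)) = mat 1"
  by (simp add: diagm_mult diagm_one)


section \<open>The spectral theorem\<close>

text \<open>On the unit sphere of an invariant subspace the quadratic form attains its maximum, and at a
  maximizer the first-order condition is the eigenvector equation. Here the subspace is the
  orthogonal complement of a family of eigenvectors, so the family can be enlarged.\<close>

lemma symmetric_eigenvector_orthogonal:
  fixes P :: "real^'n^'n"
  assumes sym: "transpose P = P"
    and eig: "\<And>b. b \<in> B \<Longrightarrow> \<exists>c. P *v b = c *\<^sub>R b" and B: "finite B" "card B < CARD('n)"
  shows "\<exists>x c. norm x = 1 \<and> (\<forall>b\<in>B. b \<bullet> x = 0) \<and> P *v x = c *\<^sub>R x"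
proof -
  let ?W = "{x. \<forall>b\<in>B. b \<bullet> x = 0}"
  have swap: "x \<bullet> (P *v y) = (P *v x) \<bullet> y" for x y
    using dot_matrix_vector_transpose[of x P y] sym by simp
  have inv: "P *v x \<in> ?W" if "x \<in> ?W" for x
  proof safe
    fix b assume "b \<in> B"
    with eig obtain c where "P *v b = c *\<^sub>R b" by blast
    then show "b \<bullet> (P *v x) = 0" using that \<open>b \<in> B\<close> by (simp add: swap)
  qed
  have "dim (span B) < DIM(real^'n)"
    using dim_le_card'[OF B(1)] B(2) by simp
  then have "span B \<noteq> UNIV" using dim_UNIV by fastforce
  then obtain a where a: "a \<noteq> 0" "\<forall>x\<in>span B. a \<bullet> x = 0"
    using span_not_univ_subset_hyperplane[of B] by auto
  then have aW: "a \<in> ?W" by (auto simp: inner_commute span_base)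
  let ?K = "sphere 0 1 \<inter> ?W"
  have "closed ?W"
    unfolding Collect_ball_eq by (intro closed_INT ballI closed_hyperplane)
  then have K: "compact ?K" by (intro compact_Int_closed) auto
  have "a /\<^sub>R norm a \<in> ?K" using a aW by simp
  then have ne: "?K \<noteq> {}" by blast
  have cont: "continuous_on ?K (\<lambda>x. x \<bullet> (P *v x))"
  proof -
    have "continuous_on ?K ((*v) P)"
      by (rule linear_continuous_on[OF matrix_vector_mul_bounded_linear])
    then show ?thesis using continuous_on_inner continuous_on_id by blast
  qed
  from continuous_attains_sup[OF K ne cont]
  obtain x where x: "x \<in> ?K" "\<forall>y\<in>?K. y \<bullet> (P *v y) \<le> x \<bullet> (P *v x)" ..
  define c where "c = x \<bullet> (P *v x)"
  define w where "w = P *v x - c *\<^sub>R x"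
  have xx: "x \<bullet> x = 1" using x(1) by (simp add: norm_eq_1)
  have wW: "w \<in> ?W" using x(1) inv[of x] by (auto simp: w_def inner_diff_right)
  have quad: "y \<bullet> (P *v y) \<le> c * (y \<bullet> y)" if "y \<in> ?W" for y
  proof (cases "y = 0")
    case False
    then have "y /\<^sub>R norm y \<in> ?K" using that by simp
    from bspec[OF x(2) this] have "(y \<bullet> (P *v y)) / (norm y)\<^sup>2 \<le> c"
      by (simp add: c_def matrix_vector_mult_scaleR power2_eq_square divide_inverse mult_ac)
    then show ?thesis using False by (simp add: divide_le_eq power2_norm_eq_inner)
  qed simp
  have wx: "w \<bullet> x = 0" "x \<bullet> w = 0"
    by (simp_all add: w_def inner_diff_left inner_diff_right c_def xx inner_commute)
  have wPx: "w \<bullet> (P *v x) = w \<bullet> w"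
    using wx by (simp add: w_def inner_diff_right)
  have ineq: "2 * t * (w \<bullet> w) \<le> t\<^sup>2 * (c * (w \<bullet> w) - w \<bullet> (P *v w))" for t
  proof -
    have "(x + t *\<^sub>R w) \<bullet> (P *v (x + t *\<^sub>R w)) \<le> c * ((x + t *\<^sub>R w) \<bullet> (x + t *\<^sub>R w))"
      using x(1) wW by (intro quad) (auto simp: inner_add_right)
    moreover have "x \<bullet> (P *v w) = w \<bullet> w" using wPx swap[of x w] by (simp only: inner_commute)
    ultimately show ?thesis using wx
      by (simp add: matrix_vector_right_distrib matrix_vector_mult_scaleR inner_add_left
          inner_add_right c_def[symmetric] xx wPx power2_eq_square algebra_simps)
  qed
  have "w \<bullet> w = 0"
  proof (rule ccontr)
    assume "w \<bullet> w \<noteq> 0"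
    then have pos: "w \<bullet> w > 0" by (simp add: less_le)
    define D where "D = \<bar>c * (w \<bullet> w) - w \<bullet> (P *v w)\<bar> + 1"
    have D: "D > 0" "c * (w \<bullet> w) - w \<bullet> (P *v w) \<le> D" by (auto simp: D_def)
    define t where "t = (w \<bullet> w) / D"
    have t: "t > 0" using D pos by (simp add: t_def)
    have "2 * t * (w \<bullet> w) \<le> t\<^sup>2 * D"
      using ineq[of t] D(2) by (meson mult_left_mono order_trans zero_le_power2)
    also have "t\<^sup>2 * D = t * (w \<bullet> w)" using D by (simp add: t_def power2_eq_square)
    finally show False using t pos by (simp add: mult_pos_pos)
  qed
  then have "P *v x = c *\<^sub>R x" by (simp add: w_def)
  then show ?thesis using x(1) by (auto simp: dist_norm)
qed

lemma orthonormal_eigenvectors_exist: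
  fixes P :: "real^'n^'n"
  assumes sym: "transpose P = P" and "k \<le> CARD('n)"
  shows "\<exists>B. finite B \<and> card B = k \<and> pairwise orthogonal B \<and>
    (\<forall>b\<in>B. norm b = 1 \<and> (\<exists>c. P *v b = c *\<^sub>R b))"
  using \<open>k \<le> CARD('n)\<close>
proof (induction k)
  case 0
  show ?case by (intro exI[of _ "{}"]) auto
next
  case (Suc k)
  then obtain B where B: "finite B" "card B = k" "pairwise orthogonal B"
    "\<forall>b\<in>B. norm b = 1 \<and> (\<exists>c. P *v b = c *\<^sub>R b)" by auto
  obtain x c where x: "norm x = 1" "\<forall>b\<in>B. b \<bullet> x = 0" "P *v x = c *\<^sub>R x"
    using symmetric_eigenvector_orthogonal[OF sym, of B] B Suc.prems by auto
  have "x \<notin> B" using x by (auto simp: norm_eq_1)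
  moreover have "\<forall>b\<in>B. orthogonal x b \<and> orthogonal b x"
    using x(2) by (simp add: orthogonal_def inner_commute)
  ultimately show ?case using B x
    by (intro exI[of _ "insert x B"]) (auto simp: pairwise_insert)
qed

theorem spectral_theorem:
  fixes P :: "real^'n^'n"
  assumes "transpose P = P"
  shows "\<exists>R v. orthogonal_matrix R \<and> P = R ** diagm v ** transpose R"
proof -
  obtain B where B: "finite B" "card B = CARD('n)" "pairwise orthogonal B"
    "\<forall>b\<in>B. norm b = 1 \<and> (\<exists>c. P *v b = c *\<^sub>R b)"
    using orthonormal_eigenvectors_exist[OF assms order_refl] by blast
  obtain e :: "'n \<Rightarrow> _" where e: "bij_betw e UNIV B"
    using finite_same_card_bij[of "UNIV :: 'n set" B] B(1,2) by auto
  have eB: "e i \<in> B" for i using e by (auto simp: bij_betw_def)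
  have eq: "e i = e j \<longleftrightarrow> i = j" for i j using e by (auto simp: bij_betw_def inj_on_def)
  have "\<forall>i. \<exists>c. P *v e i = c *\<^sub>R e i"
    by (rule allI) (rule conjunct2[OF bspec[OF B(4) eB]])
  from choice[OF this] obtain v where v: "\<forall>i. P *v e i = v i *\<^sub>R e i" ..
  define R where "R = (\<chi> i j. e j $ i)"
  have col: "column j R = e j" for j by (simp add: R_def column_def vec_eq_iff)
  have R: "orthogonal_matrix R"
    unfolding orthogonal_matrix_orthonormal_columns using B eB eq
    by (auto simp: col pairwise_def)
  have "P ** R = R ** diagm (\<chi> i. v i)"
  proof -
    have "(P ** R) $ i $ j = (R ** diagm (\<chi> i. v i)) $ i $ j" for i j
    proof -
      have "(P ** R) $ i $ j = (P *v e j) $ i"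
        by (simp add: matrix_matrix_mult_def matrix_vector_mult_def R_def)
      then show ?thesis by (simp add: v diagm_mult_right R_def mult_ac)
    qed
    then show ?thesis by (simp add: vec_eq_iff)
  qed
  then have "P ** (R ** transpose R) = R ** diagm (\<chi> i. v i) ** transpose R"
    by (simp add: matrix_mul_assoc)
  then have "P = R ** diagm (\<chi> i. v i) ** transpose R"
    using R by (simp add: orthogonal_matrix_def)
  with R show ?thesis by (intro exI conjI)
qed


lemma orthogonal_matrixD: "orthogonal_matrix R \<Longrightarrow> transpose R ** R = mat 1"
  "orthogonal_matrix R \<Longrightarrow> R ** transpose R = mat 1" for R :: "real^'n^'n"
  by (simp_all add: orthogonal_matrix_def)

lemma orthogonal_matrix_invertible: "orthogonal_matrix R \<Longrightarrow> invertible R" for R :: "real^'n^'n"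
  using invertibleI orthogonal_matrixD(2) by blast

lemma orthogonal_matrix_square_det: "orthogonal_matrix R \<Longrightarrow> det R * det R = 1" for R :: "real^'n^'n"
  by (metis det_I det_mul det_transpose orthogonal_matrixD(1))

lemma det_congruence: "det (G ** D ** transpose G) = (det G)\<^sup>2 * det D" for G :: "real^'n^'n"
  by (simp add: det_mul power2_eq_square)


section \<open>Functional calculus of symmetric matrices\<close>

text \<open>The matrix \<open>X = R'\<^sup>T W R\<close> intertwines two diagonal matrices, so \<open>X\<^sub>i\<^sub>j \<noteq> 0\<close>
  only where the corresponding eigenvalues agree; there the values of \<open>g\<close> agree as well. The
  case \<open>W = 1\<close> gives the independence of the functional calculus of the diagonalization. A
  rectangular index type for \<open>W\<close> is what the change of coordinates by \<open>[U, V]\<close> needs.\<close>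

lemma diagonalization_intertwine:
  fixes R :: "real^'a^'a" and R' :: "real^'b^'b" and W :: "real^'a^'b"
  assumes R: "orthogonal_matrix R" and R': "orthogonal_matrix R'"
    and eq: "R' ** diagm v' ** transpose R' ** W = W ** (R ** diagm v ** transpose R)"
  shows "R' ** diagm (\<chi> i. g (v' $ i)) ** transpose R' ** W =
    W ** (R ** diagm (\<chi> i. g (v $ i)) ** transpose R)"
proof -
  define X where "X = transpose R' ** W ** R"
  have "transpose R' ** (R' ** diagm v' ** transpose R' ** W) ** R =
      (transpose R' ** R') ** diagm v' ** X"
    by (simp add: X_def matrix_mul_assoc)
  moreover have "transpose R' ** (W ** (R ** diagm v ** transpose R)) ** R =
      X ** diagm v ** (transpose R ** R)"
    by (simp add: X_def matrix_mul_assoc)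
  ultimately have "diagm v' ** X = X ** diagm v"
    using eq by (simp add: orthogonal_matrixD[OF R] orthogonal_matrixD[OF R'])
  then have ent: "v' $ i * X $ i $ j = X $ i $ j * v $ j" for i j
    by (metis diagm_mult_left diagm_mult_right)
  have "diagm (\<chi> i. g (v' $ i)) ** X = X ** diagm (\<chi> i. g (v $ i))"
  proof -
    have "g (v' $ i) * X $ i $ j = X $ i $ j * g (v $ j)" for i j
      using ent[of i j] by (cases "X $ i $ j = 0") auto
    then show ?thesis by (simp add: vec_eq_iff diagm_mult_left diagm_mult_right)
  qed
  then have "R' ** (diagm (\<chi> i. g (v' $ i)) ** X) ** transpose R =
      R' ** (X ** diagm (\<chi> i. g (v $ i))) ** transpose R"
    by simp
  moreover have "R' ** (diagm (\<chi> i. g (v' $ i)) ** X) ** transpose R =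
      R' ** diagm (\<chi> i. g (v' $ i)) ** transpose R' ** W ** (R ** transpose R)"
    by (simp add: X_def matrix_mul_assoc)
  moreover have "R' ** (X ** diagm (\<chi> i. g (v $ i))) ** transpose R =
      (R' ** transpose R') ** W ** (R ** diagm (\<chi> i. g (v $ i)) ** transpose R)"
    by (simp add: X_def matrix_mul_assoc)
  ultimately show ?thesis
    by (simp add: orthogonal_matrixD[OF R] orthogonal_matrixD[OF R'])
qed

lemma sym_fun_eq:
  fixes R :: "real^'n^'n"
  assumes R: "orthogonal_matrix R"
  shows "sym_fun g (R ** diagm v ** transpose R) = R ** diagm (\<chi> i. g (v $ i)) ** transpose R"
  unfolding sym_fun_def
proof (rule the_equality)
  show "\<exists>R' w. orthogonal_matrix R' \<and> R ** diagm v ** transpose R = R' ** diagm w ** transpose R' \<and>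
      R ** diagm (\<chi> i. g (v $ i)) ** transpose R = R' ** diagm (\<chi> i. g (w $ i)) ** transpose R'"
    using R by (intro exI[of _ R] exI[of _ v]) simp
next
  fix Y assume "\<exists>R' w. orthogonal_matrix R' \<and>
      R ** diagm v ** transpose R = R' ** diagm w ** transpose R' \<and>
      Y = R' ** diagm (\<chi> i. g (w $ i)) ** transpose R'"
  then obtain R' w where R': "orthogonal_matrix R'"
    and eq: "R ** diagm v ** transpose R = R' ** diagm w ** transpose R'"
    and Y: "Y = R' ** diagm (\<chi> i. g (w $ i)) ** transpose R'" by auto
  show "Y = R ** diagm (\<chi> i. g (v $ i)) ** transpose R"
    using diagonalization_intertwine[OF R R', of w "mat 1" v g] eq Y by simp
qed

lemma sym_fun_conjugate:
  fixes P :: "real^'a^'a" and W :: "real^'a^'b"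
  assumes P: "transpose P = P" and W: "transpose W ** W = mat 1" "W ** transpose W = mat 1"
  shows "sym_fun g (W ** P ** transpose W) = W ** sym_fun g P ** transpose W"
proof -
  obtain R v where R: "orthogonal_matrix R" and P_eq: "P = R ** diagm v ** transpose R"
    using spectral_theorem[OF P] by auto
  have "transpose (W ** P ** transpose W) = W ** P ** transpose W"
    by (simp add: matrix_transpose_mul P matrix_mul_assoc)
  then obtain R' v' where R': "orthogonal_matrix R'"
    and eq: "W ** P ** transpose W = R' ** diagm v' ** transpose R'"
    using spectral_theorem[of "W ** P ** transpose W"] by auto
  have "R' ** diagm v' ** transpose R' ** W = W ** P ** (transpose W ** W)"
    unfolding eq[symmetric] by (simp add: matrix_mul_assoc)
  then have "R' ** diagm v' ** transpose R' ** W = W ** (R ** diagm v ** transpose R)"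
    by (simp add: W P_eq)
  from diagonalization_intertwine[OF R R' this, of g]
  have "sym_fun g (W ** P ** transpose W) ** W = W ** sym_fun g P"
    unfolding eq sym_fun_eq[OF R'] unfolding P_eq sym_fun_eq[OF R] .
  then have "sym_fun g (W ** P ** transpose W) ** (W ** transpose W) = W ** sym_fun g P ** transpose W"
    by (simp add: matrix_mul_assoc)
  then show ?thesis by (simp add: W)
qed

lemma orthogonal_conjugate_card:
  fixes W :: "real^'a^'b"
  assumes "transpose W ** W = mat 1" "W ** transpose W = mat 1"
  shows "CARD('a) = CARD('b)"
proof -
  have "trace (mat 1 :: real^'a^'a) = trace (mat 1 :: real^'b^'b)"
    using trace_mul_sym[of W "transpose W"] assms by simp
  then show ?thesis by (simp add: trace_I)
qed

lemma norm_orthogonal_conjugate: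
  fixes W :: "real^'a^'b" and P :: "real^'a^'a"
  assumes W: "transpose W ** W = mat 1"
  shows "norm (W ** P ** transpose W) = norm P"
proof -
  have "(W ** P ** transpose W) \<bullet> (W ** P ** transpose W) =
      (P ** transpose W) \<bullet> (transpose W ** W ** (P ** transpose W))"
    unfolding matrix_mul_assoc[symmetric] inner_matrix_mult_left ..
  also have "\<dots> = P \<bullet> (P ** (transpose W ** W))"
    by (simp add: W inner_matrix_mult_right flip: matrix_mul_assoc)
  finally show ?thesis by (simp add: W norm_eq_sqrt_inner)
qed

text \<open>The determinant of a matrix over another index type is compared through the eigenvalues,
  which are merely reindexed by a bijection.\<close>

lemma det_orthogonal_conjugate:
  fixes P :: "real^'a^'a" and W :: "real^'a^'b"
  assumes P: "transpose P = P" and W: "transpose W ** W = mat 1" "W ** transpose W = mat 1"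
  shows "det (W ** P ** transpose W) = det P"
proof -
  obtain R v where R: "orthogonal_matrix R" and P_eq: "P = R ** diagm v ** transpose R"
    using spectral_theorem[OF P] by auto
  obtain \<beta> :: "'b \<Rightarrow> 'a" where \<beta>: "bij_betw \<beta> UNIV UNIV"
    using finite_same_card_bij[of "UNIV :: 'b set" "UNIV :: 'a set"] orthogonal_conjugate_card[OF W]
    by auto
  have reindex: "(\<Sum>j\<in>UNIV. f (\<beta> j)) = (\<Sum>k\<in>UNIV. f k)" for f :: "'a \<Rightarrow> real"
    by (rule sum.reindex_bij_betw[OF \<beta>])
  define Y where "Y = W ** R"
  define Y' where "Y' = (\<chi> i j. Y $ i $ \<beta> j)"
  have entry: "(Y' ** diagm (\<chi> j. w (\<beta> j)) ** transpose Y') $ i $ k =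
      (Y ** diagm (\<chi> j. w j) ** transpose Y) $ i $ k" for w i k
  proof -
    have "(Y' ** diagm (\<chi> j. w (\<beta> j)) ** transpose Y') $ i $ k =
        (\<Sum>j\<in>UNIV. Y $ i $ \<beta> j * w (\<beta> j) * Y $ k $ \<beta> j)"
      by (subst matrix_matrix_mult_def) (simp add: diagm_mult_right transpose_def Y'_def)
    also have "\<dots> = (\<Sum>j\<in>UNIV. Y $ i $ j * w j * Y $ k $ j)"
      by (rule reindex)
    also have "\<dots> = (Y ** diagm (\<chi> j. w j) ** transpose Y) $ i $ k"
      by (subst matrix_matrix_mult_def) (simp add: diagm_mult_right transpose_def)
    finally show ?thesis .
  qed
  have eq: "Y' ** diagm (\<chi> j. w (\<beta> j)) ** transpose Y' = Y ** diagm (\<chi> j. w j) ** transpose Y" for w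
    by (simp add: vec_eq_iff entry)
  have "Y ** transpose Y = W ** (R ** transpose R) ** transpose W"
    by (simp add: Y_def matrix_transpose_mul matrix_mul_assoc)
  then have "Y ** transpose Y = mat 1" by (simp add: orthogonal_matrixD[OF R] W)
  then have "Y' ** transpose Y' = mat 1" using eq[of "\<lambda>_. 1"] by (simp add: diagm_one)
  then have Y': "(det Y')\<^sup>2 = 1" by (metis det_I det_mul det_transpose power2_eq_square)
  have "W ** P ** transpose W = Y ** diagm v ** transpose Y"
    by (simp add: P_eq Y_def matrix_transpose_mul matrix_mul_assoc)
  also have "\<dots> = Y' ** diagm (\<chi> j. v $ \<beta> j) ** transpose Y'"
    using eq[of "\<lambda>j. v $ j"] by simp
  finally have "det (W ** P ** transpose W) = (\<Prod>j\<in>UNIV. v $ \<beta> j)"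
    by (simp only: det_congruence Y' det_diagm mult_1 vec_lambda_beta)
  also have "\<dots> = (\<Prod>j\<in>UNIV. v $ j)" by (rule prod.reindex_bij_betw[OF \<beta>])
  also have "\<dots> = det P"
    using orthogonal_matrix_square_det[OF R]
    by (simp only: P_eq det_congruence det_diagm power2_eq_square mult_1)
  finally show ?thesis .
qed


section \<open>Positive definite matrices\<close>

text \<open>A condition on the quadratic form alone cuts out an open set in the space of all matrices, and on
  this set the matrix logarithm can be differentiated.\<close>

definition posdef :: "real^'n^'n \<Rightarrow> bool" where
  "posdef K \<longleftrightarrow> (\<forall>x. x \<noteq> 0 \<longrightarrow> x \<bullet> (K *v x) > 0)"

lemma spd_iff_posdef: "spd P \<longleftrightarrow> transpose P = P \<and> posdef P"
  by (simp add: spd_def posdef_def)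

lemma posdef_invertible: "posdef K \<Longrightarrow> invertible K"
  by (rule invertibleI_kernel) (metis inner_zero_right less_irrefl posdef_def)

lemma spd_invertible: "spd P \<Longrightarrow> invertible P"
  by (simp add: posdef_invertible spd_iff_posdef)

lemma spd_transpose: "spd P \<Longrightarrow> transpose P = P"
  by (simp add: spd_def)

lemma posdef_congruence:
  fixes G :: "real^'a^'b"
  assumes "posdef K" and "\<And>x. transpose G *v x = 0 \<Longrightarrow> x = 0"
  shows "posdef (G ** K ** transpose G)"
  unfolding posdef_def
proof (intro allI impI)
  fix x :: "real^'b" assume "x \<noteq> 0"
  have "x \<bullet> ((G ** K ** transpose G) *v x) = (transpose G *v x) \<bullet> (K *v (transpose G *v x))"
    unfolding matrix_vector_mul_assoc[symmetric] dot_matrix_vector_transpose[of x G] ..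
  then show "0 < x \<bullet> ((G ** K ** transpose G) *v x)"
    using assms \<open>x \<noteq> 0\<close> unfolding posdef_def by metis
qed

lemma posdef_congruence_invertible:
  "posdef K \<Longrightarrow> invertible G \<Longrightarrow> posdef (G ** K ** transpose G)" for G :: "real^'n^'n"
  by (rule posdef_congruence, assumption, erule invertible_mult_eq_0[OF invertible_transposeI])

lemma spd_congruence: "spd K \<Longrightarrow> invertible G \<Longrightarrow> spd (G ** K ** transpose G)" for G :: "real^'n^'n"
  by (simp add: spd_iff_posdef posdef_congruence_invertible matrix_transpose_mul matrix_mul_assoc)

lemma spd_orthogonal_conjugate:
  fixes W :: "real^'a^'b"
  assumes "spd K" "W ** transpose W = mat 1"
  shows "spd (W ** K ** transpose W)"
proof -
  have "x = 0" if "transpose W *v x = 0" for x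
    by (metis that assms(2) matrix_vector_mul_assoc matrix_vector_mul_lid matrix_vector_mult_0_right)
  then show ?thesis using assms(1)
    by (auto simp: spd_iff_posdef matrix_transpose_mul matrix_mul_assoc intro!: posdef_congruence)
qed

lemma axis_diagm_axis: "axis i 1 \<bullet> (diagm v *v axis i 1) = v $ i"
  by (simp add: diagm_mult_vec inner_axis')

lemma spd_diagm: "spd (diagm v) \<longleftrightarrow> (\<forall>i. v $ i > 0)"
proof
  assume "spd (diagm v)"
  then have "axis i 1 \<bullet> (diagm v *v axis i 1) > 0" for i
    by (auto simp: spd_def axis_eq_0_iff)
  then show "\<forall>i. v $ i > 0" by (simp add: axis_diagm_axis)
next
  assume v: "\<forall>i. v $ i > 0"
  show "spd (diagm v)" unfolding spd_def
  proof (intro conjI allI impI)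
    fix x :: "real^'a" assume "x \<noteq> 0"
    then obtain k where k: "x $ k \<noteq> 0" by (auto simp: vec_eq_iff)
    have "x \<bullet> (diagm v *v x) = (\<Sum>i\<in>UNIV. v $ i * (x $ i)\<^sup>2)"
      by (simp add: diagm_mult_vec inner_vec_def power2_eq_square mult_ac)
    also have "\<dots> > 0"
      using v k by (intro sum_pos2[of _ k]) (auto simp: less_imp_le)
    finally show "0 < x \<bullet> (diagm v *v x)" .
  qed simp
qed

lemma spd_diagonalization:
  fixes P :: "real^'n^'n"
  assumes "spd P"
  obtains R v where "orthogonal_matrix R" "P = R ** diagm v ** transpose R" "\<And>i. v $ i > 0"
proof -
  obtain R v where R: "orthogonal_matrix R" and P: "P = R ** diagm v ** transpose R"
    using spectral_theorem[OF spd_transpose[OF assms]] by auto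
  have "spd (transpose R ** P ** transpose (transpose R))"
    using assms orthogonal_matrix_invertible[OF R] by (intro spd_congruence invertible_transposeI)
  also have "transpose R ** P ** transpose (transpose R) =
      (transpose R ** R) ** diagm v ** (transpose R ** R)"
    by (simp add: P matrix_mul_assoc)
  finally have "\<forall>i. v $ i > 0" by (simp add: orthogonal_matrixD[OF R] spd_diagm)
  then show thesis using that R P by blast
qed

lemma spd_of_diagonal: "orthogonal_matrix R \<Longrightarrow> (\<And>i. v $ i > 0) \<Longrightarrow> spd (R ** diagm v ** transpose R)"
  by (intro spd_congruence orthogonal_matrix_invertible) (auto simp: spd_diagm)

lemma det_orthogonal_diagonal: "orthogonal_matrix R \<Longrightarrow>
    det (R ** diagm v ** transpose R) = (\<Prod>i\<in>UNIV. v $ i)" for R :: "real^'n^'n"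
  using orthogonal_matrix_square_det[of R] by (simp only: det_congruence det_diagm power2_eq_square mult_1)

lemma spd_det_pos: "spd P \<Longrightarrow> det P > 0"
  by (rule spd_diagonalization[of P]) (auto simp: det_orthogonal_diagonal intro!: prod_pos)

lemma matrix_inv_diagonalization:
  fixes R :: "real^'n^'n"
  assumes R: "orthogonal_matrix R" and v: "\<And>i. v $ i \<noteq> 0"
  shows "matrix_inv (R ** diagm v ** transpose R) = R ** diagm (\<chi> i. inverse (v $ i)) ** transpose R"
proof (rule matrix_inv_unique)
  have "R ** diagm v ** transpose R ** (R ** diagm (\<chi> i. inverse (v $ i)) ** transpose R) =
      R ** diagm v ** (transpose R ** R) ** diagm (\<chi> i. inverse (v $ i)) ** transpose R"
    by (simp add: matrix_mul_assoc)
  also have "\<dots> = R ** (diagm v ** diagm (\<chi> i. inverse (v $ i))) ** transpose R"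
    by (simp add: orthogonal_matrixD[OF R] matrix_mul_assoc)
  also have "\<dots> = mat 1"
    using v by (subst diagm_inv) (simp_all add: orthogonal_matrixD[OF R])
  finally show "R ** diagm v ** transpose R ** (R ** diagm (\<chi> i. inverse (v $ i)) ** transpose R) = mat 1" .
qed

lemma spd_matrix_inv: "spd P \<Longrightarrow> spd (matrix_inv P)"
  by (rule spd_diagonalization[of P])
    (auto simp: matrix_inv_diagonalization less_imp_neq[symmetric] intro!: spd_of_diagonal)

lemma transpose_matrix_inv_spd: "spd P \<Longrightarrow> transpose (matrix_inv P) = matrix_inv P"
  by (simp add: spd_matrix_inv spd_transpose)

text \<open>Diagonalizing \<open>H\<^sup>-\<^sup>1 X H\<^sup>-\<^sup>T\<close> for a square root \<open>P = H H\<^sup>T\<close> puts \<open>P\<close> and \<open>X\<close> in diagonal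
  form at the same time. All geodesics below are written in such a frame.\<close>

lemma simultaneous_diagonalization:
  fixes P :: "real^'n^'n"
  assumes P: "spd P" and X: "transpose X = X"
  obtains G :: "real^'n^'n" and x where "invertible G" "P = G ** transpose G" "X = G ** diagm x ** transpose G"
proof -
  obtain R v where R: "orthogonal_matrix R" and P_eq: "P = R ** diagm v ** transpose R"
    and v: "\<And>i. v $ i > 0" using spd_diagonalization[OF P] by blast
  define H where "H = R ** diagm (\<chi> i. sqrt (v $ i))"
  have HH: "H ** transpose H = P"
  proof -
    have "H ** transpose H = R ** (diagm (\<chi> i. sqrt (v $ i)) ** diagm (\<chi> i. sqrt (v $ i))) ** transpose R"
      by (simp add: H_def matrix_transpose_mul matrix_mul_assoc)
    then show ?thesis using v by (simp add: P_eq diagm_mult less_imp_le)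
  qed
  have "diagm (\<chi> i. sqrt (v $ i)) ** diagm (\<chi> i. inverse (sqrt (v $ i))) = mat 1"
    using diagm_inv[of "\<chi> i. sqrt (v $ i)"] v by (simp add: less_imp_neq[symmetric])
  then have H: "invertible H"
    unfolding H_def using invertibleI orthogonal_matrix_invertible[OF R] invertible_mult by blast
  define Y where "Y = matrix_inv H ** X ** transpose (matrix_inv H)"
  have "transpose Y = Y" by (simp add: Y_def matrix_transpose_mul X matrix_mul_assoc)
  then obtain R' x where R': "orthogonal_matrix R'" and Y_eq: "Y = R' ** diagm x ** transpose R'"
    using spectral_theorem[of Y] by auto
  define G where "G = H ** R'"
  have "invertible G" unfolding G_def using H R' orthogonal_matrix_invertible invertible_mult by blast
  moreover have "G ** transpose G = H ** (R' ** transpose R') ** transpose H"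
    by (simp add: G_def matrix_transpose_mul matrix_mul_assoc)
  then have "P = G ** transpose G" by (simp add: orthogonal_matrixD[OF R'] HH)
  moreover have "G ** diagm x ** transpose G = H ** Y ** transpose H"
    by (simp add: G_def Y_eq matrix_transpose_mul matrix_mul_assoc)
  then have "G ** diagm x ** transpose G =
      (H ** matrix_inv H) ** X ** (transpose (H ** matrix_inv H))"
    by (simp add: Y_def matrix_transpose_mul matrix_mul_assoc)
  then have "X = G ** diagm x ** transpose G" by (simp add: matrix_inv_right[OF H])
  ultimately show thesis by (rule that)
qed

lemma spd_powr_minus_half:
  fixes P :: "real^'n^'n"
  assumes "spd P"
  defines "Z \<equiv> spd_powr P (-1/2)"
  shows "transpose Z = Z" "Z ** P ** Z = mat 1" "invertible Z"
proof -
  obtain R v where R: "orthogonal_matrix R" and P_eq: "P = R ** diagm v ** transpose R"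
    and v: "\<And>i. v $ i > 0" using spd_diagonalization[OF assms(1)] by blast
  define z where "z = (\<chi> i. (v $ i) powr (-1/2))"
  have Z: "Z = R ** diagm z ** transpose R"
    unfolding Z_def spd_powr_def P_eq sym_fun_eq[OF R] z_def ..
  show "transpose Z = Z" by (simp add: Z matrix_transpose_mul matrix_mul_assoc)
  have "z $ i * v $ i * z $ i = 1" for i
  proof -
    have "z $ i * v $ i * z $ i = v $ i powr (-1/2) * v $ i powr 1 * v $ i powr (-1/2)"
      using v[of i] by (simp add: z_def)
    also have "\<dots> = v $ i powr 0" by (simp only: powr_add[symmetric]) simp
    finally show ?thesis using v[of i] by simp
  qed
  then have zvz: "diagm z ** diagm v ** diagm z = mat 1"
    by (simp add: diagm_mult flip: diagm_one)
  have "Z ** P ** Z = R ** diagm z ** (transpose R ** R) ** diagm v ** (transpose R ** R) ** diagm z ** transpose R"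
    by (simp add: Z P_eq matrix_mul_assoc)
  also have "\<dots> = R ** (diagm z ** diagm v ** diagm z) ** transpose R"
    by (simp add: orthogonal_matrixD[OF R] matrix_mul_assoc)
  finally show ZPZ: "Z ** P ** Z = mat 1" by (simp add: zvz orthogonal_matrixD[OF R])
  show "invertible Z" using ZPZ by (metis invertibleI matrix_mul_assoc)
qed

text \<open>The eigenvalues are nonnegative and their product does not vanish. This is why \<^const>\<open>spd1\<close> is
  closed, although \<^const>\<open>spd\<close> is not.\<close>

lemma spd_if_semidefinite:
  fixes P :: "real^'n^'n"
  assumes sym: "transpose P = P" and nn: "\<And>x. x \<bullet> (P *v x) \<ge> 0" and det: "det P \<noteq> 0"
  shows "spd P"
proof -
  obtain R v where R: "orthogonal_matrix R" and P: "P = R ** diagm v ** transpose R"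
    using spectral_theorem[OF sym] by auto
  have "v $ i \<ge> 0" for i
  proof -
    have "diagm v *v axis i 1 = (transpose R ** R ** diagm v ** (transpose R ** R)) *v axis i 1"
      by (simp add: orthogonal_matrixD[OF R])
    also have "\<dots> = transpose R *v (P *v (R *v axis i 1))"
      by (simp add: P matrix_vector_mul_assoc matrix_mul_assoc)
    finally have "axis i 1 \<bullet> (diagm v *v axis i 1) = (R *v axis i 1) \<bullet> (P *v (R *v axis i 1))"
      by (simp add: dot_matrix_vector_transpose)
    then show ?thesis using nn by (simp add: axis_diagm_axis)
  qed
  moreover have "v $ i \<noteq> 0" for i
    using det by (simp add: P det_orthogonal_diagonal[OF R])
  ultimately show ?thesis
    unfolding P by (intro spd_of_diagonal R) (metis less_eq_real_def)
qed

lemma closed_spd1: "closed (spd1 :: (real^'n^'n) set)"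
proof -
  have eq: "spd1 = {P :: real^'n^'n. transpose P = P} \<inter> (\<Inter>x. {P. x \<bullet> (P *v x) \<ge> 0}) \<inter> {P. det P = 1}"
  proof -
    have "x \<bullet> (P *v x) \<ge> 0" if "spd P" for x and P :: "real^'n^'n"
      using that by (cases "x = 0") (auto simp: spd_def less_imp_le)
    then show ?thesis by (auto simp: spd1_def spd_transpose intro: spd_if_semidefinite)
  qed
  have "continuous_on UNIV (\<lambda>P :: real^'n^'n. x \<bullet> (P *v x))" for x
    by (intro continuous_on_inner continuous_on_const linear_continuous_on
        bounded_bilinear.bounded_linear_left[OF bounded_bilinear_matrix_vector_mult])
  then have "closed (\<Inter>x. {P :: real^'n^'n. x \<bullet> (P *v x) \<ge> 0})"
    by (intro closed_INT ballI closed_Collect_le continuous_on_const)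
  moreover have "continuous_on UNIV (\<lambda>P :: real^'n^'n. det P)"
    unfolding det_def by (intro continuous_intros)
  then have "closed {P :: real^'n^'n. det P = 1}"
    by (intro closed_Collect_eq continuous_on_const)
  moreover have "closed {P :: real^'n^'n. transpose P = P}"
    using linear_transpose by (intro closed_Collect_eq continuous_on_id linear_continuous_on)
      (simp add: linear_conv_bounded_linear)
  ultimately show ?thesis unfolding eq by (intro closed_Int)
qed

lemma mat_1_spd1: "mat 1 \<in> spd1"
  by (simp add: spd1_def spd_def)


section \<open>Continuously differentiable maps\<close>

text \<open>Continuity of the derivative is asked for direction by direction. In finite dimension this is
  equivalent to continuity in the operator norm, and it is much easier to check.\<close>

definition cont_diff_on :: "('a::euclidean_space \<Rightarrow> 'b::euclidean_space) \<Rightarrow> 'a set \<Rightarrow> bool" where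
  "cont_diff_on f U \<longleftrightarrow> (\<exists>f'. (\<forall>x\<in>U. (f has_derivative f' x) (at x)) \<and>
     (\<forall>v. continuous_on U (\<lambda>x. f' x v)))"

lemma cont_diff_onI:
  assumes "\<And>x. x \<in> U \<Longrightarrow> (f has_derivative f' x) (at x)" "\<And>v. continuous_on U (\<lambda>x. f' x v)"
  shows "cont_diff_on f U"
  using assms unfolding cont_diff_on_def by blast

lemma cont_diff_onE:
  assumes "cont_diff_on f U"
  obtains f' where "\<And>x. x \<in> U \<Longrightarrow> (f has_derivative f' x) (at x)" "\<And>v. continuous_on U (\<lambda>x. f' x v)"
  using assms unfolding cont_diff_on_def by auto

lemma cont_diff_on_differentiable: "cont_diff_on f U \<Longrightarrow> x \<in> U \<Longrightarrow> f differentiable (at x)"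
  unfolding cont_diff_on_def differentiable_def by blast

lemma cont_diff_on_continuous:
  assumes "cont_diff_on f U"
  shows "continuous_on U f"
  using assms unfolding cont_diff_on_def
  by (meson continuous_at_imp_continuous_on has_derivative_continuous)

lemma cont_diff_on_subset: "cont_diff_on f U \<Longrightarrow> V \<subseteq> U \<Longrightarrow> cont_diff_on f V"
  unfolding cont_diff_on_def by (meson continuous_on_subset subsetD)

lemma cont_diff_on_const: "cont_diff_on (\<lambda>x. c) U"
  by (rule cont_diff_onI[where f' = "\<lambda>x h. 0"]) simp_all

lemma cont_diff_on_bounded_linear: "bounded_linear f \<Longrightarrow> cont_diff_on f U"
  by (rule cont_diff_onI[where f' = "\<lambda>x. f"])
    (simp_all add: bounded_linear_imp_has_derivative)

lemma cont_diff_on_linear: "linear f \<Longrightarrow> cont_diff_on f U"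
  by (simp add: cont_diff_on_bounded_linear linear_conv_bounded_linear)

lemma cont_diff_on_compose:
  assumes "cont_diff_on g V" "cont_diff_on f U" "f ` U \<subseteq> V"
  shows "cont_diff_on (\<lambda>x. g (f x)) U"
proof -
  obtain f' where f': "\<And>x. x \<in> U \<Longrightarrow> (f has_derivative f' x) (at x)" "\<And>v. continuous_on U (\<lambda>x. f' x v)"
    using cont_diff_onE[OF assms(2)] by blast
  obtain g' where g': "\<And>x. x \<in> V \<Longrightarrow> (g has_derivative g' x) (at x)" "\<And>v. continuous_on V (\<lambda>x. g' x v)"
    using cont_diff_onE[OF assms(1)] by blast
  show ?thesis
  proof (rule cont_diff_onI[where f' = "\<lambda>x h. g' (f x) (f' x h)"])
    fix x assume "x \<in> U"
    then show "((\<lambda>x. g (f x)) has_derivative (\<lambda>h. g' (f x) (f' x h))) (at x)"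
      using assms(3) by (intro has_derivative_compose[OF f'(1) g'(1)]) auto
  next
    fix v
    have "g' (f x) (f' x v) = (\<Sum>b\<in>Basis. (f' x v \<bullet> b) *\<^sub>R g' (f x) b)" if "x \<in> U" for x
    proof -
      have lin: "linear (g' (f x))"
        using g'(1)[of "f x"] that assms(3) has_derivative_linear by blast
      have "g' (f x) (f' x v) = g' (f x) (\<Sum>b\<in>Basis. (f' x v \<bullet> b) *\<^sub>R b)"
        by (simp add: euclidean_representation)
      then show ?thesis by (simp add: linear_sum[OF lin] linear_cmul[OF lin])
    qed
    moreover have "continuous_on U (\<lambda>x. \<Sum>b\<in>Basis. (f' x v \<bullet> b) *\<^sub>R g' (f x) b)"
      by (intro continuous_intros f'(2) continuous_on_compose2[OF g'(2)]
          cont_diff_on_continuous[OF assms(2)] assms(3))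
    ultimately show "continuous_on U (\<lambda>x. g' (f x) (f' x v))"
      by (simp cong: continuous_on_cong)
  qed
qed

lemma cont_diff_on_linear_compose:
  "linear g \<Longrightarrow> cont_diff_on f U \<Longrightarrow> cont_diff_on (\<lambda>x. g (f x)) U"
  by (rule cont_diff_on_compose[OF cont_diff_on_linear[where U = UNIV]]) auto

lemma cont_diff_on_bilinear:
  fixes mult (infixl \<open>\<star>\<close> 70)
  assumes "bounded_bilinear (\<star>)" "cont_diff_on f U" "cont_diff_on g U"
  shows "cont_diff_on (\<lambda>x. f x \<star> g x) U"
proof -
  interpret bounded_bilinear "(\<star>)" by fact
  obtain f' where f': "\<And>x. x \<in> U \<Longrightarrow> (f has_derivative f' x) (at x)" "\<And>v. continuous_on U (\<lambda>x. f' x v)"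
    using cont_diff_onE[OF assms(2)] by blast
  obtain g' where g': "\<And>x. x \<in> U \<Longrightarrow> (g has_derivative g' x) (at x)" "\<And>v. continuous_on U (\<lambda>x. g' x v)"
    using cont_diff_onE[OF assms(3)] by blast
  show ?thesis
    by (rule cont_diff_onI[where f' = "\<lambda>x h. f x \<star> g' x h + f' x h \<star> g x"])
      (intro FDERIV f' g' continuous_on_add continuous_on cont_diff_on_continuous[OF assms(2)]
        cont_diff_on_continuous[OF assms(3)] | assumption)+
qed

lemmas cont_diff_on_matrix_mult = cont_diff_on_bilinear[OF bounded_bilinear_matrix_mult]
  and cont_diff_on_scaleR = cont_diff_on_bilinear[OF bounded_bilinear_scaleR]
  and cont_diff_on_mult = cont_diff_on_bilinear[OF bounded_bilinear_mult]
  and cont_diff_on_inner = cont_diff_on_bilinear[OF bounded_bilinear_inner]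

lemma cont_diff_on_Pair:
  assumes "cont_diff_on f U" "cont_diff_on g U"
  shows "cont_diff_on (\<lambda>x. (f x, g x)) U"
proof -
  obtain f' where f': "\<And>x. x \<in> U \<Longrightarrow> (f has_derivative f' x) (at x)" "\<And>v. continuous_on U (\<lambda>x. f' x v)"
    using cont_diff_onE[OF assms(1)] by blast
  obtain g' where g': "\<And>x. x \<in> U \<Longrightarrow> (g has_derivative g' x) (at x)" "\<And>v. continuous_on U (\<lambda>x. g' x v)"
    using cont_diff_onE[OF assms(2)] by blast
  show ?thesis
    by (rule cont_diff_onI[where f' = "\<lambda>x h. (f' x h, g' x h)"])
      (auto intro!: has_derivative_Pair f' g' continuous_on_Pair)
qed

lemma cont_diff_on_add: "cont_diff_on f U \<Longrightarrow> cont_diff_on g U \<Longrightarrow> cont_diff_on (\<lambda>x. f x + g x) U"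
  using cont_diff_on_linear_compose[of "\<lambda>z. fst z + snd z" "\<lambda>x. (f x, g x)" U] cont_diff_on_Pair[of f U g]
  by (simp add: linear_iff scaleR_add_right)

lemma cont_diff_on_diff: "cont_diff_on f U \<Longrightarrow> cont_diff_on g U \<Longrightarrow> cont_diff_on (\<lambda>x. f x - g x) U"
  using cont_diff_on_linear_compose[of "\<lambda>z. fst z - snd z" "\<lambda>x. (f x, g x)" U] cont_diff_on_Pair[of f U g]
  by (simp add: linear_iff scaleR_diff_right)

lemma cont_diff_on_sum:
  "(\<And>i. i \<in> I \<Longrightarrow> cont_diff_on (f i) U) \<Longrightarrow> cont_diff_on (\<lambda>x. \<Sum>i\<in>I. f i x) U"
  by (induction I rule: infinite_finite_induct)
    (auto intro: cont_diff_on_const cont_diff_on_add)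

lemma cont_diff_on_prod:
  fixes f :: "'i \<Rightarrow> 'a::euclidean_space \<Rightarrow> real"
  shows "(\<And>i. i \<in> I \<Longrightarrow> cont_diff_on (f i) U) \<Longrightarrow> cont_diff_on (\<lambda>x. \<Prod>i\<in>I. f i x) U"
  by (induction I rule: infinite_finite_induct)
    (auto intro: cont_diff_on_const cont_diff_on_mult)

lemma cont_diff_on_powr:
  fixes f :: "'a::euclidean_space \<Rightarrow> real"
  assumes "cont_diff_on f U" "\<And>x. x \<in> U \<Longrightarrow> f x > 0"
  shows "cont_diff_on (\<lambda>x. f x powr r) U"
proof (rule cont_diff_on_compose[OF _ assms(1), where V = "{0<..}"])
  show "cont_diff_on (\<lambda>y :: real. y powr r) {0<..}"
    by (rule cont_diff_onI[where f' = "\<lambda>y h. h * (r * y powr (r - 1))"])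
      (auto intro!: derivative_eq_intros continuous_intros simp: powr_diff mult_ac)
qed (use assms(2) in auto)


section \<open>Derivatives of determinant and inverse\<close>

lemma linear_vec_nth: "linear (\<lambda>A :: real^'n^'m. A $ i $ j)"
  by (rule linearI) simp_all

lemma cont_diff_on_det:
  assumes "cont_diff_on F U"
  shows "cont_diff_on (\<lambda>x. det (F x :: real^'n^'n)) U"
  unfolding det_def
  by (intro cont_diff_on_sum cont_diff_on_mult cont_diff_on_prod cont_diff_on_const
      cont_diff_on_linear_compose[OF linear_vec_nth assms])

text \<open>In the Leibniz expansion around the identity matrix only the identity permutation contributes
  to first order: any other one moves two points and leaves a vanishing factor.\<close>

lemma has_derivative_det_at_1: "(det has_derivative trace) (at (mat 1 :: real^'n^'n))"
proof -
  let ?D = "\<lambda>E :: real^'n^'n. \<Sum>p\<in>{p. p permutes UNIV}. of_int (sign p) *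
      (\<Sum>i\<in>UNIV. E $ i $ p i * (\<Prod>j\<in>UNIV - {i}. (mat 1 :: real^'n^'n) $ j $ p j))"
  have nth: "((\<lambda>A :: real^'n^'n. A $ i $ j) has_derivative (\<lambda>E. E $ i $ j)) (at A)" for i j A
    using linear_vec_nth linear_conv_bounded_linear bounded_linear_imp_has_derivative by blast
  have "((\<lambda>A :: real^'n^'n. det A) has_derivative ?D) (at (mat 1))"
    unfolding det_def
    by (intro has_derivative_sum has_derivative_mult_right has_derivative_prod nth)
  moreover have "?D E = trace E" for E
  proof -
    have van: "(\<Prod>j\<in>UNIV - {i}. (mat 1 :: real^'n^'n) $ j $ p j) = 0"
      if p: "p permutes UNIV" "p \<noteq> id" for i p
    proof -
      obtain k where k: "p k \<noteq> k" using p(2) by (auto simp: fun_eq_iff)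
      have "p (p k) \<noteq> p k" using k p(1) by (metis permutes_inverses(2))
      then obtain j where "j \<noteq> i" "p j \<noteq> j" using k by metis
      then show ?thesis by (intro prod_zero bexI[of _ j]) (auto simp: mat_def)
    qed
    have "?D E = (\<Sum>p\<in>{id}. of_int (sign p) *
        (\<Sum>i\<in>UNIV. E $ i $ p i * (\<Prod>j\<in>UNIV - {i}. (mat 1 :: real^'n^'n) $ j $ p j)))"
      by (rule sum.mono_neutral_right) (auto simp: van permutes_id finite_permutations)
    also have "\<dots> = trace E" by (simp add: trace_def mat_def sign_id)
    finally show ?thesis .
  qed
  ultimately show ?thesis by simp
qed

lemma has_derivative_det:
  fixes P :: "real^'n^'n"
  assumes "invertible P"
  shows "(det has_derivative (\<lambda>E. det P * trace (matrix_inv P ** E))) (at P)"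
proof -
  have bl: "bounded_linear (\<lambda>X. matrix_inv P ** X)"
    by (rule bounded_bilinear.bounded_linear_right[OF bounded_bilinear_matrix_mult])
  have "((\<lambda>X. det P * det (matrix_inv P ** X)) has_derivative
      (\<lambda>E. det P * trace (matrix_inv P ** E))) (at P)"
    using has_derivative_det_at_1
    by (intro has_derivative_mult_right
        has_derivative_compose[OF bounded_linear_imp_has_derivative[OF bl]])
      (simp add: matrix_inv_left[OF assms])
  moreover have "det P * det (matrix_inv P ** X) = det X" for X
    by (metis assms det_mul matrix_inv_cancel(3))
  ultimately show ?thesis by simp
qed

lemma open_invertible: "open {A :: real^'n^'n. invertible A}"
proof -
  have "continuous_on UNIV (\<lambda>P :: real^'n^'n. det P)"
    unfolding det_def by (intro continuous_intros)
  then have "open {A :: real^'n^'n. det A \<noteq> 0}"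
    by (intro open_Collect_neq continuous_on_const)
  then show ?thesis by (simp add: invertible_det_nz)
qed

lemma matrix_inv_entry:
  fixes A :: "real^'n^'n"
  assumes "invertible A"
  shows "matrix_inv A $ k $ l = det (\<chi> i j. if j = k then axis l 1 $ i else A $ i $ j) / det A"
proof -
  have "A *v (matrix_inv A *v axis l 1) = axis l 1"
    by (simp add: matrix_vector_mul_assoc matrix_inv_right[OF assms])
  then have "matrix_inv A *v axis l 1 = (\<chi> k. det (\<chi> i j. if j = k then axis l 1 $ i else A $ i $ j) / det A)"
    using cramer[of A "matrix_inv A *v axis l 1" "axis l 1"] assms by (simp add: invertible_det_nz)
  then have "(matrix_inv A *v axis l 1) $ k = det (\<chi> i j. if j = k then axis l 1 $ i else A $ i $ j) / det A"
    by simp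
  then show ?thesis by (simp add: matrix_vector_mult_basis column_def)
qed

lemma continuous_on_matrix_inv: "continuous_on {A :: real^'n^'n. invertible A} matrix_inv"
proof -
  have "continuous_on {A :: real^'n^'n. invertible A}
      (\<lambda>A. \<chi> k l. det (\<chi> i j. if j = k then axis l 1 $ i else A $ i $ j) / det A)"
  proof (intro continuous_on_vec_lambda continuous_on_divide)
    fix k l :: 'n
    have *: "continuous_on S (\<lambda>A :: real^'n^'n. if P then c else A $ i $ j)" for P c i j S
      by (cases P) (auto intro!: continuous_intros)
    show "continuous_on {A :: real^'n^'n. invertible A}
        (\<lambda>A. det (\<chi> i j. if j = k then axis l 1 $ i else A $ i $ j))"
      unfolding det_def by (intro continuous_intros *)
    show "continuous_on {A :: real^'n^'n. invertible A} det"
      unfolding det_def by (intro continuous_intros)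
  qed (simp add: invertible_det_nz)
  then show ?thesis
    by (rule continuous_on_eq) (simp add: vec_eq_iff matrix_inv_entry)
qed

lemma has_derivative_matrix_inv:
  fixes A :: "real^'n^'n"
  assumes A: "invertible A"
  shows "(matrix_inv has_derivative (\<lambda>E. - (matrix_inv A ** E ** matrix_inv A))) (at A)"
proof -
  obtain e where e: "e > 0" "ball A e \<subseteq> {A. invertible A}"
    using open_invertible A openE by blast
  obtain c where c: "c > 0" "\<And>(X :: real^'n^'n) (Y :: real^'n^'n). norm (X ** Y) \<le> norm X * norm Y * c"
    using bounded_bilinear.pos_bounded[OF bounded_bilinear_matrix_mult] by blast
  let ?H = "\<lambda>Y. norm (matrix_inv A - matrix_inv Y) * norm (matrix_inv A) * c * c"
  show ?thesis
  proof (rule has_derivativeI_sandwich[where e = e and H = ?H])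
    have "bounded_linear (\<lambda>E. matrix_inv A ** E ** matrix_inv A)"
      by (rule bounded_linear_compose[OF
            bounded_bilinear.bounded_linear_left[OF bounded_bilinear_matrix_mult]
            bounded_bilinear.bounded_linear_right[OF bounded_bilinear_matrix_mult]])
    then show "bounded_linear (\<lambda>E. - (matrix_inv A ** E ** matrix_inv A))"
      by (rule bounded_linear_minus)
  next
    fix Y assume Y: "Y \<noteq> A" "dist Y A < e"
    then have inv: "invertible Y" using e(2) by (auto simp: dist_commute)
    have "matrix_inv Y ** (Y - A) ** matrix_inv A = matrix_inv A - matrix_inv Y"
      by (simp add: matrix_diff_ldistrib matrix_diff_rdistrib matrix_inv_left[OF inv]
          matrix_inv_cancel[OF A])
    then have "(matrix_inv Y - matrix_inv A) - - (matrix_inv A ** (Y - A) ** matrix_inv A) =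
        (matrix_inv A - matrix_inv Y) ** (Y - A) ** matrix_inv A"
      by (simp add: matrix_diff_rdistrib algebra_simps)
    also have "norm \<dots> \<le> norm ((matrix_inv A - matrix_inv Y) ** (Y - A)) * norm (matrix_inv A) * c"
      by (rule c(2))
    also have "\<dots> \<le> (norm (matrix_inv A - matrix_inv Y) * norm (Y - A) * c) * norm (matrix_inv A) * c"
      using c by (intro mult_right_mono) auto
    finally show "norm ((matrix_inv Y - matrix_inv A) - - (matrix_inv A ** (Y - A) ** matrix_inv A))
        / norm (Y - A) \<le> ?H Y"
      using Y(1) by (simp add: divide_le_eq mult_ac)
  next
    have "isCont matrix_inv A"
      using continuous_on_matrix_inv continuous_on_eq_continuous_at[OF open_invertible] A by blast
    then have "(matrix_inv \<longlongrightarrow> matrix_inv A) (at A)" by (simp add: isCont_def)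
    then have "((\<lambda>Y. norm (matrix_inv A - matrix_inv Y) * norm (matrix_inv A) * c * c) \<longlongrightarrow>
        norm (matrix_inv A - matrix_inv A) * norm (matrix_inv A) * c * c) (at A)"
      by (intro tendsto_intros)
    then show "(?H \<longlongrightarrow> 0) (at A)" by simp
  qed (use e in auto)
qed

lemma cont_diff_on_matrix_inv:
  assumes "cont_diff_on F U" "\<And>x. x \<in> U \<Longrightarrow> invertible (F x :: real^'n^'n)"
  shows "cont_diff_on (\<lambda>x. matrix_inv (F x)) U"
proof (rule cont_diff_on_compose[OF _ assms(1), where V = "{A. invertible A}"])
  show "cont_diff_on matrix_inv {A :: real^'n^'n. invertible A}"
    by (rule cont_diff_onI[OF has_derivative_matrix_inv])
      (auto intro!: continuous_on_minus bounded_bilinear.continuous_on[OF bounded_bilinear_matrix_mult]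
        continuous_on_const continuous_on_matrix_inv)
qed (use assms(2) in auto)


section \<open>The matrix logarithm\<close>

lemma posdef_coercive:
  fixes K :: "real^'n^'n"
  assumes "posdef K"
  obtains c where "c > 0" "\<And>x. x \<bullet> (K *v x) \<ge> c * (x \<bullet> x)"
proof -
  have cont: "continuous_on (sphere 0 1) (\<lambda>x :: real^'n. x \<bullet> (K *v x))"
    by (intro continuous_on_inner continuous_on_id linear_continuous_on
        matrix_vector_mul_bounded_linear)
  have ne: "sphere (0 :: real^'n) 1 \<noteq> {}"
    by (simp add: sphere_eq_empty)
  obtain z where z: "z \<in> sphere 0 1" "\<forall>x\<in>sphere 0 1. z \<bullet> (K *v z) \<le> x \<bullet> (K *v x)"
    using continuous_attains_inf[OF compact_sphere ne cont] by blast
  define c where "c = z \<bullet> (K *v z)"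
  have "z \<noteq> 0" using z(1) by auto
  then have c: "c > 0" using assms by (simp add: c_def posdef_def)
  have "x \<bullet> (K *v x) \<ge> c * (x \<bullet> x)" for x
  proof (cases "x = 0")
    case False
    then have "x /\<^sub>R norm x \<in> sphere 0 1" by simp
    then have "c \<le> (x /\<^sub>R norm x) \<bullet> (K *v (x /\<^sub>R norm x))" using z(2) unfolding c_def by blast
    also have "\<dots> = (x \<bullet> (K *v x)) / (norm x)\<^sup>2"
      by (simp add: matrix_vector_mult_scaleR power2_eq_square divide_inverse mult_ac)
    finally show ?thesis using False by (simp add: le_divide_eq power2_norm_eq_inner)
  qed simp
  with c show thesis by (rule that)
qed

lemma open_posdef: "open {K :: real^'n^'n. posdef K}"
  unfolding open_contains_ball
proof
  fix K :: "real^'n^'n" assume "K \<in> {K. posdef K}"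
  then obtain c where c: "c > 0" "\<And>x. x \<bullet> (K *v x) \<ge> c * (x \<bullet> x)"
    using posdef_coercive by blast
  obtain b where b: "b > 0" "\<And>(A :: real^'n^'n) x. norm (A *v x) \<le> norm A * norm x * b"
    using bounded_bilinear.pos_bounded[OF bounded_bilinear_matrix_vector_mult] by blast
  have "posdef L" if L: "dist K L < c / b" for L
    unfolding posdef_def
  proof (intro allI impI)
    fix x :: "real^'n" assume x: "x \<noteq> 0"
    have "\<bar>x \<bullet> ((K - L) *v x)\<bar> \<le> norm x * (norm (K - L) * norm x * b)"
      using Cauchy_Schwarz_ineq2[of x "(K - L) *v x"] b(2)[of "K - L" x]
      by (meson mult_left_mono norm_ge_zero order_trans)
    also have "\<dots> = (norm (K - L) * b) * (x \<bullet> x)"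
      by (simp add: power2_norm_eq_inner[symmetric] power2_eq_square)
    also have "\<dots> < c * (x \<bullet> x)"
      using L b(1) x by (intro mult_strict_right_mono) (simp_all add: dist_norm less_divide_eq)
    finally have "x \<bullet> ((K - L) *v x) < c * (x \<bullet> x)" by simp
    then show "x \<bullet> (L *v x) > 0"
      using c(2)[of x] by (simp add: matrix_vector_mult_diff_rdistrib inner_diff_right)
  qed
  then show "\<exists>e>0. ball K e \<subseteq> {K. posdef K}"
    using c(1) b(1) by (intro exI[of _ "c / b"]) auto
qed

lemma convex_posdef: "convex {K :: real^'n^'n. posdef K}"
proof (rule convexI)
  fix K L :: "real^'n^'n" and u v :: real
  assume KL: "K \<in> {K. posdef K}" "L \<in> {K. posdef K}" and uv: "0 \<le> u" "0 \<le> v" "u + v = 1"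
  have "x \<bullet> ((u *\<^sub>R K + v *\<^sub>R L) *v x) > 0" if "x \<noteq> 0" for x
  proof -
    have "x \<bullet> ((u *\<^sub>R K + v *\<^sub>R L) *v x) = u * (x \<bullet> (K *v x)) + v * (x \<bullet> (L *v x))"
      by (simp add: matrix_vector_mult_add_rdistrib scaleR_matrix_vector_assoc[symmetric] inner_add_right)
    moreover have "x \<bullet> (K *v x) > 0" "x \<bullet> (L *v x) > 0" using KL that by (auto simp: posdef_def)
    ultimately show ?thesis using uv
      by (cases "u = 0") (auto intro!: add_pos_nonneg mult_pos_pos mult_nonneg_nonneg)
  qed
  then show "u *\<^sub>R K + v *\<^sub>R L \<in> {K. posdef K}" by (simp add: posdef_def)
qed

lemma posdef_mat_1: "posdef (mat 1)"
  by (simp add: posdef_def)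

definition resolvent :: "real^'n^'n \<Rightarrow> real \<Rightarrow> real^'n^'n" where
  "resolvent K t = matrix_inv ((1 - t) *\<^sub>R mat 1 + t *\<^sub>R K)"

text \<open>Integrating along the segment from the identity to \<open>K\<close> gives a logarithm on the whole convex
  set of matrices with positive definite quadratic form. The integrand is smooth up to both end
  points, so derivatives can be taken under the integral sign.\<close>

definition mlog :: "real^'n^'n \<Rightarrow> real^'n^'n" where
  "mlog K = integral (cbox 0 1) (\<lambda>t. resolvent K t ** (K - mat 1))"

definition dmlog :: "real^'n^'n \<Rightarrow> real^'n^'n \<Rightarrow> real^'n^'n" where
  "dmlog K E = integral (cbox 0 1) (\<lambda>t. resolvent K t ** E ** resolvent K t)"

lemma posdef_segment:
  assumes "posdef K" "t \<in> cbox 0 1"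
  shows "posdef ((1 - t) *\<^sub>R mat 1 + t *\<^sub>R K)"
  using convexD[OF convex_posdef, of "mat 1" K "1 - t" t] assms by (simp add: posdef_mat_1)

lemma resolvent_mult:
  assumes "posdef K" "t \<in> cbox 0 1"
  shows "resolvent K t ** ((1 - t) *\<^sub>R mat 1 + t *\<^sub>R K) = mat 1"
  unfolding resolvent_def by (rule matrix_inv_left[OF posdef_invertible[OF posdef_segment[OF assms]]])

lemma resolvent_identity:
  assumes "posdef K" "t \<in> cbox 0 1"
  shows "mat 1 - t *\<^sub>R resolvent K t ** (K - mat 1) = resolvent K t"
    "resolvent K t ** K = K ** resolvent K t"
proof -
  let ?J = "resolvent K t" and ?S = "(1 - t) *\<^sub>R mat 1 + t *\<^sub>R K"
  have S: "?S = mat 1 + t *\<^sub>R (K - mat 1)" by (simp add: algebra_simps)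
  have "?J + t *\<^sub>R (?J ** (K - mat 1)) = mat 1"
    using resolvent_mult[OF assms] unfolding S
    by (simp add: matrix_add_ldistrib matrix_scaleR_right)

  then show "mat 1 - t *\<^sub>R ?J ** (K - mat 1) = ?J"
    by (simp only: matrix_scaleR_left) (simp add: algebra_simps)
  have inv: "invertible ?S" using posdef_invertible[OF posdef_segment[OF assms]] .
  have "K ** ?S = ?S ** K"
    by (simp add: matrix_add_ldistrib matrix_add_rdistrib matrix_scaleR_left matrix_scaleR_right)
  then have "?J ** (K ** ?S) ** ?J = ?J ** (?S ** K) ** ?J" by simp
  then show "?J ** K = K ** ?J"
    unfolding resolvent_def by (simp add: matrix_mul_assoc matrix_inv_cancel[OF inv] matrix_inv_left[OF inv])

qed

lemma continuous_on_resolvent: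
  "continuous_on ({K :: real^'n^'n. posdef K} \<times> cbox 0 1) (\<lambda>(K, t). resolvent K t)"
  unfolding resolvent_def case_prod_beta
proof (rule continuous_on_compose2[OF continuous_on_matrix_inv])
  show "continuous_on ({K :: real^'n^'n. posdef K} \<times> cbox 0 1)
      (\<lambda>x. (1 - snd x) *\<^sub>R mat 1 + snd x *\<^sub>R fst x)"
    by (intro continuous_intros)
qed (use posdef_invertible posdef_segment in \<open>force simp del: cbox_interval\<close>)

lemma continuous_on_resolvent_fixed:
  "posdef K \<Longrightarrow> continuous_on (cbox 0 1) (resolvent K)"
  using continuous_on_compose2[OF continuous_on_resolvent, of "cbox 0 1" "\<lambda>t. (K, t)"]
  by (simp add: continuous_intros image_subset_iff)

lemmas continuous_on_matrix_mult = bounded_bilinear.continuous_on[OF bounded_bilinear_matrix_mult]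

lemma has_derivative_resolvent:
  fixes K :: "real^'n^'n"
  assumes "posdef K" "t \<in> cbox 0 1"
  shows "((\<lambda>K. resolvent K t) has_derivative (\<lambda>E. - (resolvent K t ** (t *\<^sub>R E) ** resolvent K t))) (at K)"
  unfolding resolvent_def
  by (rule has_derivative_compose[OF _ has_derivative_matrix_inv])
    (auto intro!: derivative_eq_intros posdef_invertible posdef_segment assms)

lemma bounded_linear_sandwich: "bounded_linear (\<lambda>E :: real^'n^'n. A ** E ** B)"
  for A :: "real^'n^'m" and B :: "real^'k^'n"
  by (rule bounded_linear_compose[OF
        bounded_bilinear.bounded_linear_left[OF bounded_bilinear_matrix_mult]
        bounded_bilinear.bounded_linear_right[OF bounded_bilinear_matrix_mult]])

lemma continuous_on_resolvent_sandwich: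
  "continuous_on ({K :: real^'n^'n. posdef K} \<times> cbox 0 1) (\<lambda>(K, t). resolvent K t ** E ** resolvent K t)"
  using continuous_on_resolvent unfolding case_prod_beta
  by (intro continuous_on_matrix_mult continuous_on_const)

lemma integrable_resolvent_sandwich:
  "posdef K \<Longrightarrow> (\<lambda>t. resolvent K t ** E ** resolvent K t) integrable_on cbox 0 1"
  by (intro integrable_continuous continuous_on_matrix_mult continuous_on_const
      continuous_on_resolvent_fixed)

lemma integrable_mlog:
  "posdef K \<Longrightarrow> (\<lambda>t. resolvent K t ** (K - mat 1)) integrable_on cbox 0 1"
  by (intro integrable_continuous continuous_on_matrix_mult continuous_on_const
      continuous_on_resolvent_fixed)

lemma has_derivative_mlog:
  fixes K :: "real^'n^'n"
  assumes K: "posdef K"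
  shows "(mlog has_derivative dmlog K) (at K)"
proof -
  define D where "D = (\<lambda>(K :: real^'n^'n) t. Blinfun (\<lambda>E. resolvent K t ** E ** resolvent K t))"
  have D: "blinfun_apply (D K t) = (\<lambda>E. resolvent K t ** E ** resolvent K t)" for K t
    unfolding D_def by (simp add: bounded_linear_Blinfun_apply bounded_linear_sandwich)
  have contD: "continuous_on ({K. posdef K} \<times> cbox 0 1) (\<lambda>(K, t). D K t)"
  proof (rule continuous_on_blinfun_componentwise)
    show "continuous_on ({K. posdef K} \<times> cbox 0 1) (\<lambda>x. blinfun_apply (case x of (K, t) \<Rightarrow> D K t) E)" for E
      using continuous_on_resolvent_sandwich[of E] by (simp add: case_prod_beta D)
  qed
  have "((\<lambda>K. integral (cbox 0 1) (\<lambda>t. resolvent K t ** (K - mat 1))) has_derivative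
      blinfun_apply (integral (cbox 0 1) (D K))) (at K within {K. posdef K})"
  proof (rule leibniz_rule)
    fix L :: "real^'n^'n" and t :: real assume L: "L \<in> {K. posdef K}" and t: "t \<in> cbox 0 1"
    let ?J = "resolvent L t"
    have "((\<lambda>K. resolvent K t ** (K - mat 1)) has_derivative
        (\<lambda>E. ?J ** E + - (?J ** (t *\<^sub>R E) ** ?J) ** (L - mat 1))) (at L)"
      using L t by (intro bounded_bilinear.FDERIV[OF bounded_bilinear_matrix_mult]
          has_derivative_resolvent) (auto intro!: derivative_eq_intros)
    moreover have "?J ** E + - (?J ** (t *\<^sub>R E) ** ?J) ** (L - mat 1) = ?J ** E ** ?J" for E
    proof -
      have "?J ** E ** ?J = ?J ** E ** (mat 1 - t *\<^sub>R ?J ** (L - mat 1))"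
        using resolvent_identity(1)[of L t] L t by simp
      then show ?thesis
        by (simp add: matrix_diff_ldistrib matrix_scaleR_left matrix_scaleR_right matrix_minus_left
            matrix_mul_assoc diff_diff_eq2 add_diff_eq matrix_add_ldistrib)
    qed
    ultimately show "((\<lambda>K. resolvent K t ** (K - mat 1)) has_derivative blinfun_apply (D L t))
        (at L within {K. posdef K})"
      by (simp add: D has_derivative_at_withinI)
  qed (use K contD integrable_mlog convex_posdef in auto)
  moreover have "blinfun_apply (integral (cbox 0 1) (D K)) E = dmlog K E" for E
  proof -
    have "continuous_on (cbox 0 1) (D K)"
      using continuous_on_compose2[OF contD, of "cbox 0 1" "\<lambda>t. (K, t)"] K
      by (simp add: continuous_intros image_subset_iff)
    then show ?thesis
      unfolding dmlog_def by (subst blinfun_apply_integral) (auto intro: integrable_continuous_real simp: D)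
  qed
  then have "blinfun_apply (integral (cbox 0 1) (D K)) = dmlog K" by (rule ext)
  ultimately have "(mlog has_derivative dmlog K) (at K within {K. posdef K})"
    unfolding mlog_def[abs_def] by (simp only:)
  then show ?thesis
    using at_within_open[of K, OF _ open_posdef] K by simp
qed

lemma cont_diff_on_mlog: "cont_diff_on mlog {K :: real^'n^'n. posdef K}"
proof (rule cont_diff_onI[OF has_derivative_mlog])
  show "continuous_on {K :: real^'n^'n. posdef K} (\<lambda>K. dmlog K E)" for E
    unfolding dmlog_def by (rule integral_continuous_on_param[OF continuous_on_resolvent_sandwich])
qed simp

lemma vec_lambda_has_vector_derivative:
  fixes f :: "'i::finite \<Rightarrow> real \<Rightarrow> real"
  assumes "\<And>i. (f i has_vector_derivative f' i) (at t within S)"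
  shows "((\<lambda>t. \<chi> i. f i t) has_vector_derivative (\<chi> i. f' i)) (at t within S)"
  unfolding has_vector_derivative_def
proof (subst has_derivative_componentwise_within, intro ballI)
  fix b :: "real^'i" assume "b \<in> Basis"
  then obtain i where b: "b = axis i 1" by (auto simp: Basis_vec_def)
  show "((\<lambda>t. (\<chi> i. f i t) \<bullet> b) has_derivative (\<lambda>h. (h *\<^sub>R (\<chi> i. f' i)) \<bullet> b)) (at t within S)"
    using assms[of i] by (simp add: b inner_axis has_vector_derivative_def)
qed

lemma diagonal_frame_has_vector_derivative:
  fixes f :: "'i::finite \<Rightarrow> real \<Rightarrow> real" and A :: "real^'i^'m" and B :: "real^'k^'i"
  assumes "\<And>i. (f i has_vector_derivative f' i) (at t within S)"
  shows "((\<lambda>t. A ** diagm (\<chi> i. f i t) ** B) has_vector_derivative (A ** diagm (\<chi> i. f' i) ** B)) (at t within S)"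
proof (rule bounded_linear.has_vector_derivative[OF bounded_linear_sandwich])
  show "((\<lambda>t. diagm (\<chi> i. f i t)) has_vector_derivative diagm (\<chi> i. f' i)) (at t within S)"
    using linear_diagm
    by (intro bounded_linear.has_vector_derivative[OF _ vec_lambda_has_vector_derivative] assms)
      (simp add: linear_conv_bounded_linear)
qed

lemma segment_pos:
  fixes c t :: real
  shows "c > 0 \<Longrightarrow> t \<in> {0..1} \<Longrightarrow> (1 - t) + t * c > 0"
  by (cases "t = 0") (auto intro: add_nonneg_pos)

lemma resolvent_diagonal:
  fixes R :: "real^'n^'n"
  assumes R: "orthogonal_matrix R" and v: "\<And>i. v $ i > 0" and t: "t \<in> {0..1}"
  shows "resolvent (R ** diagm v ** transpose R) t =
    R ** diagm (\<chi> i. inverse ((1 - t) + t * v $ i)) ** transpose R"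
proof -
  have "R ** ((1 - t) *\<^sub>R diagm (\<chi> i. 1) + t *\<^sub>R diagm v) ** transpose R =
      (1 - t) *\<^sub>R mat 1 + t *\<^sub>R (R ** diagm v ** transpose R)"
    by (simp add: diagm_one matrix_add_ldistrib matrix_add_rdistrib matrix_scaleR_left
        matrix_scaleR_right orthogonal_matrixD[OF R])
  moreover have "(1 - t) *\<^sub>R diagm (\<chi> i. 1) + t *\<^sub>R diagm v = diagm (\<chi> i. (1 - t) + t * v $ i)"
    by (simp add: diagm_def vec_eq_iff)
  ultimately have "(1 - t) *\<^sub>R mat 1 + t *\<^sub>R (R ** diagm v ** transpose R) =
      R ** diagm (\<chi> i. (1 - t) + t * v $ i) ** transpose R"
    by simp
  then show ?thesis
    unfolding resolvent_def
    using matrix_inv_diagonalization[OF R, of "\<chi> i. (1 - t) + t * v $ i"] segment_pos[OF v t]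
    by (simp add: less_imp_neq[symmetric])
qed

lemma mlog_diagonal:
  fixes R :: "real^'n^'n"
  assumes R: "orthogonal_matrix R" and v: "\<And>i. v $ i > 0"
  shows "mlog (R ** diagm v ** transpose R) = R ** diagm (\<chi> i. ln (v $ i)) ** transpose R"
proof -
  let ?K = "R ** diagm v ** transpose R"

  have K1: "?K - mat 1 = R ** diagm (\<chi> i. v $ i - 1) ** transpose R"
  proof -
    have "R ** (diagm v - diagm (\<chi> i. 1)) ** transpose R = ?K - mat 1"
      by (simp add: diagm_one matrix_diff_ldistrib matrix_diff_rdistrib orthogonal_matrixD[OF R])
    moreover have "diagm v - diagm (\<chi> i. 1) = diagm (\<chi> i. v $ i - 1)"
      by (simp add: diagm_def vec_eq_iff)
    ultimately show ?thesis by simp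
  qed
  have integrand: "resolvent ?K t ** (?K - mat 1) =
      R ** diagm (\<chi> i. (v $ i - 1) / ((1 - t) + t * v $ i)) ** transpose R" if "t \<in> {0..1}" for t
  proof -
    have "resolvent ?K t ** (?K - mat 1) = R ** diagm (\<chi> i. inverse ((1 - t) + t * v $ i)) **
        (transpose R ** R) ** diagm (\<chi> i. v $ i - 1) ** transpose R"
      by (simp add: K1 resolvent_diagonal[OF R v that] matrix_mul_assoc)
    also have "\<dots> = R ** (diagm (\<chi> i. inverse ((1 - t) + t * v $ i)) ** diagm (\<chi> i. v $ i - 1)) ** transpose R"
      by (simp add: orthogonal_matrixD[OF R] matrix_mul_assoc)
    finally show ?thesis by (simp add: diagm_mult divide_inverse mult.commute)
  qed
  have "((\<lambda>t. R ** diagm (\<chi> i. (v $ i - 1) / ((1 - t) + t * v $ i)) ** transpose R) has_integral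
      (R ** diagm (\<chi> i. ln ((1 - 1) + 1 * v $ i)) ** transpose R -
       R ** diagm (\<chi> i. ln ((1 - 0) + 0 * v $ i)) ** transpose R)) {0..1}"
  proof (rule fundamental_theorem_of_calculus)
    fix t :: real assume t: "t \<in> {0..1}"
    show "((\<lambda>t. R ** diagm (\<chi> i. ln ((1 - t) + t * v $ i)) ** transpose R) has_vector_derivative
        R ** diagm (\<chi> i. (v $ i - 1) / ((1 - t) + t * v $ i)) ** transpose R) (at t within {0..1})"
      by (rule diagonal_frame_has_vector_derivative)
        (use segment_pos[OF v t] in \<open>auto intro!: derivative_eq_intros
          simp: has_real_derivative_iff_has_vector_derivative[symmetric] divide_inverse\<close>)
  qed simp
  moreover have "diagm (\<chi> i. ln 1) = (0 :: real^'n^'n)" by (simp add: diagm_def vec_eq_iff)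
  ultimately have "((\<lambda>t. R ** diagm (\<chi> i. (v $ i - 1) / ((1 - t) + t * v $ i)) ** transpose R) has_integral
      (R ** diagm (\<chi> i. ln (v $ i)) ** transpose R)) {0..1}"
    by (simp add: matrix_mult_0_left matrix_mult_0_right)
  then have "((\<lambda>t. resolvent ?K t ** (?K - mat 1)) has_integral
      (R ** diagm (\<chi> i. ln (v $ i)) ** transpose R)) {0..1}"
    by (rule has_integral_eq[rotated]) (simp add: integrand)
  then show ?thesis unfolding mlog_def by (simp add: integral_unique)
qed

text \<open>The integral is computed eigenvalue by eigenvalue in the preceding lemma; hence it is the
  logarithm of the functional calculus.\<close>

lemma spd_log_eq_mlog:
  assumes "spd P"
  shows "spd_log P = mlog P"
proof -
  obtain R v where R: "orthogonal_matrix R" and P: "P = R ** diagm v ** transpose R"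
    and v: "\<And>i. v $ i > 0" using spd_diagonalization[OF assms] by blast
  show ?thesis unfolding spd_log_def P sym_fun_eq[OF R] mlog_diagonal[OF R v] ..
qed

lemma transpose_mlog: "spd K \<Longrightarrow> transpose (mlog K) = mlog K"
  by (rule spd_diagonalization[of K]) (auto simp: mlog_diagonal matrix_transpose_mul matrix_mul_assoc)

text \<open>The primitive \<open>t (1 + t (K - 1))\<^sup>-\<^sup>1\<close> has derivative \<open>(1 + t (K - 1))\<^sup>-\<^sup>2\<close>.\<close>

lemma integral_resolvent_square:
  fixes K :: "real^'n^'n"
  assumes K: "posdef K"
  shows "integral (cbox 0 1) (\<lambda>t. resolvent K t ** resolvent K t) = matrix_inv K"
proof -
  have "((\<lambda>t. resolvent K t ** resolvent K t) has_integral (1 *\<^sub>R resolvent K 1 - 0 *\<^sub>R resolvent K 0)) {0..1}"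
  proof (rule fundamental_theorem_of_calculus)
    fix t :: real assume "t \<in> {0..1}"
    then have t: "t \<in> cbox 0 1" by simp
    let ?J = "resolvent K t"
    have "((\<lambda>t. (1 - t) *\<^sub>R mat 1 + t *\<^sub>R K) has_derivative (\<lambda>h. h *\<^sub>R (K - mat 1))) (at t within {0..1})"
      by (auto intro!: derivative_eq_intros simp: algebra_simps)
    from has_derivative_compose[OF this has_derivative_matrix_inv[OF posdef_invertible[OF posdef_segment[OF K t]]]]
    have J: "(resolvent K has_vector_derivative - (?J ** (K - mat 1) ** ?J)) (at t within {0..1})"
      by (simp add: resolvent_def[abs_def] has_vector_derivative_def matrix_scaleR_left matrix_scaleR_right)
    have "((\<lambda>t. t *\<^sub>R resolvent K t) has_vector_derivative (t *\<^sub>R - (?J ** (K - mat 1) ** ?J) + 1 *\<^sub>R ?J))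
        (at t within {0..1})"
      by (intro has_vector_derivative_scaleR J) (auto intro!: derivative_eq_intros)
    moreover have "t *\<^sub>R - (?J ** (K - mat 1) ** ?J) + 1 *\<^sub>R ?J = (mat 1 - t *\<^sub>R ?J ** (K - mat 1)) ** ?J"
      by (simp add: matrix_diff_rdistrib matrix_scaleR_left)
    ultimately show "((\<lambda>t. t *\<^sub>R resolvent K t) has_vector_derivative ?J ** ?J) (at t within {0..1})"
      using resolvent_identity(1)[OF K t] by simp
  qed simp
  then show ?thesis by (simp add: integral_unique resolvent_def)
qed

lemma commute_matrix_inv:
  fixes A B :: "real^'n^'n"
  assumes "invertible B" "A ** B = B ** A"
  shows "A ** matrix_inv B = matrix_inv B ** A"
proof -
  have "matrix_inv B ** (A ** B) ** matrix_inv B = matrix_inv B ** (B ** A) ** matrix_inv B"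
    by (simp add: assms)
  then show ?thesis
    using assms(1) by (simp add: matrix_mul_assoc matrix_inv_cancel matrix_inv_left)
qed

lemma mlog_commute:
  fixes A K :: "real^'n^'n"
  assumes K: "posdef K" and A: "A ** K = K ** A"
  shows "A ** mlog K = mlog K ** A"
proof -
  have "A ** resolvent K t = resolvent K t ** A" if "t \<in> cbox 0 1" for t
    unfolding resolvent_def
    by (rule commute_matrix_inv[OF posdef_invertible[OF posdef_segment[OF K that]]])
      (simp add: matrix_add_ldistrib matrix_add_rdistrib matrix_scaleR_left matrix_scaleR_right A)
  moreover have "A ** (K - mat 1) = (K - mat 1) ** A"
    by (simp add: A matrix_diff_ldistrib matrix_diff_rdistrib)
  ultimately have comm: "A ** (resolvent K t ** (K - mat 1)) = resolvent K t ** (K - mat 1) ** A"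
    if "t \<in> cbox 0 1" for t
    using that by (metis matrix_mul_assoc)
  have "A ** mlog K = integral (cbox 0 1) (\<lambda>t. A ** (resolvent K t ** (K - mat 1)))"
    unfolding mlog_def
    using integral_linear[OF integrable_mlog[OF K]
        bounded_bilinear.bounded_linear_right[OF bounded_bilinear_matrix_mult, of A]]
    by (simp add: o_def)
  also have "\<dots> = integral (cbox 0 1) (\<lambda>t. resolvent K t ** (K - mat 1) ** A)"
    by (rule integral_cong) (rule comm)
  also have "\<dots> = mlog K ** A"
    unfolding mlog_def
    using integral_linear[OF integrable_mlog[OF K]
        bounded_bilinear.bounded_linear_left[OF bounded_bilinear_matrix_mult, of A]]
    by (simp add: o_def)
  finally show ?thesis .
qed

lemma bounded_linear_trace_mult: "bounded_linear (\<lambda>X :: real^'n^'m. trace (A ** X))"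
  for A :: "real^'m^'n"
proof -
  have "bounded_linear (trace :: real^'n^'n \<Rightarrow> real)"
    using linear_trace linear_conv_bounded_linear by blast
  then show ?thesis
    using bounded_linear_compose bounded_bilinear.bounded_linear_right[OF bounded_bilinear_matrix_mult]
    by blast
qed

text \<open>Under the trace, \<open>log K\<close> commutes past the resolvents, and what remains is the integral of the
  squared resolvent.\<close>

lemma trace_mlog_dmlog:
  fixes K :: "real^'n^'n"
  assumes K: "posdef K"
  shows "trace (mlog K ** dmlog K E) = trace (mlog K ** matrix_inv K ** E)"
proof -
  have "mlog K ** resolvent K t = resolvent K t ** mlog K" if "t \<in> cbox 0 1" for t
    using mlog_commute[OF K, of "resolvent K t"] resolvent_identity(2)[OF K that] by simp
  then have swap: "trace (mlog K ** (resolvent K t ** E ** resolvent K t)) =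
      trace (E ** mlog K ** (resolvent K t ** resolvent K t))" if "t \<in> cbox 0 1" for t
    using that by (metis matrix_mul_assoc trace_mul_sym)
  have "trace (mlog K ** dmlog K E) =
      integral (cbox 0 1) (\<lambda>t. trace (mlog K ** (resolvent K t ** E ** resolvent K t)))"
    unfolding dmlog_def
    using integral_linear[OF integrable_resolvent_sandwich[OF K] bounded_linear_trace_mult]
    by (simp add: o_def)
  also have "\<dots> = integral (cbox 0 1) (\<lambda>t. trace (E ** mlog K ** (resolvent K t ** resolvent K t)))"
    by (rule integral_cong) (rule swap)
  also have "\<dots> = trace (E ** mlog K ** integral (cbox 0 1) (\<lambda>t. resolvent K t ** resolvent K t))"
    using integral_linear[OF integrable_resolvent_sandwich[OF K, of "mat 1"] bounded_linear_trace_mult, of "E ** mlog K"]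
    by (simp add: o_def)
  also have "\<dots> = trace (mlog K ** matrix_inv K ** E)"
    unfolding integral_resolvent_square[OF K] by (metis matrix_mul_assoc trace_mul_sym)
  finally show ?thesis .
qed

lemma trace_weighted_square:
  fixes F :: "real^'n^'n"
  assumes "transpose F = F"
  shows "trace (diagm a ** F ** diagm b ** F) = (\<Sum>i\<in>UNIV. \<Sum>j\<in>UNIV. a $ i * b $ j * (F $ i $ j)\<^sup>2)"
proof -
  have sym: "F $ j $ i = F $ i $ j" for i j
    using assms by (simp add: vec_eq_iff transpose_def)
  have "(diagm a ** F ** diagm b ** F) $ i $ i = (\<Sum>j\<in>UNIV. a $ i * b $ j * (F $ i $ j)\<^sup>2)" for i
  proof -
    have "(diagm a ** F ** diagm b ** F) $ i $ i = (\<Sum>j\<in>UNIV. (diagm a ** F ** diagm b) $ i $ j * F $ j $ i)"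
      by (subst matrix_matrix_mult_def) simp
    then show ?thesis
      by (simp add: diagm_mult_left diagm_mult_right sym power2_eq_square mult_ac)
  qed
  then show ?thesis by (simp add: trace_def)
qed

text \<open>The trace is the second derivative of half the squared distance to the identity, along the
  geodesic with velocity \<open>E\<close> at \<open>K\<close>. In an eigenbasis of \<open>K\<close> the integrand is a sum of squares with
  positive weights.\<close>

lemma dmlog_pos:
  fixes K :: "real^'n^'n"
  assumes K: "spd K" and E: "transpose E = E" "E \<noteq> 0"
  shows "trace (dmlog K E ** (matrix_inv K ** E)) > 0"
proof -
  have pK: "posdef K" using K by (simp add: spd_iff_posdef)
  obtain R v where R: "orthogonal_matrix R" and K_eq: "K = R ** diagm v ** transpose R"
    and v: "\<And>i. v $ i > 0" using spd_diagonalization[OF K] by blast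
  define F where "F = transpose R ** E ** R"
  have F: "transpose F = F" by (simp add: F_def matrix_transpose_mul E matrix_mul_assoc)
  have "R ** F ** transpose R = (R ** transpose R) ** E ** (R ** transpose R)"
    by (simp add: F_def matrix_mul_assoc)
  then have "F \<noteq> 0" using E(2) by (auto simp: orthogonal_matrixD[OF R] matrix_mult_0_left matrix_mult_0_right)
  then obtain k l where kl: "F $ k $ l \<noteq> 0" by (auto simp: vec_eq_iff)
  define w where "w = (\<lambda>t. \<chi> i. inverse ((1 - t) + t * v $ i))"
  have res: "resolvent K t = R ** diagm (w t) ** transpose R" if t: "t \<in> {0..1}" for t
    unfolding K_eq w_def by (rule resolvent_diagonal[OF R v t])
  have inv: "matrix_inv K = R ** diagm (\<chi> i. inverse (v $ i)) ** transpose R"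
    unfolding K_eq using v by (intro matrix_inv_diagonalization R) (simp add: less_imp_neq[symmetric])
  define \<phi> where "\<phi> = (\<lambda>t. trace ((resolvent K t ** E ** resolvent K t) ** (matrix_inv K ** E)))"
  have \<phi>: "\<phi> t = (\<Sum>i\<in>UNIV. \<Sum>j\<in>UNIV. w t $ i * (w t $ j / v $ j) * (F $ i $ j)\<^sup>2)" if t: "t \<in> {0..1}" for t
  proof -
    have "\<phi> t = trace (R ** (diagm (w t) ** (transpose R ** E ** R) ** diagm (w t) ** (transpose R ** R) **
        diagm (\<chi> i. inverse (v $ i)) ** transpose R ** E))"
      by (simp add: \<phi>_def res[OF t] inv matrix_mul_assoc)
    also have "\<dots> = trace (diagm (w t) ** F ** diagm (w t) ** diagm (\<chi> i. inverse (v $ i)) ** F)"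
      by (subst trace_mul_sym) (simp add: F_def matrix_mul_assoc orthogonal_matrixD[OF R])
    also have "\<dots> = trace (diagm (w t) ** F ** (diagm (w t) ** diagm (\<chi> i. inverse (v $ i))) ** F)"
      by (simp add: matrix_mul_assoc)
    also have "\<dots> = (\<Sum>i\<in>UNIV. \<Sum>j\<in>UNIV. w t $ i * (w t $ j / v $ j) * (F $ i $ j)\<^sup>2)"
      unfolding diagm_mult by (subst trace_weighted_square[OF F]) (simp add: divide_inverse)
    finally show ?thesis .
  qed
  have wpos: "w t $ i > 0" if "t \<in> {0..1}" for t i using segment_pos[OF v that] by (simp add: w_def)
  have nonneg: "\<phi> t \<ge> 0" if t: "t \<in> {0..1}" for t
    unfolding \<phi>[OF t] using wpos[OF t] v
    by (intro sum_nonneg mult_nonneg_nonneg divide_nonneg_pos) (auto simp: less_imp_le)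
  have "\<phi> 0 > 0"
  proof -
    have nn: "w 0 $ i * (w 0 $ j / v $ j) * (F $ i $ j)\<^sup>2 \<ge> 0" for i j
      using wpos[of 0] v by (intro mult_nonneg_nonneg divide_nonneg_pos) (auto simp: less_imp_le)
    have p: "w 0 $ k * (w 0 $ l / v $ l) * (F $ k $ l)\<^sup>2 > 0"
      using wpos[of 0] v kl by (intro mult_pos_pos divide_pos_pos) auto
    have "\<phi> 0 = (\<Sum>i\<in>UNIV. \<Sum>j\<in>UNIV. w 0 $ i * (w 0 $ j / v $ j) * (F $ i $ j)\<^sup>2)"
      by (rule \<phi>) simp
    also have "\<dots> > 0"
      by (intro sum_pos2[where i = k] sum_pos2[where i = l] sum_nonneg nn p finite_class.finite_UNIV UNIV_I)
    finally show ?thesis .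
  qed
  moreover have "continuous_on {0..1} \<phi>"
    unfolding \<phi>_def using continuous_on_resolvent_fixed[OF pK] linear_trace
    by (intro linear_continuous_on_compose[OF _ linear_trace] continuous_on_matrix_mult continuous_on_const) auto
  ultimately have "integral {0..1} \<phi> \<noteq> 0"
    using integral_eq_0_iff[of 0 1 \<phi>] nonneg by fastforce
  moreover have "integral {0..1} \<phi> \<ge> 0"
    using nonneg by (intro integral_nonneg integrable_continuous_real \<open>continuous_on {0..1} \<phi>\<close>)
  moreover have "trace (dmlog K E ** (matrix_inv K ** E)) = integral {0..1} \<phi>"
    unfolding \<phi>_def dmlog_def trace_mul_sym[of _ "matrix_inv K ** E"]
    using integral_linear[OF integrable_resolvent_sandwich[OF pK] bounded_linear_trace_mult[of "matrix_inv K ** E"]]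
    by (simp add: o_def)
  ultimately show ?thesis by linarith
qed

text \<open>Half the squared distance to the identity, as a smooth function on \<^const>\<open>posdef\<close> matrices.\<close>

definition log_energy :: "real^'n^'n \<Rightarrow> real" where
  "log_energy K = 1/2 * trace (mlog K ** mlog K)"

lemma log_energy_spd: "spd K \<Longrightarrow> log_energy K = 1/2 * (norm (spd_log K))\<^sup>2"
  by (simp add: log_energy_def spd_log_eq_mlog power2_norm_eq_inner inner_matrix_trace transpose_mlog)

lemma has_derivative_log_energy:
  fixes K :: "real^'n^'n"
  assumes K: "posdef K"
  shows "(log_energy has_derivative (\<lambda>E. trace (mlog K ** matrix_inv K ** E))) (at K)"
proof -
  have tr: "bounded_linear (trace :: real^'n^'n \<Rightarrow> real)"
    using linear_trace linear_conv_bounded_linear by blast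
  have "((\<lambda>K. 1/2 * trace (mlog K ** mlog K)) has_derivative
      (\<lambda>E. 1/2 * trace (mlog K ** dmlog K E + dmlog K E ** mlog K))) (at K)"
    by (intro has_derivative_mult_right bounded_linear.has_derivative[OF tr]
        bounded_bilinear.FDERIV[OF bounded_bilinear_matrix_mult] has_derivative_mlog K)
  moreover have "1/2 * trace (mlog K ** dmlog K E + dmlog K E ** mlog K) =
      trace (mlog K ** matrix_inv K ** E)" for E
    by (simp add: trace_add trace_mul_sym[of "dmlog K E"] trace_mlog_dmlog[OF K])
  ultimately show ?thesis unfolding log_energy_def[abs_def] by simp
qed


section \<open>The implicit function theorem\<close>

text \<open>The inverse function theorem is applied to \<open>z \<mapsto> (f z, snd z)\<close>.\<close>

lemma implicit_function:
  fixes f :: "'a::euclidean_space \<times> 'l::euclidean_space \<Rightarrow> 'a"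
  assumes N: "open N" "(x0, y0) \<in> N" and f: "cont_diff_on f N" and zero: "f (x0, y0) = 0"
    and f': "(f has_derivative f') (at (x0, y0))"
    and inj: "\<And>v. f' (v, 0) = 0 \<Longrightarrow> v = 0"
  obtains W \<delta> \<sigma> \<sigma>' where "open W" "x0 \<in> W" "\<delta> > 0" "W \<times> ball y0 \<delta> \<subseteq> N"
    "\<And>y. y \<in> ball y0 \<delta> \<Longrightarrow> \<sigma> y \<in> W \<and> f (\<sigma> y, y) = 0"
    "\<And>x y. x \<in> W \<Longrightarrow> y \<in> ball y0 \<delta> \<Longrightarrow> f (x, y) = 0 \<Longrightarrow> x = \<sigma> y"
    "continuous_on (ball y0 \<delta>) \<sigma>" "(\<sigma> has_derivative \<sigma>') (at y0)" "\<sigma> y0 = x0"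
    "\<And>h. f' (\<sigma>' h, h) = 0"
proof -
  define \<Psi> where "\<Psi> = (\<lambda>z. (f z, snd z))"
  have cd: "cont_diff_on \<Psi> N"
    unfolding \<Psi>_def by (intro cont_diff_on_Pair f cont_diff_on_bounded_linear bounded_linear_snd)
  then obtain D where D: "\<And>z. z \<in> N \<Longrightarrow> (\<Psi> has_derivative D z) (at z)"
    "\<And>v. continuous_on N (\<lambda>z. D z v)" by (rule cont_diff_onE) blast
  define D' where "D' = (\<lambda>z. Blinfun (D z))"
  have D': "blinfun_apply (D' z) = D z" if "z \<in> N" for z
    unfolding D'_def using D(1)[OF that] by (intro bounded_linear_Blinfun_apply has_derivative_bounded_linear)
  have contD': "continuous_on N D'"
    by (rule continuous_on_blinfun_componentwise) (use D(2) in \<open>simp add: D' cong: continuous_on_cong\<close>)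
  have "(\<Psi> has_derivative (\<lambda>h. (f' h, snd h))) (at (x0, y0))"
    unfolding \<Psi>_def by (intro has_derivative_Pair f' has_derivative_snd has_derivative_ident)
  then have D0: "D (x0, y0) = (\<lambda>h. (f' h, snd h))"
    using D(1)[OF N(2)] has_derivative_unique by blast
  have lin: "linear (D (x0, y0))" using D(1)[OF N(2)] has_derivative_linear by blast
  have "inj (D (x0, y0))"
    unfolding linear_injective_0[OF lin] using inj by (auto simp: D0 zero_prod_def)
  then obtain L where L: "linear L" "L \<circ> D (x0, y0) = id"
    using linear_injective_left_inverse[OF lin] by blast
  have invf: "Blinfun L o\<^sub>L D' (x0, y0) = id_blinfun"
    using L(1) by (intro blinfun_eqI)
      (simp add: D'[OF N(2)] bounded_linear_Blinfun_apply linear_conv_bounded_linear[symmetric]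
        fun_cong[OF L(2), simplified])
  obtain U' V g g' where U': "open U'" "U' \<subseteq> N" "(x0, y0) \<in> U'" and V: "open V" "\<Psi> (x0, y0) \<in> V"
    and hom: "homeomorphism U' V \<Psi> g" and g': "\<And>y. y \<in> V \<Longrightarrow> (g has_derivative (g' y)) (at y)"
    using inverse_function_theorem[of N \<Psi> D' "(x0, y0)" "Blinfun L"] N D(1) D' contD' invf
    by (metis (no_types, lifting))
  have \<Psi>0: "\<Psi> (x0, y0) = (0, y0)" by (simp add: \<Psi>_def zero)
  obtain W B where WB: "open W" "open B" "(x0, y0) \<in> W \<times> B" "W \<times> B \<subseteq> U'"
    using open_prod_elim[OF U'(1,3)] by metis
  define \<sigma> where "\<sigma> y = fst (g (0, y))" for y
  have snd_g: "g (0, y) = (\<sigma> y, y) \<and> f (\<sigma> y, y) = 0" if "(0, y) \<in> V" for y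
  proof -
    have "\<Psi> (g (0, y)) = (0, y)" using homeomorphism_apply2[OF hom that] .
    then show ?thesis by (cases "g (0, y)") (simp add: \<Psi>_def \<sigma>_def)
  qed
  have g0: "g (0, y0) = (x0, y0)" using homeomorphism_apply1[OF hom U'(3)] \<Psi>0 by simp
  have cont_g: "continuous_on V g" using hom by (simp add: homeomorphism_def)
  define Y where "Y = {y. (0, y) \<in> V}"
  have Yeq: "Y = (\<lambda>y. (0, y)) -` V" by (auto simp: Y_def)
  have Y: "open Y" "y0 \<in> Y"
    using V \<Psi>0 unfolding Yeq by (auto intro!: open_vimage continuous_intros)
  have cont_\<sigma>: "continuous_on Y \<sigma>"
    unfolding \<sigma>_def
    by (intro continuous_on_fst continuous_on_compose2[OF cont_g] continuous_intros) (auto simp: Y_def)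
  have "open (Y \<inter> \<sigma> -` W)"
    using continuous_open_preimage[OF cont_\<sigma> Y(1) WB(1)] .
  moreover have "y0 \<in> Y \<inter> \<sigma> -` W" using Y WB g0 by (simp add: \<sigma>_def)
  ultimately have "open (B \<inter> (Y \<inter> \<sigma> -` W))" "y0 \<in> B \<inter> (Y \<inter> \<sigma> -` W)"
    using WB by (auto intro: open_Int)
  then obtain \<delta> where \<delta>: "\<delta> > 0" "ball y0 \<delta> \<subseteq> B \<inter> (Y \<inter> \<sigma> -` W)"
    using openE by blast
  have bl: "((\<lambda>y. (0 :: 'a, y)) has_derivative (\<lambda>h. (0, h))) (at y0)"
    by (intro has_derivative_Pair has_derivative_const has_derivative_ident)
  have "((\<lambda>y. g (0, y)) has_derivative (\<lambda>h. g' (0, y0) (0, h))) (at y0)"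
    using V(2) \<Psi>0 by (intro has_derivative_compose[OF bl g']) simp
  then have \<sigma>': "(\<sigma> has_derivative (\<lambda>h. fst (g' (0, y0) (0, h)))) (at y0)"
    unfolding \<sigma>_def[abs_def] by (rule has_derivative_fst)
  have \<sigma>0: "\<sigma> y0 = x0" using g0 by (simp add: \<sigma>_def)
  show thesis
  proof (rule that[of W \<delta> \<sigma>])
    show "W \<times> ball y0 \<delta> \<subseteq> N" using \<delta>(2) WB(4) U'(2) by blast
    show "\<sigma> y \<in> W \<and> f (\<sigma> y, y) = 0" if "y \<in> ball y0 \<delta>" for y
      using \<delta>(2) that snd_g[of y] by (auto simp: Y_def)
    show "x = \<sigma> y" if "x \<in> W" "y \<in> ball y0 \<delta>" "f (x, y) = 0" for x y
    proof -
      have "(x, y) \<in> U'" using that \<delta>(2) WB(4) by blast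
      then have "g (\<Psi> (x, y)) = (x, y)" using homeomorphism_apply1[OF hom] by blast
      then show ?thesis using that(3) by (simp add: \<Psi>_def \<sigma>_def)
    qed
    show "continuous_on (ball y0 \<delta>) \<sigma>" using cont_\<sigma> \<delta>(2) continuous_on_subset by blast
    show "f' (fst (g' (0, y0) (0, h)), h) = 0" for h
    proof -
      have "((\<lambda>y. f (\<sigma> y, y)) has_derivative (\<lambda>h. f' (fst (g' (0, y0) (0, h)), h))) (at y0)"
        using f' \<sigma>0 by (intro has_derivative_compose[OF has_derivative_Pair[OF \<sigma>' has_derivative_ident]]) simp
      moreover have "((\<lambda>y. f (\<sigma> y, y)) has_derivative (\<lambda>h. 0)) (at y0)"
      proof (rule has_derivative_transform_within_open[OF has_derivative_const Y])
        show "0 = f (\<sigma> y, y)" if "y \<in> Y" for y using snd_g[of y] that by (simp add: Y_def)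
      qed
      ultimately have "(\<lambda>h. f' (fst (g' (0, y0) (0, h)), h)) = (\<lambda>h. 0)" by (rule has_derivative_unique)
      then show ?thesis by (rule fun_cong)
    qed
  qed (use WB \<delta> \<sigma>' \<sigma>0 in auto)
qed


section \<open>Curves in the unit-determinant matrices\<close>

text \<open>The geodesics of the affine-invariant metric, in a frame \<open>G\<close> that diagonalizes the base point
  and the velocity.\<close>

definition geo :: "real^'n^'n \<Rightarrow> real^'n \<Rightarrow> real \<Rightarrow> real^'n^'n" where
  "geo G a t = G ** diagm (\<chi> i. exp (t * a $ i)) ** transpose G"

lemma geo_0: "geo G a 0 = G ** transpose G"
  by (simp add: geo_def diagm_one)

lemma spd_geo: "invertible G \<Longrightarrow> spd (geo G a t)"
  unfolding geo_def by (intro spd_congruence) (simp_all add: spd_diagm)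

lemma det_geo: "det (geo G a t) = (det G)\<^sup>2 * exp (t * (\<Sum>i\<in>UNIV. a $ i))"
  by (simp add: geo_def det_congruence det_diagm exp_sum sum_distrib_left)

lemma geo_has_vector_derivative:
  "(geo G a has_vector_derivative G ** diagm (\<chi> i. a $ i * exp (t * a $ i)) ** transpose G) (at t within A)"
  unfolding geo_def[abs_def]
  by (rule diagonal_frame_has_vector_derivative)
    (auto intro!: derivative_eq_intros simp: has_real_derivative_iff_has_vector_derivative[symmetric])

lemma geo_velocity_0: "G ** diagm (\<chi> i. a $ i * exp (0 * a $ i)) ** transpose G = G ** diagm a ** transpose G"
  by simp

lemma geo_inv:
  assumes G: "invertible G"
  shows "matrix_inv (geo G a t) =
    transpose (matrix_inv G) ** diagm (\<chi> i. exp (- t * a $ i)) ** matrix_inv G"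
proof (rule matrix_inv_unique)
  have "geo G a t ** (transpose (matrix_inv G) ** diagm (\<chi> i. exp (- t * a $ i)) ** matrix_inv G) =
      G ** diagm (\<chi> i. exp (t * a $ i)) ** transpose (matrix_inv G ** G) **
      diagm (\<chi> i. exp (- t * a $ i)) ** matrix_inv G"
    by (simp add: geo_def matrix_transpose_mul matrix_mul_assoc)
  also have "\<dots> = G ** (diagm (\<chi> i. exp (t * a $ i)) ** diagm (\<chi> i. exp (- t * a $ i))) ** matrix_inv G"
    by (simp add: matrix_inv_left[OF G] matrix_mul_assoc)
  also have "\<dots> = mat 1"
    by (simp add: diagm_mult diagm_one matrix_inv_right[OF G] flip: exp_add)
  finally show "geo G a t ** (transpose (matrix_inv G) ** diagm (\<chi> i. exp (- t * a $ i)) ** matrix_inv G) = mat 1" .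
qed

lemma geo_log_velocity:
  assumes G: "invertible G"
  shows "matrix_inv (geo G a t) ** (G ** diagm (\<chi> i. a $ i * exp (t * a $ i)) ** transpose G) =
    transpose (matrix_inv G) ** diagm a ** transpose G"
proof -
  have "matrix_inv (geo G a t) ** (G ** diagm (\<chi> i. a $ i * exp (t * a $ i)) ** transpose G) =
      transpose (matrix_inv G) ** diagm (\<chi> i. exp (- t * a $ i)) ** (matrix_inv G ** G) **
      diagm (\<chi> i. a $ i * exp (t * a $ i)) ** transpose G"
    by (simp add: geo_inv[OF G] matrix_mul_assoc)
  also have "\<dots> = transpose (matrix_inv G) ** (diagm (\<chi> i. exp (- t * a $ i)) **
      diagm (\<chi> i. a $ i * exp (t * a $ i))) ** transpose G"
    by (simp add: matrix_inv_left[OF G] matrix_mul_assoc)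
  also have "diagm (\<chi> i. exp (- t * a $ i)) ** diagm (\<chi> i. a $ i * exp (t * a $ i)) = diagm a"
    unfolding diagm_mult
    by (rule arg_cong[where f = diagm]) (simp add: vec_eq_iff mult.left_commute flip: exp_add)
  finally show ?thesis .
qed

lemma spd1_imp_spd: "P \<in> spd1 \<Longrightarrow> spd P" and spd1_det: "P \<in> spd1 \<Longrightarrow> det P = 1"
  by (simp_all add: spd1_def)

lemma tangent1_geo:
  fixes P :: "real^'n^'n"
  assumes P: "P \<in> spd1" and X: "X \<in> tangent1 P"
  obtains G :: "real^'n^'n" and a where "invertible G" "geo G a 0 = P" "G ** diagm a ** transpose G = X"
    "\<And>t. geo G a t \<in> spd1" "(\<Sum>i\<in>UNIV. a $ i) = 0"
proof -
  have "transpose X = X" using X by (simp add: tangent1_def)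
  then obtain G :: "real^'n^'n" and a where G: "invertible G" "P = G ** transpose G" "X = G ** diagm a ** transpose G"
    using simultaneous_diagonalization[OF spd1_imp_spd[OF P]] by blast
  have P0: "geo G a 0 = P" by (simp add: geo_0 G)
  have "0 = trace (matrix_inv (geo G a 0) ** X)" using X by (simp add: P0 tangent1_def)
  also have "\<dots> = trace (transpose (matrix_inv G) ** diagm a ** transpose G)"
    using geo_log_velocity[OF G(1), of a 0] by (simp add: G(3))
  also have "\<dots> = trace (transpose (matrix_inv G ** G) ** diagm a)"
    by (metis matrix_mul_assoc matrix_transpose_mul trace_mul_sym)
  also have "\<dots> = (\<Sum>i\<in>UNIV. a $ i)" by (simp add: matrix_inv_left[OF G(1)] trace_diagm)
  finally have sum: "(\<Sum>i\<in>UNIV. a $ i) = 0" by simp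
  have "(det G)\<^sup>2 = 1" using spd1_det[OF P] det_geo[of G a 0] by (simp add: P0)
  then have "geo G a t \<in> spd1" for t
    by (simp add: spd1_def spd_geo[OF G(1)] det_geo sum)
  then show thesis using that G P0 sum by blast
qed

text \<open>In a frame in which the first point is the identity and the second is diagonal, the geodesic
  consists of the powers of the second.\<close>

lemma spd1_connecting_geo:
  fixes P P' :: "real^'n^'n"
  assumes P: "P \<in> spd1" and P': "P' \<in> spd1"
  obtains G :: "real^'n^'n" and a where "invertible G" "geo G a 0 = P" "geo G a 1 = P'"
    "\<And>t. geo G a t \<in> spd1" "(\<Sum>i\<in>UNIV. a $ i) = 0"
proof -
  obtain G :: "real^'n^'n" and w where G: "invertible G" "P = G ** transpose G" "P' = G ** diagm w ** transpose G"
    using simultaneous_diagonalization[OF spd1_imp_spd[OF P] spd_transpose[OF spd1_imp_spd[OF P']]] by blast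
  have iG: "invertible (matrix_inv G)" using G(1) by (rule invertible_matrix_inv)
  have "spd (matrix_inv G ** P' ** transpose (matrix_inv G))"
    by (rule spd_congruence[OF spd1_imp_spd[OF P'] iG])
  also have "matrix_inv G ** P' ** transpose (matrix_inv G) =
      (matrix_inv G ** G) ** diagm w ** transpose (matrix_inv G ** G)"
    by (simp add: G(3) matrix_transpose_mul matrix_mul_assoc)
  finally have w: "w $ i > 0" for i by (simp add: matrix_inv_left[OF G(1)] spd_diagm)
  define a where "a = (\<chi> i. ln (w $ i))"
  have 0: "geo G a 0 = P" by (simp add: geo_0 G)
  have 1: "geo G a 1 = P'" using w by (simp add: geo_def a_def G(3))
  have dG: "(det G)\<^sup>2 = 1" using spd1_det[OF P] det_geo[of G a 0] by (simp add: 0)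
  then have "exp (\<Sum>i\<in>UNIV. a $ i) = 1" using spd1_det[OF P'] det_geo[of G a 1] by (simp add: 1)
  then have sum: "(\<Sum>i\<in>UNIV. a $ i) = 0" by simp
  have "geo G a t \<in> spd1" for t
    by (simp add: spd1_def spd_geo[OF G(1)] det_geo sum dG)
  then show thesis using that[of G a] G(1) 0 1 sum by blast
qed

lemma has_vector_derivative_along_geo:
  fixes g :: "real^'n^'n \<Rightarrow> 'b::real_normed_vector"
  assumes D: "(g has_derivative D) (at (geo G a t) within spd1)" and geo: "\<And>t. geo G a t \<in> spd1"
  shows "((\<lambda>t. g (geo G a t)) has_vector_derivative
    D (G ** diagm (\<chi> i. a $ i * exp (t * a $ i)) ** transpose G)) (at t)"
proof -
  have "range (geo G a) \<subseteq> spd1" using geo by auto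
  with D have "(g has_derivative D) (at (geo G a t) within range (geo G a))"
    using has_derivative_subset by blast
  moreover have "(geo G a has_derivative (\<lambda>h. h *\<^sub>R (G ** diagm (\<chi> i. a $ i * exp (t * a $ i)) ** transpose G)))
      (at t within UNIV)"
    using geo_has_vector_derivative by (simp add: has_vector_derivative_def)
  ultimately have "((\<lambda>t. g (geo G a t)) has_derivative
      (\<lambda>h. D (h *\<^sub>R (G ** diagm (\<chi> i. a $ i * exp (t * a $ i)) ** transpose G)))) (at t within UNIV)"
    by (rule has_derivative_in_compose[rotated])
  then show ?thesis
    using linear_cmul[OF has_derivative_linear[OF D]] by (simp add: has_vector_derivative_def)
qed


section \<open>Calculus on the unit-determinant matrices\<close>

lemma has_derivative_spd1_unique:
  fixes g :: "real^'n^'n \<Rightarrow> 'b::real_normed_vector"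
  assumes "(g has_derivative D) (at P within spd1)" "(g has_derivative D') (at P within spd1)"
    and P: "P \<in> spd1" and X: "X \<in> tangent1 P"
  shows "D X = D' X"
proof -
  obtain G a where G: "geo G a 0 = P" "G ** diagm a ** transpose G = X" "\<And>t. geo G a t \<in> spd1"
    using tangent1_geo[OF P X] by metis
  have "((\<lambda>t. g (geo G a t)) has_vector_derivative D X) (at 0)"
    "((\<lambda>t. g (geo G a t)) has_vector_derivative D' X) (at 0)"
    using has_vector_derivative_along_geo[of g D G a 0] has_vector_derivative_along_geo[of g D' G a 0] G assms(1,2)
    by (simp_all only: geo_velocity_0)
  then show ?thesis using vector_derivative_unique_at by blast
qed

text \<open>The Frechet derivative within \<^const>\<open>spd1\<close> is an arbitrary choice off the tangent space; on the
  tangent space it can be computed from any derivative.\<close>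

lemma frechet_derivative_spd1:
  fixes g :: "real^'n^'n \<Rightarrow> 'b::real_normed_vector"
  assumes D: "(g has_derivative D) (at P within spd1)" and P: "P \<in> spd1" and X: "X \<in> tangent1 P"
  shows "frechet_derivative g (at P within spd1) X = D X"
proof -
  have "g differentiable (at P within spd1)" using D by (auto simp: differentiable_def)
  then show ?thesis
    using has_derivative_spd1_unique[OF _ D P X] by (simp add: frechet_derivative_works)
qed

definition symp :: "real^'n^'n \<Rightarrow> real^'n^'n" where
  "symp X = (1/2) *\<^sub>R (X + transpose X)"

definition skewp :: "real^'n^'n \<Rightarrow> real^'n^'n" where
  "skewp X = (1/2) *\<^sub>R (X - transpose X)"

lemma symp_skewp: "symp X + skewp X = X"
  by (simp add: symp_def skewp_def vec_eq_iff field_simps)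

lemma linear_symp: "linear symp"
  unfolding symp_def[abs_def] by (rule linearI) (simp_all add: transpose_add transpose_scalar algebra_simps)

lemma linear_skewp: "linear skewp"
  unfolding skewp_def[abs_def] by (rule linearI) (simp_all add: transpose_add transpose_scalar algebra_simps)

lemma transpose_symp: "transpose (symp X) = symp X"
  by (simp add: symp_def transpose_scalar transpose_add add.commute)

lemma transpose_skewp: "transpose (skewp X) = - skewp X"
  by (simp add: skewp_def transpose_scalar transpose_diff flip: scaleR_minus_right)

lemma symp_of_symmetric: "transpose X = X \<Longrightarrow> symp X = X"
  by (simp add: symp_def vec_eq_iff)

lemma skewp_of_symmetric: "transpose X = X \<Longrightarrow> skewp X = 0"
  by (simp add: skewp_def)

lemma inner_symp: "transpose X = X \<Longrightarrow> symp Y \<bullet> X = Y \<bullet> X"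
  using inner_transpose[of Y X] by (simp add: symp_def inner_add_left)

lemma trace_symmetric_skew: "transpose A = A \<Longrightarrow> trace (A ** skewp X) = 0"
proof -
  assume A: "transpose A = A"
  have "trace (A ** skewp X) = trace (transpose (A ** skewp X))" by (simp only: trace_transpose)
  also have "\<dots> = - trace (A ** skewp X)"
    by (simp add: matrix_transpose_mul A transpose_skewp matrix_minus_left trace_mul_sym[of A])
      (simp add: trace_def sum_negf)
  finally show ?thesis by simp
qed

lemma subspace_tangent1: "subspace (tangent1 P)"
  unfolding subspace_def tangent1_def
  by (auto simp: transpose_add transpose_scalar matrix_add_ldistrib trace_add matrix_scaleR_right
      trace_scaleR matrix_mult_0_right trace_def[of 0])

text \<open>On \<^const>\<open>spd1\<close> the map \<open>X \<mapsto> skew X + (det X - 1) P / n\<close> vanishes, and its derivative at \<open>P\<close>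
  is the projection along the tangent space. Adding a linear image of it to a function changes the
  ambient derivative off the tangent space without changing the function.\<close>

lemma has_derivative_spd1_cong:
  fixes g :: "real^'n^'n \<Rightarrow> 'b::real_normed_vector"
  assumes g: "(g has_derivative D) (at P within spd1)" and P: "P \<in> spd1" and D': "bounded_linear D'"
    and eq: "\<And>X. X \<in> tangent1 P \<Longrightarrow> D' X = D X"
  shows "(g has_derivative D') (at P within spd1)"
proof -
  have sP: "spd P" and dP: "det P = 1" using P by (simp_all add: spd1_def)
  have iP: "invertible P" using sP by (rule spd_invertible)
  have bD: "bounded_linear D" using g by (rule has_derivative_bounded_linear)
  let ?n = "real CARD('n)"
  define \<Lambda> where "\<Lambda> = (\<lambda>X. D' X - D X)"
  define q where "q = (\<lambda>E. skewp E + (trace (matrix_inv P ** E) / ?n) *\<^sub>R P)"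
  have b\<Lambda>: "bounded_linear \<Lambda>" unfolding \<Lambda>_def by (rule bounded_linear_sub[OF D' bD])
  have tang: "E - q E \<in> tangent1 P" for E
  proof -
    have "E - q E = symp E - (trace (matrix_inv P ** E) / ?n) *\<^sub>R P"
      using symp_skewp[of E] by (simp add: q_def algebra_simps)
    moreover have "trace (matrix_inv P ** E) = trace (matrix_inv P ** symp E)"
      using trace_symmetric_skew[OF transpose_matrix_inv_spd[OF sP], of E]
        trace_add[of "matrix_inv P ** symp E" "matrix_inv P ** skewp E"]
      by (simp add: symp_skewp flip: matrix_add_ldistrib)
    ultimately show ?thesis
      by (simp add: tangent1_def transpose_diff transpose_symp transpose_scalar spd_transpose[OF sP]
          matrix_diff_ldistrib trace_sub matrix_scaleR_right trace_scaleR matrix_inv_left[OF iP] trace_I)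
  qed
  have \<Lambda>q: "\<Lambda> (q E) = \<Lambda> E" for E
  proof -
    have "\<Lambda> (E - q E) = 0" using eq[OF tang] by (simp add: \<Lambda>_def)
    then show ?thesis by (simp add: linear_diff[OF bounded_linear.linear[OF b\<Lambda>]])
  qed
  have dskew: "(skewp has_derivative skewp) (at P within spd1)"
    using linear_skewp linear_conv_bounded_linear bounded_linear_imp_has_derivative by blast
  have ddet: "(det has_derivative (\<lambda>E. trace (matrix_inv P ** E))) (at P within spd1)"
    using has_derivative_at_withinI[OF has_derivative_det[OF iP]] by (simp add: dP)
  have "((\<lambda>X. skewp X + ((det X - 1) / ?n) *\<^sub>R P) has_derivative q) (at P within spd1)"
    unfolding q_def by (auto intro!: derivative_eq_intros dskew ddet)
  then have "((\<lambda>X. \<Lambda> (skewp X + ((det X - 1) / ?n) *\<^sub>R P)) has_derivative (\<lambda>E. \<Lambda> (q E))) (at P within spd1)"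
    by (rule bounded_linear.has_derivative[OF b\<Lambda>])
  then have "((\<lambda>X. g X + \<Lambda> (skewp X + ((det X - 1) / ?n) *\<^sub>R P)) has_derivative (\<lambda>E. D E + \<Lambda> (q E))) (at P within spd1)"
    by (rule has_derivative_add[OF g])
  then have "((\<lambda>X. g X + \<Lambda> (skewp X + ((det X - 1) / ?n) *\<^sub>R P)) has_derivative D') (at P within spd1)"
    by (simp add: \<Lambda>q) (simp add: \<Lambda>_def)
  then show ?thesis
    by (rule has_derivative_transform[OF P, rotated])
      (simp add: spd1_def spd_transpose skewp_of_symmetric linear_0[OF bounded_linear.linear[OF b\<Lambda>]])
qed

lemma local_min_critical1:
  assumes D: "(g has_derivative D) (at P within spd1)" and P: "P \<in> spd1"
    and W: "open W" "P \<in> W" "\<And>P'. P' \<in> W \<inter> spd1 \<Longrightarrow> g P \<le> g P'"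
  shows "is_critical1 g P"
proof -
  have "D X = 0" if X: "X \<in> tangent1 P" for X
  proof -
    obtain G a where G: "geo G a 0 = P" "G ** diagm a ** transpose G = X" "\<And>t. geo G a t \<in> spd1"
      using tangent1_geo[OF P X] by metis
    have "((\<lambda>t. g (geo G a t)) has_vector_derivative D X) (at 0)"
      using has_vector_derivative_along_geo[of g D G a 0] G D by (simp only: geo_velocity_0)
    then have der: "((\<lambda>t. g (geo G a t)) has_real_derivative D X) (at 0)"
      by (simp add: has_real_derivative_iff_has_vector_derivative)
    have cont: "continuous_on UNIV (geo G a)"
      by (rule continuous_at_imp_continuous_on, intro ballI)
        (rule has_vector_derivative_continuous[OF geo_has_vector_derivative])
    have "open (geo G a -` W)" using open_vimage[OF W(1) cont] .
    then obtain e where e: "e > 0" "ball 0 e \<subseteq> geo G a -` W"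
      using G(1) W(2) openE by (metis vimage_eq)
    show "D X = 0"
      by (rule DERIV_local_min[OF der e(1)]) (use e(2) G W(3) in \<open>auto simp: dist_norm subset_iff\<close>)
  qed
  then show ?thesis unfolding is_critical1_def using D P by blast
qed


section \<open>Riemannian gradient and Hessian\<close>

lemma eq_minus_self_iff: "X = - X \<longleftrightarrow> X = 0" for X :: "'a::real_vector"
proof
  assume "X = - X"
  then have "X + X = 0" by (simp add: eq_neg_iff_add_eq_0)
  then show "X = 0" by (simp flip: scaleR_2)
qed simp

lemma linear_airm_left: "linear (\<lambda>X. airm P X Y)"
  unfolding airm_def
  by (rule linearI) (simp_all add: matrix_add_ldistrib matrix_add_rdistrib trace_add
      matrix_scaleR_left matrix_scaleR_right trace_scaleR)

lemma linear_airm_right: "linear (airm P X)"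
  unfolding airm_def
  by (rule linearI) (simp_all add: matrix_add_ldistrib trace_add matrix_scaleR_right trace_scaleR)

lemma airm_pos:
  fixes P :: "real^'n^'n"
  assumes P: "spd P" and X: "transpose X = X" "X \<noteq> 0"
  shows "airm P X X > 0"
proof -
  obtain G :: "real^'n^'n" and a where G: "invertible G" "P = G ** transpose G" "X = G ** diagm a ** transpose G"
    using simultaneous_diagonalization[OF P X(1)] by blast
  have "P = geo G a 0" by (simp add: geo_0 G)
  then have PX: "matrix_inv P ** X = transpose (matrix_inv G) ** diagm a ** transpose G"
    using geo_log_velocity[OF G(1), of a 0] by (simp add: G(3))
  have "airm P X X = trace ((matrix_inv P ** X) ** (matrix_inv P ** X))"
    by (simp add: airm_def matrix_mul_assoc)
  also have "\<dots> = trace (transpose (matrix_inv G) ** (diagm a ** transpose (matrix_inv G ** G) ** diagm a ** transpose G))"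
    by (simp add: PX matrix_transpose_mul matrix_mul_assoc)
  also have "\<dots> = trace ((diagm a ** diagm a) ** transpose (matrix_inv G ** G))"
    by (subst trace_mul_sym) (simp add: matrix_inv_left[OF G(1)] matrix_transpose_mul[symmetric]
      flip: matrix_mul_assoc)
  also have "\<dots> = (\<Sum>i\<in>UNIV. (a $ i)\<^sup>2)"
    by (simp add: matrix_inv_left[OF G(1)] diagm_mult trace_diagm power2_eq_square)
  finally have eq: "airm P X X = (\<Sum>i\<in>UNIV. (a $ i)\<^sup>2)" .
  have "a \<noteq> 0"
  proof
    assume "a = 0"
    then have "diagm a = 0" by (simp add: diagm_def vec_eq_iff)
    then show False using X(2) G(3) by (simp add: matrix_mult_0_left matrix_mult_0_right)
  qed
  then obtain k where "a $ k \<noteq> 0" by (auto simp: vec_eq_iff)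
  then show ?thesis unfolding eq by (intro sum_pos2[of _ k]) auto
qed

lemma airm_eq_imp_eq:
  assumes P: "P \<in> spd1" and XY: "X \<in> tangent1 P" "Y \<in> tangent1 P"
    and eq: "\<And>Z. Z \<in> tangent1 P \<Longrightarrow> airm P X Z = airm P Y Z"
  shows "X = Y"
proof (rule ccontr)
  assume "X \<noteq> Y"
  have XY': "X - Y \<in> tangent1 P" using XY subspace_tangent1 subspace_diff by blast
  then have "airm P (X - Y) (X - Y) > 0"
    using \<open>X \<noteq> Y\<close> by (intro airm_pos spd1_imp_spd P) (auto simp: tangent1_def)
  then show False using eq[OF XY'] by (simp add: linear_diff[OF linear_airm_left])
qed

text \<open>The Riemannian gradient at \<open>X\<close> of a function with ambient gradient \<open>\<Gamma>\<close>. It is polynomial in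
  both arguments, so it is as smooth as \<open>\<Gamma>\<close>.\<close>

definition rgrad :: "real^'n^'n \<Rightarrow> real^'n^'n \<Rightarrow> real^'n^'n" where
  "rgrad X \<Gamma> = X ** symp \<Gamma> ** X - ((X \<bullet> symp \<Gamma>) / real CARD('n)) *\<^sub>R X"

lemma linear_rgrad: "linear (rgrad X)"
  unfolding rgrad_def
  by (rule linearI) (simp_all add: linear_add[OF linear_symp] linear_cmul[OF linear_symp]
      matrix_add_ldistrib matrix_add_rdistrib matrix_scaleR_left matrix_scaleR_right inner_add_right
      add_divide_distrib scaleR_add_left scaleR_diff_right)

lemma cont_diff_on_rgrad:
  assumes "cont_diff_on F U" "cont_diff_on \<Gamma> U"
  shows "cont_diff_on (\<lambda>z. rgrad (F z) (\<Gamma> z)) U"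
  unfolding rgrad_def divide_inverse
  by (intro cont_diff_on_diff cont_diff_on_matrix_mult cont_diff_on_scaleR cont_diff_on_mult cont_diff_on_inner
      cont_diff_on_const cont_diff_on_linear_compose[OF linear_symp] assms)

lemma transpose_rgrad: "transpose X = X \<Longrightarrow> transpose (rgrad X \<Gamma>) = rgrad X \<Gamma>"
  by (simp add: rgrad_def transpose_diff transpose_scalar matrix_transpose_mul transpose_symp matrix_mul_assoc)

lemma trace_rgrad:
  fixes X :: "real^'n^'n"
  assumes X: "transpose X = X" "invertible X"
  shows "trace (matrix_inv X ** rgrad X \<Gamma>) = 0"
proof -
  have "trace (matrix_inv X ** rgrad X \<Gamma>) = trace (symp \<Gamma> ** X) - X \<bullet> symp \<Gamma>"
    by (simp add: rgrad_def matrix_diff_ldistrib trace_sub matrix_scaleR_right trace_scaleR trace_I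
        matrix_inv_left[OF X(2)] matrix_mul_assoc)
  then show ?thesis by (simp add: inner_matrix_trace X trace_mul_sym[of X])
qed

lemma rgrad_tangent: "P \<in> spd1 \<Longrightarrow> rgrad P \<Gamma> \<in> tangent1 P"
  using trace_rgrad[of P] by (simp add: tangent1_def transpose_rgrad spd1_imp_spd spd_transpose spd_invertible)

lemma airm_rgrad:
  fixes P :: "real^'n^'n"
  assumes P: "P \<in> spd1" and E: "E \<in> tangent1 P"
  shows "airm P (rgrad P \<Gamma>) E = \<Gamma> \<bullet> E"
proof -
  have iP: "invertible P" using P spd1_imp_spd spd_invertible by blast
  have "airm P (rgrad P \<Gamma>) E = trace (symp \<Gamma> ** E) - (P \<bullet> symp \<Gamma>) / real CARD('n) * trace (matrix_inv P ** E)"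
    by (simp add: airm_def rgrad_def matrix_diff_ldistrib matrix_diff_rdistrib trace_sub
        matrix_scaleR_left matrix_scaleR_right trace_scaleR matrix_mul_assoc matrix_inv_left[OF iP]
        matrix_inv_cancel[OF iP])
  also have "\<dots> = symp \<Gamma> \<bullet> E" using E by (simp add: tangent1_def inner_matrix_trace transpose_symp)
  also have "\<dots> = \<Gamma> \<bullet> E" using E by (simp add: tangent1_def inner_symp)
  finally show ?thesis .
qed

lemma is_critical1_iff:
  assumes D: "(g has_derivative (\<lambda>E. \<Gamma> \<bullet> E)) (at P within spd1)" and P: "P \<in> spd1"
  shows "is_critical1 g P \<longleftrightarrow> rgrad P \<Gamma> = 0"
proof
  assume "is_critical1 g P"
  then obtain D' where D': "(g has_derivative D') (at P within spd1)" "\<forall>X\<in>tangent1 P. D' X = 0"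
    unfolding is_critical1_def by blast
  show "rgrad P \<Gamma> = 0"
  proof (rule airm_eq_imp_eq[OF P rgrad_tangent[OF P]])
    show "0 \<in> tangent1 P" using subspace_tangent1 subspace_0 by blast
    show "airm P (rgrad P \<Gamma>) Z = airm P 0 Z" if "Z \<in> tangent1 P" for Z
      using has_derivative_spd1_unique[OF D D'(1) P that] D'(2) that
      by (simp add: airm_rgrad[OF P that] linear_0[OF linear_airm_left])
  qed
next
  assume "rgrad P \<Gamma> = 0"
  then have "\<Gamma> \<bullet> X = 0" if "X \<in> tangent1 P" for X
    using airm_rgrad[OF P that, of \<Gamma>] by (simp add: linear_0[OF linear_airm_left])
  then show "is_critical1 g P" unfolding is_critical1_def using D P by blast
qed

lemma grad1_eq_rgrad:
  assumes D: "(g has_derivative (\<lambda>E. \<Gamma> \<bullet> E)) (at P within spd1)" and P: "P \<in> spd1"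
  shows "grad1 g P = rgrad P \<Gamma>"
  unfolding grad1_def
proof (rule the_equality)
  have "(g has_derivative airm P (rgrad P \<Gamma>)) (at P within spd1)"
    by (rule has_derivative_spd1_cong[OF D P])
      (simp_all add: airm_rgrad[OF P] linear_airm_right linear_conv_bounded_linear[symmetric])
  then show "rgrad P \<Gamma> \<in> tangent1 P \<and> (g has_derivative airm P (rgrad P \<Gamma>)) (at P within spd1)"
    using rgrad_tangent[OF P] by blast
next
  fix Y assume Y: "Y \<in> tangent1 P \<and> (g has_derivative airm P Y) (at P within spd1)"
  show "Y = rgrad P \<Gamma>"
  proof (rule airm_eq_imp_eq[OF P _ rgrad_tangent[OF P]])
    show "airm P Y Z = airm P (rgrad P \<Gamma>) Z" if "Z \<in> tangent1 P" for Z
      using has_derivative_spd1_unique[OF _ D P that, of "airm P Y"] Y that by (simp add: airm_rgrad[OF P])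
  qed (use Y in blast)
qed

text \<open>At a critical point the gradient vanishes, and with it the connection terms of the covariant
  derivative: the Hessian is the plain derivative of the gradient field.\<close>

lemma hess1_at_critical:
  assumes S: "S \<in> spd1" and W: "open W" "S \<in> W"
    and D: "\<And>P. P \<in> W \<inter> spd1 \<Longrightarrow> (g has_derivative (\<lambda>E. \<Gamma> P \<bullet> E)) (at P within spd1)"
    and R: "((\<lambda>P. rgrad P (\<Gamma> P)) has_derivative R) (at S)" and crit: "rgrad S (\<Gamma> S) = 0"
    and X: "X \<in> tangent1 S"
  shows "hess1 g S X Y = airm S (R X) Y"
proof -
  have grad: "grad1 g P = rgrad P (\<Gamma> P)" if "P \<in> W \<inter> spd1" for P
    using grad1_eq_rgrad[OF D] that by blast
  obtain e where e: "e > 0" "ball S e \<subseteq> W" using W openE by blast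
  have "(grad1 g has_derivative R) (at S within spd1)"
    by (rule has_derivative_transform_within[OF has_derivative_at_withinI[OF R] e(1) S])
      (use e grad in \<open>auto simp: dist_commute subset_iff\<close>)
  then have "frechet_derivative (grad1 g) (at S within spd1) X = R X"
    using frechet_derivative_spd1 S X by blast
  then show ?thesis
    using grad[of S] S W crit by (simp add: hess1_def cov_deriv1_def matrix_mult_0_left matrix_mult_0_right)
qed

text \<open>At a zero of the gradient field the moving point and its inverse contribute nothing to the
  derivative of the identities \<open>Y = Y\<^sup>T\<close> and \<open>tr (X\<^sup>-\<^sup>1 Y) = 0\<close> for the gradient \<open>Y\<close> at \<open>X\<close>.\<close>

lemma rgrad_derivative_tangent:
  fixes \<Gamma> :: "real^'n^'n \<Rightarrow> real^'n^'n"
  assumes S: "S \<in> spd1" and crit: "rgrad S (\<Gamma> S) = 0"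
    and R: "((\<lambda>X. rgrad X (\<Gamma> X)) has_derivative R) (at S)"
  shows "R (symp E) \<in> tangent1 S"
proof -
  have sS: "spd S" using S by (rule spd1_imp_spd)
  have iS: "invertible S" using sS by (rule spd_invertible)
  have symS: "symp S = S" using sS by (simp add: symp_of_symmetric spd_transpose)
  let ?r = "\<lambda>X. rgrad (symp X) (\<Gamma> (symp X))"
  have bs: "bounded_linear (symp :: real^'n^'n \<Rightarrow> _)"
    using linear_symp linear_conv_bounded_linear by blast
  have dsymp: "(symp has_derivative symp) (at S)" by (rule bounded_linear_imp_has_derivative[OF bs])
  have r: "(?r has_derivative (\<lambda>E. R (symp E))) (at S)"
    using has_derivative_compose[OF dsymp, of "\<lambda>X. rgrad X (\<Gamma> X)" R] R by (simp add: symS)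
  have bt: "bounded_linear (transpose :: real^'n^'n \<Rightarrow> _)"
    using linear_transpose linear_conv_bounded_linear by blast
  have "((\<lambda>X. transpose (?r X)) has_derivative (\<lambda>E. transpose (R (symp E)))) (at S)"
    by (rule bounded_linear.has_derivative[OF bt r])
  then have "(?r has_derivative (\<lambda>E. transpose (R (symp E)))) (at S)"
    by (simp add: transpose_rgrad transpose_symp)
  from fun_cong[OF has_derivative_unique[OF this r]]
  have 1: "transpose (R (symp E)) = R (symp E)" .
  have dinv: "((\<lambda>X. matrix_inv (symp X)) has_derivative (\<lambda>E. - (matrix_inv S ** symp E ** matrix_inv S))) (at S)"
    using has_derivative_compose[OF dsymp, of matrix_inv] has_derivative_matrix_inv[OF iS] by (simp add: symS)
  have btr: "bounded_linear (trace :: real^'n^'n \<Rightarrow> real)"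
    using linear_trace linear_conv_bounded_linear by blast
  have "((\<lambda>X. trace (matrix_inv (symp X) ** ?r X)) has_derivative
      (\<lambda>E. trace (matrix_inv (symp S) ** R (symp E) + - (matrix_inv S ** symp E ** matrix_inv S) ** ?r S))) (at S)"
    by (intro bounded_linear.has_derivative[OF btr] bounded_bilinear.FDERIV[OF bounded_bilinear_matrix_mult] dinv r)
  then have tr: "((\<lambda>X. trace (matrix_inv (symp X) ** ?r X)) has_derivative
      (\<lambda>E. trace (matrix_inv S ** R (symp E)))) (at S)"
    by (simp add: symS crit matrix_mult_0_right)
  have "continuous_on UNIV (symp :: real^'n^'n \<Rightarrow> _)" by (rule linear_continuous_on[OF bs])
  then have op: "open (symp -` {A :: real^'n^'n. invertible A})" by (rule open_vimage[OF open_invertible])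
  have mem: "S \<in> symp -` {A. invertible A}" by (simp add: symS iS)
  have "((\<lambda>X. trace (matrix_inv (symp X) ** ?r X)) has_derivative (\<lambda>E. 0)) (at S)"
    by (rule has_derivative_transform_within_open[OF has_derivative_const op mem])
      (simp add: trace_rgrad transpose_symp)
  from fun_cong[OF has_derivative_unique[OF tr this]]
  have 2: "trace (matrix_inv S ** R (symp E)) = 0" .
  show ?thesis using 1 2 by (simp add: tangent1_def)
qed

text \<open>The extension to all matrices of a map of the tangent space into itself. Modulo the tangent space
  it is injective on the complement, which consists of the sums of multiples of \<open>S\<close> and skew matrices.\<close>

definition tangent_lift :: "real^'n^'n \<Rightarrow> (real^'n^'n \<Rightarrow> real^'n^'n) \<Rightarrow> real^'n^'n \<Rightarrow> real^'n^'n" where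
  "tangent_lift S R E = R (symp E) + trace (matrix_inv S ** symp E) *\<^sub>R S + skewp E"

lemma linear_tangent_lift: "linear R \<Longrightarrow> linear (tangent_lift S R)"
  unfolding tangent_lift_def
  by (rule linearI) (simp_all add: linear_add[OF linear_symp] linear_cmul[OF linear_symp] linear_add[OF linear_skewp]
      linear_cmul[OF linear_skewp] linear_add[of R] linear_cmul[of R] matrix_add_ldistrib trace_add
      matrix_scaleR_right trace_scaleR algebra_simps)

lemma tangent_lift_tangent:
  fixes S :: "real^'n^'n"
  assumes S: "S \<in> spd1" and R: "\<And>E. R (symp E) \<in> tangent1 S"
    and L: "tangent_lift S R E \<in> tangent1 S"
  shows "E \<in> tangent1 S" "R E = tangent_lift S R E"
proof -
  have sS: "spd S" using S by (rule spd1_imp_spd)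
  have tL: "transpose (tangent_lift S R E) = tangent_lift S R E" using L by (simp add: tangent1_def)
  have tR: "transpose (R (symp E)) = R (symp E)" "trace (matrix_inv S ** R (symp E)) = 0"
    using R by (simp_all add: tangent1_def)
  have "skewp E = - skewp E"
    using tL tR by (simp add: tangent_lift_def transpose_add transpose_scalar spd_transpose[OF sS] transpose_skewp)
  then have sk: "skewp E = 0" using eq_minus_self_iff by blast
  then have E: "symp E = E" using symp_skewp[of E] by simp
  then have tE: "transpose E = E" using transpose_symp[of E] by simp
  have "trace (matrix_inv S ** tangent_lift S R E) = 0" using L by (simp add: tangent1_def)
  then have "trace (matrix_inv S ** symp E) * real CARD('n) = 0"
    by (simp add: tangent_lift_def matrix_add_ldistrib trace_add tR sk matrix_mult_0_right matrix_scaleR_right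
        trace_scaleR matrix_inv_left[OF spd_invertible[OF sS]] trace_I trace_def[of 0])
  then have tr: "trace (matrix_inv S ** E) = 0" by (simp add: E)
  show "E \<in> tangent1 S" using tE tr by (simp add: tangent1_def)
  show "R E = tangent_lift S R E" by (simp add: tangent_lift_def E tr sk)
qed

lemma tangent_lift_injective:
  assumes S: "S \<in> spd1" and R: "\<And>E. R (symp E) \<in> tangent1 S"
    and pos: "\<And>E. E \<in> tangent1 S \<Longrightarrow> E \<noteq> 0 \<Longrightarrow> airm S (R E) E > 0"
    and zero: "tangent_lift S R E = 0"
  shows "E = 0"
proof (rule ccontr)
  assume "E \<noteq> 0"
  have "tangent_lift S R E \<in> tangent1 S" using zero subspace_tangent1 subspace_0 by metis
  from tangent_lift_tangent[OF S R this] have "E \<in> tangent1 S" "R E = 0" using zero by auto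
  then show False using pos[of E] \<open>E \<noteq> 0\<close> by (simp add: linear_0[OF linear_airm_left])
qed

text \<open>The equation is solved for the \<^const>\<open>tangent_lift\<close>, an injective and therefore surjective map on
  the space of all matrices; a tangent right-hand side forces a tangent solution.\<close>

lemma hessian_equation_solvable:
  fixes S :: "real^'n^'n"
  assumes S: "S \<in> spd1" and lin: "linear R" and R: "\<And>E. R (symp E) \<in> tangent1 S"
    and pos: "\<And>E. E \<in> tangent1 S \<Longrightarrow> E \<noteq> 0 \<Longrightarrow> airm S (R E) E > 0"
    and \<xi>: "linear \<xi>"
  shows "\<exists>!X. X \<in> tangent1 S \<and> (\<forall>Y\<in>tangent1 S. airm S (R X) Y = \<xi> Y)"
proof -
  define \<Gamma> where "\<Gamma> = (\<Sum>b\<in>Basis. \<xi> b *\<^sub>R b)"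
  have \<Gamma>: "\<Gamma> \<bullet> Y = \<xi> Y" for Y
  proof -
    have "\<xi> Y = \<xi> (\<Sum>b\<in>Basis. (Y \<bullet> b) *\<^sub>R b)" by (simp add: euclidean_representation)
    also have "\<dots> = (\<Sum>b\<in>Basis. (Y \<bullet> b) * \<xi> b)" by (simp add: linear_sum[OF \<xi>] linear_cmul[OF \<xi>])
    also have "\<dots> = \<Gamma> \<bullet> Y"
      unfolding \<Gamma>_def inner_sum_left by (rule sum.cong) (simp_all add: inner_commute)
    finally show ?thesis by simp
  qed
  have L: "linear (tangent_lift S R)" by (rule linear_tangent_lift[OF lin])
  have "inj (tangent_lift S R)"
    unfolding linear_injective_0[OF L] using tangent_lift_injective[of S R, OF S R pos] by blast
  then have "surj (tangent_lift S R)" by (rule linear_inj_imp_surj[OF L])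
  then obtain X where X: "tangent_lift S R X = rgrad S \<Gamma>" by (metis surjD)
  have X': "X \<in> tangent1 S" "R X = rgrad S \<Gamma>"
    using tangent_lift_tangent[of S R X, OF S R] rgrad_tangent[OF S] X by auto
  show ?thesis
  proof (rule ex1I[of _ X])
    show "X \<in> tangent1 S \<and> (\<forall>Y\<in>tangent1 S. airm S (R X) Y = \<xi> Y)"
      using X' by (simp add: airm_rgrad[OF S] \<Gamma>)
  next
    fix Z assume Z: "Z \<in> tangent1 S \<and> (\<forall>Y\<in>tangent1 S. airm S (R Z) Y = \<xi> Y)"
    have ZX: "Z - X \<in> tangent1 S" using Z X'(1) subspace_tangent1 subspace_diff by blast
    have "airm S (R (Z - X)) (Z - X) = 0"
      using Z X' ZX by (simp add: linear_diff[OF lin] linear_diff[OF linear_airm_left] airm_rgrad[OF S] \<Gamma>)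
    then show "Z = X" using pos[OF ZX] by force
  qed
qed


section \<open>Branches of critical points\<close>

text \<open>The zeros of this map are the critical points on \<^const>\<open>spd1\<close>: the three summands vanish
  separately, because the first is symmetric and orthogonal to \<open>X\<close> in the affine-invariant metric,
  the second is a multiple of \<open>X\<close>, and the third is skew. Having as many equations as unknowns, it
  is suited to the implicit function theorem.\<close>

definition critical_map :: "((real^'n^'n) \<times> 'l \<Rightarrow> real^'n^'n) \<Rightarrow> (real^'n^'n) \<times> 'l \<Rightarrow> real^'n^'n" where
  "critical_map \<Gamma> z = rgrad (symp (fst z)) (\<Gamma> (symp (fst z), snd z)) +
     (det (symp (fst z)) - 1) *\<^sub>R symp (fst z) + skewp (fst z)"

lemma critical_map_zero_iff:
  fixes X :: "real^'n^'n"
  assumes X: "posdef (symp X)"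
  shows "critical_map \<Gamma> (X, l) = 0 \<longleftrightarrow> X \<in> spd1 \<and> rgrad X (\<Gamma> (X, l)) = 0"
proof
  assume z: "critical_map \<Gamma> (X, l) = 0"
  let ?X = "symp X"
  have "transpose (critical_map \<Gamma> (X, l)) = critical_map \<Gamma> (X, l)" by (simp add: z)
  then have "skewp X = - skewp X"
    by (simp add: critical_map_def transpose_add transpose_scalar transpose_symp transpose_rgrad transpose_skewp)
  then have sk: "skewp X = 0" using eq_minus_self_iff by blast
  then have XX: "symp X = X" using symp_skewp[of X] by simp
  have iX: "invertible X" using X by (simp add: XX posdef_invertible)
  have tX: "transpose X = X" using transpose_symp[of X] XX by simp
  have "trace (matrix_inv X ** critical_map \<Gamma> (X, l)) = 0" by (simp add: z matrix_mult_0_right trace_def[of 0])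
  then have "(det X - 1) * real CARD('n) = 0"
    by (simp add: critical_map_def XX sk matrix_add_ldistrib trace_add trace_rgrad[OF tX iX] matrix_scaleR_right
        trace_scaleR matrix_inv_left[OF iX] trace_I)
  then have d: "det X = 1" by simp
  then show "X \<in> spd1 \<and> rgrad X (\<Gamma> (X, l)) = 0"
    using z X tX by (simp add: critical_map_def XX sk spd1_def spd_iff_posdef)
next
  assume "X \<in> spd1 \<and> rgrad X (\<Gamma> (X, l)) = 0"
  then show "critical_map \<Gamma> (X, l) = 0"
    by (simp add: critical_map_def symp_of_symmetric skewp_of_symmetric spd1_def spd_transpose)
qed

text \<open>The implicit function theorem for \<^const>\<open>critical_map\<close>. Its derivative in the first variable is
  the \<^const>\<open>tangent_lift\<close> of the derivative \<open>R\<close> of the gradient field, which is injective when the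
  Hessian is positive definite. The last two conclusions are the linearized equation for the
  derivative of the branch.\<close>

theorem critical_branch:
  fixes \<Gamma> :: "(real^'n^'n) \<times> 'l::euclidean_space \<Rightarrow> real^'n^'n"
  assumes S: "S \<in> spd1" and N: "open N" "(S, l0) \<in> N" and \<Gamma>: "cont_diff_on \<Gamma> N"
    and crit: "rgrad S (\<Gamma> (S, l0)) = 0"
    and R: "((\<lambda>X. rgrad X (\<Gamma> (X, l0))) has_derivative R) (at S)"
    and K: "((\<lambda>l. \<Gamma> (S, l)) has_derivative K) (at l0)"
    and pos: "\<And>E. E \<in> tangent1 S \<Longrightarrow> E \<noteq> 0 \<Longrightarrow> airm S (R E) E > 0"
  obtains W \<delta> \<sigma> \<sigma>' where "open W" "S \<in> W" "\<delta> > 0"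
    "\<And>X l. X \<in> W \<Longrightarrow> l \<in> ball l0 \<delta> \<Longrightarrow> X \<in> spd1 \<Longrightarrow> (X, l) \<in> N"
    "\<And>l. l \<in> ball l0 \<delta> \<Longrightarrow> \<sigma> l \<in> W \<and> \<sigma> l \<in> spd1 \<and> rgrad (\<sigma> l) (\<Gamma> (\<sigma> l, l)) = 0"
    "\<And>X l. X \<in> W \<Longrightarrow> l \<in> ball l0 \<delta> \<Longrightarrow> X \<in> spd1 \<Longrightarrow> rgrad X (\<Gamma> (X, l)) = 0 \<Longrightarrow> X = \<sigma> l"
    "continuous_on (ball l0 \<delta>) \<sigma>" "(\<sigma> has_derivative \<sigma>') (at l0)" "\<sigma> l0 = S"
    "\<And>h. \<sigma>' h \<in> tangent1 S"
    "\<And>h Y. Y \<in> tangent1 S \<Longrightarrow> airm S (R (\<sigma>' h)) Y = - (K h \<bullet> Y)"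
proof -
  have sS: "spd S" and dS: "det S = 1" using S by (simp_all add: spd1_def)
  have iS: "invertible S" using sS by (rule spd_invertible)
  have symS: "symp S = S" using sS by (simp add: symp_of_symmetric spd_transpose)
  have bs: "bounded_linear (symp :: real^'n^'n \<Rightarrow> _)"
    using linear_symp linear_conv_bounded_linear by blast
  have linR: "linear R" using R by (rule has_derivative_linear)
  have RT: "R (symp E) \<in> tangent1 S" for E
    using rgrad_derivative_tangent[of S "\<lambda>X. \<Gamma> (X, l0)" R] S crit R by simp
  define J where "J = (\<lambda>z :: (real^'n^'n) \<times> 'l. (symp (fst z), snd z))"
  have blJ: "bounded_linear J"
    unfolding J_def by (intro bounded_linear_Pair bounded_linear_compose[OF bs] bounded_linear_fst bounded_linear_snd)
  have contJ: "continuous_on UNIV J" by (rule linear_continuous_on[OF blJ])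
  have conts: "continuous_on UNIV (\<lambda>z :: (real^'n^'n) \<times> 'l. symp (fst z))"
    by (rule linear_continuous_on[OF bounded_linear_compose[OF bs bounded_linear_fst]])
  define M where "M = J -` N \<inter> (\<lambda>z. symp (fst z)) -` {A. posdef A}"
  have openM: "open M" unfolding M_def by (intro open_Int open_vimage N(1) contJ open_posdef conts)
  have memM: "(S, l0) \<in> M" using N(2) sS by (simp add: M_def J_def symS spd_iff_posdef)
  have cdJ: "cont_diff_on (\<lambda>z. \<Gamma> (symp (fst z), snd z)) M"
    by (rule cont_diff_on_compose[OF \<Gamma> cont_diff_on_bounded_linear[OF blJ[unfolded J_def]]])
      (auto simp: M_def J_def)
  have cds: "cont_diff_on (\<lambda>z :: (real^'n^'n) \<times> 'l. symp (fst z)) M"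
    by (rule cont_diff_on_bounded_linear[OF bounded_linear_compose[OF bs bounded_linear_fst]])
  have cdk: "cont_diff_on (\<lambda>z :: (real^'n^'n) \<times> 'l. skewp (fst z)) M"
    by (rule cont_diff_on_linear_compose[OF linear_skewp cont_diff_on_bounded_linear[OF bounded_linear_fst]])
  have cd: "cont_diff_on (critical_map \<Gamma>) M"
    unfolding critical_map_def[abs_def]
    by (intro cont_diff_on_add cont_diff_on_rgrad cont_diff_on_scaleR cont_diff_on_diff cont_diff_on_const
        cont_diff_on_det cdJ cds cdk)
  have zero: "critical_map \<Gamma> (S, l0) = 0"
    using S crit sS by (subst critical_map_zero_iff) (simp_all add: symS spd_iff_posdef)
  have "cont_diff_on (\<lambda>z. rgrad (fst z) (\<Gamma> z)) N"
    by (intro cont_diff_on_rgrad \<Gamma> cont_diff_on_bounded_linear bounded_linear_fst)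
  from cont_diff_on_differentiable[OF this N(2)]
  obtain r' where r': "((\<lambda>z. rgrad (fst z) (\<Gamma> z)) has_derivative r') (at (S, l0))"
    unfolding differentiable_def ..
  have linr: "linear r'" using r' by (rule has_derivative_linear)
  have r'1: "r' (E, 0) = R E" for E
  proof -
    have "((\<lambda>X. (X, l0)) has_derivative (\<lambda>E. (E, 0))) (at S)"
      by (intro has_derivative_Pair has_derivative_const has_derivative_ident)
    from has_derivative_compose[OF this r']
    have "((\<lambda>X. rgrad X (\<Gamma> (X, l0))) has_derivative (\<lambda>E. r' (E, 0))) (at S)" by simp
    from fun_cong[OF has_derivative_unique[OF this R]] show ?thesis .
  qed
  have r'2: "r' (0, h) = rgrad S (K h)" for h
  proof -
    have "((\<lambda>l. (S, l)) has_derivative (\<lambda>h. (0, h))) (at l0)"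
      by (intro has_derivative_Pair has_derivative_const has_derivative_ident)
    from has_derivative_compose[OF this r']
    have 1: "((\<lambda>l. rgrad S (\<Gamma> (S, l))) has_derivative (\<lambda>h. r' (0, h))) (at l0)" by simp
    have 2: "((\<lambda>l. rgrad S (\<Gamma> (S, l))) has_derivative (\<lambda>h. rgrad S (K h))) (at l0)"
      using bounded_linear.has_derivative[OF _ K] linear_rgrad linear_conv_bounded_linear by blast
    from fun_cong[OF has_derivative_unique[OF 1 2]] show ?thesis .
  qed
  define f' where "f' = (\<lambda>z. r' (symp (fst z), snd z) + trace (matrix_inv S ** symp (fst z)) *\<^sub>R S + skewp (fst z))"
  have f'_eq: "f' (E, h) = tangent_lift S R E + rgrad S (K h)" for E h
  proof -
    have "r' (symp E, h) = r' ((symp E, 0) + (0, h))" by simp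
    also have "\<dots> = R (symp E) + rgrad S (K h)" by (simp only: linear_add[OF linr] r'1 r'2)
    finally show ?thesis by (simp add: f'_def tangent_lift_def)
  qed
  have der: "(critical_map \<Gamma> has_derivative f') (at (S, l0))"
  proof -
    have J': "(J has_derivative J) (at (S, l0))" by (rule bounded_linear_imp_has_derivative[OF blJ])
    have 1: "((\<lambda>z. rgrad (symp (fst z)) (\<Gamma> (symp (fst z), snd z))) has_derivative (\<lambda>z. r' (symp (fst z), snd z))) (at (S, l0))"
      using has_derivative_compose[OF J', of "\<lambda>z. rgrad (fst z) (\<Gamma> z)" r'] r' by (simp add: J_def symS)
    have 2: "((\<lambda>z :: (real^'n^'n) \<times> 'l. symp (fst z)) has_derivative (\<lambda>z. symp (fst z))) (at (S, l0))"
      by (rule bounded_linear_imp_has_derivative[OF bounded_linear_compose[OF bs bounded_linear_fst]])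
    have 3: "((\<lambda>z :: (real^'n^'n) \<times> 'l. det (symp (fst z))) has_derivative (\<lambda>z. trace (matrix_inv S ** symp (fst z)))) (at (S, l0))"
      using has_derivative_compose[OF 2, of det] has_derivative_det[OF iS] by (simp add: symS dS)
    have "bounded_linear (skewp :: real^'n^'n \<Rightarrow> _)" using linear_skewp linear_conv_bounded_linear by blast
    then have 4: "((\<lambda>z :: (real^'n^'n) \<times> 'l. skewp (fst z)) has_derivative (\<lambda>z. skewp (fst z))) (at (S, l0))"
      by (intro bounded_linear_imp_has_derivative bounded_linear_compose[OF _ bounded_linear_fst])
    show ?thesis
      unfolding critical_map_def[abs_def] f'_def
      by (rule derivative_eq_intros 1 2 3 4 refl)+ (simp add: symS dS)
  qed
  have K0: "K 0 = 0" using has_derivative_linear[OF K] linear_0 by blast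
  have inj: "v = 0" if "f' (v, 0) = 0" for v
  proof -
    have "tangent_lift S R v = 0" using that by (simp add: f'_eq K0 linear_0[OF linear_rgrad])
    with tangent_lift_injective[of S R, OF S RT pos] show ?thesis by blast
  qed
  obtain W \<delta> \<sigma> \<sigma>' where IF: "open W" "S \<in> W" "\<delta> > 0" "W \<times> ball l0 \<delta> \<subseteq> M"
    "\<And>y. y \<in> ball l0 \<delta> \<Longrightarrow> \<sigma> y \<in> W \<and> critical_map \<Gamma> (\<sigma> y, y) = 0"
    "\<And>x y. x \<in> W \<Longrightarrow> y \<in> ball l0 \<delta> \<Longrightarrow> critical_map \<Gamma> (x, y) = 0 \<Longrightarrow> x = \<sigma> y"
    "continuous_on (ball l0 \<delta>) \<sigma>" "(\<sigma> has_derivative \<sigma>') (at l0)" "\<sigma> l0 = S"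
    "\<And>h. f' (\<sigma>' h, h) = 0"
    by (rule implicit_function[OF openM memM cd zero der]) (erule inj, rule that, assumption+)
  have WM: "(X, l) \<in> M" if "X \<in> W" "l \<in> ball l0 \<delta>" for X l using IF(4) that by blast
  have pd: "posdef (symp X)" if "X \<in> W" "l \<in> ball l0 \<delta>" for X l using WM[OF that] by (simp add: M_def)
  have tang: "\<sigma>' h \<in> tangent1 S" "R (\<sigma>' h) = - rgrad S (K h)" for h
  proof -
    have eq: "tangent_lift S R (\<sigma>' h) = - rgrad S (K h)" using IF(10)[of h] by (simp add: f'_eq eq_neg_iff_add_eq_0)
    have "- rgrad S (K h) \<in> tangent1 S" using rgrad_tangent[OF S] subspace_tangent1 subspace_neg by blast
    then show "\<sigma>' h \<in> tangent1 S" "R (\<sigma>' h) = - rgrad S (K h)"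
      using tangent_lift_tangent[of S R "\<sigma>' h", OF S RT] eq by auto
  qed
  show thesis
  proof (rule that[of W \<delta> \<sigma> \<sigma>'])
    show "(X, l) \<in> N" if "X \<in> W" "l \<in> ball l0 \<delta>" "X \<in> spd1" for X l
    proof -
      have "symp X = X" using that(3) by (simp add: symp_of_symmetric spd_transpose spd1_imp_spd)
      then show ?thesis using WM[OF that(1,2)] by (simp add: M_def J_def)
    qed
    show "\<sigma> l \<in> W \<and> \<sigma> l \<in> spd1 \<and> rgrad (\<sigma> l) (\<Gamma> (\<sigma> l, l)) = 0" if "l \<in> ball l0 \<delta>" for l
    proof -
      have W: "\<sigma> l \<in> W" "critical_map \<Gamma> (\<sigma> l, l) = 0" using IF(5)[OF that] by auto
      then show ?thesis using critical_map_zero_iff[OF pd[OF W(1) that], of \<Gamma> l] by simp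
    qed
    show "X = \<sigma> l" if "X \<in> W" "l \<in> ball l0 \<delta>" "X \<in> spd1" "rgrad X (\<Gamma> (X, l)) = 0" for X l
      using IF(6)[OF that(1,2)] critical_map_zero_iff[OF pd[OF that(1,2)], of \<Gamma> l] that(3,4) by simp
    show "airm S (R (\<sigma>' h)) Y = - (K h \<bullet> Y)" if "Y \<in> tangent1 S" for h Y
      by (simp add: tang(2) linear_neg[OF linear_airm_left] airm_rgrad[OF S that])
  qed (use IF tang in auto)
qed


section \<open>Block matrices\<close>

lemma sum_UNIV_Plus: "(\<Sum>i\<in>(UNIV :: ('m::finite + 'n::finite) set). f i) = (\<Sum>i\<in>UNIV. f (Inl i)) + (\<Sum>i\<in>UNIV. f (Inr i))"
  using sum.Plus[of "UNIV :: 'm set" "UNIV :: 'n set" f] by (simp add: UNIV_Plus_UNIV o_def)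

lemma prod_UNIV_Plus: "(\<Prod>i\<in>(UNIV :: ('m::finite + 'n::finite) set). f i) = (\<Prod>i\<in>UNIV. f (Inl i)) * (\<Prod>i\<in>UNIV. f (Inr i))"
  using prod.Plus[of "UNIV :: 'm set" "UNIV :: 'n set" f] by (simp add: UNIV_Plus_UNIV o_def)

lemma block_entry [simp]:
  "block P11 P12 P21 P22 $ Inl i $ Inl j = P11 $ i $ j"
  "block P11 P12 P21 P22 $ Inl i $ Inr k = P12 $ i $ k"
  "block P11 P12 P21 P22 $ Inr l $ Inl j = P21 $ l $ j"
  "block P11 P12 P21 P22 $ Inr l $ Inr k = P22 $ l $ k"
  by (simp_all add: block_def)

lemma matrix_eq_entries: "A = B \<longleftrightarrow> (\<forall>i j. A $ i $ j = B $ i $ j)" for A B :: "real^'n^'m"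
  by (simp add: vec_eq_iff)

lemma block_mult:
  "block A B C D ** block A' B' C' D' =
    block (A ** A' + B ** C') (A ** B' + B ** D') (C ** A' + D ** C') (C ** B' + D ** D')"
  unfolding matrix_eq_entries split_sum_all
  by (simp add: matrix_matrix_mult_def sum_UNIV_Plus)

lemma transpose_block: "transpose (block A B C D) = block (transpose A) (transpose C) (transpose B) (transpose D)"
  unfolding matrix_eq_entries split_sum_all by (simp add: transpose_def)

lemma block_add: "block A B C D + block A' B' C' D' = block (A + A') (B + B') (C + C') (D + D')"
  unfolding matrix_eq_entries split_sum_all by simp

lemma block_scaleR: "c *\<^sub>R block A B C D = block (c *\<^sub>R A) (c *\<^sub>R B) (c *\<^sub>R C) (c *\<^sub>R D)"
  unfolding matrix_eq_entries split_sum_all by simp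

lemma block_eq_iff: "block A B C D = block A' B' C' D' \<longleftrightarrow> A = A' \<and> B = B' \<and> C = C' \<and> D = D'"
  unfolding matrix_eq_entries split_sum_all by auto

lemma block_mat_1: "block (mat 1) 0 0 (mat 1) = mat 1"
  unfolding matrix_eq_entries split_sum_all by (simp add: mat_def)

lemma block_cases:
  fixes P :: "real^('m::finite + 'n::finite)^('m + 'n)"
  obtains A B C D where "P = block A B C D"
proof -
  have "P = block (\<chi> i j. P $ Inl i $ Inl j) (\<chi> i j. P $ Inl i $ Inr j)
      (\<chi> i j. P $ Inr i $ Inl j) (\<chi> i j. P $ Inr i $ Inr j)"
    unfolding matrix_eq_entries split_sum_all by simp
  then show thesis by (rule that)
qed

lemma inner_block: "block A B C D \<bullet> block A' B' C' D' = A \<bullet> A' + B \<bullet> B' + C \<bullet> C' + D \<bullet> D'"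
  by (simp add: inner_vec_def sum_UNIV_Plus sum.distrib)

definition lower_right :: "real^('m::finite + 'n::finite)^('m + 'n) \<Rightarrow> real^'n^'n" where
  "lower_right P = (\<chi> i j. P $ Inr i $ Inr j)"

lemma lower_right_block [simp]: "lower_right (block A B C D) = D"
  by (simp add: lower_right_def vec_eq_iff)

lemma linear_lower_right: "linear lower_right"
  by (rule linearI) (simp_all add: lower_right_def vec_eq_iff)

lemma inner_lower_right: "block 0 0 0 E \<bullet> P = E \<bullet> lower_right P"
  by (rule block_cases[of P]) (simp add: inner_block)

lemma block_diagonal_mult_vec:
  "x \<bullet> (block M 0 0 W *v x) = (\<chi> i. x $ Inl i) \<bullet> (M *v (\<chi> i. x $ Inl i)) + (\<chi> i. x $ Inr i) \<bullet> (W *v (\<chi> i. x $ Inr i))"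
  by (simp add: inner_vec_def matrix_vector_mult_def sum_UNIV_Plus)

lemma posdef_block_diagonal: "posdef (block M 0 0 W) \<longleftrightarrow> posdef M \<and> posdef W"
proof
  assume K: "posdef (block M 0 0 W)"
  have "x \<bullet> (M *v x) > 0" if "x \<noteq> 0" for x
  proof -
    define y :: "real^('a + 'b)" where "y = (\<chi> i. case i of Inl k \<Rightarrow> x $ k | Inr k \<Rightarrow> 0)"
    have "y \<noteq> 0" using that by (auto simp: y_def vec_eq_iff split_sum_all)
    then have "y \<bullet> (block M 0 0 W *v y) > 0" using K by (simp add: posdef_def)
    moreover have "(\<chi> i. y $ Inl i) = x" "(\<chi> i. y $ Inr i) = 0" by (simp_all add: y_def vec_eq_iff)
    ultimately show ?thesis by (simp add: block_diagonal_mult_vec)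
  qed
  moreover have "x \<bullet> (W *v x) > 0" if "x \<noteq> 0" for x
  proof -
    define y :: "real^('a + 'b)" where "y = (\<chi> i. case i of Inl k \<Rightarrow> 0 | Inr k \<Rightarrow> x $ k)"
    have "y \<noteq> 0" using that by (auto simp: y_def vec_eq_iff split_sum_all)
    then have "y \<bullet> (block M 0 0 W *v y) > 0" using K by (simp add: posdef_def)
    moreover have "(\<chi> i. y $ Inl i) = 0" "(\<chi> i. y $ Inr i) = x" by (simp_all add: y_def vec_eq_iff)
    ultimately show ?thesis by (simp add: block_diagonal_mult_vec)
  qed
  ultimately show "posdef M \<and> posdef W" by (simp add: posdef_def)
next
  assume MW: "posdef M \<and> posdef W"
  show "posdef (block M 0 0 W)" unfolding posdef_def
  proof (intro allI impI)
    fix x :: "real^('a + 'b)" assume "x \<noteq> 0"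
    then have "(\<chi> i. x $ Inl i) \<noteq> 0 \<or> (\<chi> i. x $ Inr i) \<noteq> 0"
      by (auto simp: vec_eq_iff split_sum_all)
    moreover have "y \<bullet> (M *v y) \<ge> 0" for y using MW by (cases "y = 0") (auto simp: posdef_def less_imp_le)
    moreover have "y \<bullet> (W *v y) \<ge> 0" for y using MW by (cases "y = 0") (auto simp: posdef_def less_imp_le)
    moreover have "y \<noteq> 0 \<Longrightarrow> y \<bullet> (M *v y) > 0" for y using MW by (auto simp: posdef_def)
    moreover have "y \<noteq> 0 \<Longrightarrow> y \<bullet> (W *v y) > 0" for y using MW by (auto simp: posdef_def)
    ultimately show "x \<bullet> (block M 0 0 W *v x) > 0"
      unfolding block_diagonal_mult_vec by (meson add_nonneg_pos add_pos_nonneg)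
  qed
qed

lemma spd_block_diagonal: "spd (block M 0 0 W) \<longleftrightarrow> spd M \<and> spd W"
  by (auto simp: spd_iff_posdef posdef_block_diagonal transpose_block block_eq_iff)

text \<open>Diagonalizing both blocks reduces this to the determinant of a diagonal matrix.\<close>

lemma det_block_diagonal:
  fixes M :: "real^'m^'m" and W :: "real^'n^'n"
  assumes M: "transpose M = M" and W: "transpose W = W"
  shows "det (block M 0 0 W) = det M * det W"
proof -
  obtain R v where R: "orthogonal_matrix R" and M_eq: "M = R ** diagm v ** transpose R"
    using spectral_theorem[OF M] by auto
  obtain R' w where R': "orthogonal_matrix R'" and W_eq: "W = R' ** diagm w ** transpose R'"
    using spectral_theorem[OF W] by auto
  let ?R = "block R 0 0 R'" and ?d = "\<chi> i. case i of Inl k \<Rightarrow> v $ k | Inr k \<Rightarrow> w $ k"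
  have "orthogonal_matrix ?R"
    by (simp add: orthogonal_matrix_def transpose_block block_mult matrix_mult_0_left matrix_mult_0_right
        orthogonal_matrixD[OF R] orthogonal_matrixD[OF R'] block_mat_1)
  moreover have "diagm ?d = block (diagm v) 0 0 (diagm w)"
    unfolding matrix_eq_entries split_sum_all by (simp add: diagm_def)
  then have "block M 0 0 W = ?R ** diagm ?d ** transpose ?R"
    by (simp add: M_eq W_eq transpose_block block_mult matrix_mult_0_left matrix_mult_0_right)
  ultimately have "det (block M 0 0 W) = (\<Prod>i\<in>UNIV. ?d $ i)"
    by (simp only: det_orthogonal_diagonal)
  also have "\<dots> = det M * det W"
    by (simp add: prod_UNIV_Plus M_eq W_eq det_orthogonal_diagonal[OF R] det_orthogonal_diagonal[OF R'])
  finally show ?thesis .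
qed

lemma det_scaleR_matrix: "det (c *\<^sub>R A) = c ^ CARD('n) * det A" for A :: "real^'n^'n"
proof -
  have "c *\<^sub>R A = diagm (\<chi> i. c) ** A" by (simp add: vec_eq_iff diagm_mult_left)
  then show ?thesis by (simp add: det_mul det_diagm)
qed

definition lower_block :: "real^'m^'n \<Rightarrow> real^('m + 'n)^('m + 'n)" where
  "lower_block T = block (mat 1) 0 T (mat 1)"

lemma Lmat_lower_block: "Lmat A C V B = lower_block (Tmat A C V B)"
  by (simp add: Lmat_def lower_block_def)

lemma lower_block_inverse: "lower_block T ** lower_block (- T) = mat 1"
  by (simp add: lower_block_def block_mult matrix_mult_0_left matrix_mult_0_right block_mat_1)

lemma invertible_lower_block: "invertible (lower_block T)"
  using lower_block_inverse by (rule invertibleI)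

text \<open>Conjugation by \<open>diag(1, -1)\<close> turns the lower unitriangular matrix into its inverse, so its
  determinant equals that of the inverse.\<close>

lemma det_lower_block_square: "(det (lower_block T))\<^sup>2 = 1"
proof -
  let ?J = "block (mat 1) 0 0 (- mat 1) :: real^('a + 'b)^('a + 'b)"
  have "?J ** lower_block T ** ?J = lower_block (- T)" "?J ** ?J = mat 1"
    by (simp_all add: lower_block_def block_mult matrix_mult_0_left matrix_mult_0_right matrix_minus_left
        matrix_minus_right block_mat_1)
  then have "det ?J * det (lower_block T) * det ?J = det (lower_block (- T))" "det ?J * det ?J = 1"
    by (metis det_mul, metis det_mul det_I)
  moreover have "det (lower_block T) * det (lower_block (- T)) = 1"
    by (metis det_mul det_I lower_block_inverse)
  ultimately show ?thesis by (simp add: power2_eq_square mult_ac)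
qed

definition vcat :: "real^'k^'m \<Rightarrow> real^'k^'n \<Rightarrow> real^'k^('m + 'n)" where
  "vcat X Y = (\<chi> i j. case i of Inl k \<Rightarrow> X $ k $ j | Inr k \<Rightarrow> Y $ k $ j)"

lemma vcat_entry [simp]: "vcat X Y $ Inl i $ j = X $ i $ j" "vcat X Y $ Inr k $ j = Y $ k $ j"
  by (simp_all add: vcat_def)

lemma vcat_eq_iff: "vcat X Y = vcat X' Y' \<longleftrightarrow> X = X' \<and> Y = Y'"
  unfolding matrix_eq_entries split_sum_all by simp

lemma block_mult_vcat: "block A B C D ** vcat X Y = vcat (A ** X + B ** Y) (C ** X + D ** Y)"
  unfolding matrix_eq_entries split_sum_all by (simp add: matrix_matrix_mult_def sum_UNIV_Plus)

lemma transpose_hcat_mult: "transpose (hcat U V) ** X = vcat (transpose U ** X) (transpose V ** X)"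
  unfolding matrix_eq_entries split_sum_all by (simp add: matrix_matrix_mult_def hcat_def transpose_def)

lemma hcat_mult_vcat: "hcat U V ** vcat X Y = U ** X + V ** Y"
  unfolding matrix_eq_entries by (simp add: matrix_matrix_mult_def hcat_def sum_UNIV_Plus)


section \<open>The energy of a controller\<close>

text \<open>The controller \<open>\<Phi>\<^sub>A(B, \<Sigma>)\<close> in the coordinates of the frame \<open>[U, V]\<close>.\<close>

definition Kmat :: "real^'m^'d \<Rightarrow> real^'m^'m \<Rightarrow> real^'n^'d \<Rightarrow> real^'m^'d \<Rightarrow> real^'n^'n \<Rightarrow> real^('m + 'n)^('m + 'n)" where
  "Kmat A C V B \<Sigma> = Lmat A C V B ** Qmat A C B \<Sigma> ** transpose (Lmat A C V B)"

lemma Phi_eq: "Phi A U C V B \<Sigma> = hcat U V ** Kmat A C V B \<Sigma> ** transpose (hcat U V)"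
  by (simp add: Phi_def Kmat_def matrix_mul_assoc)

text \<open>The index type of \<open>\<Sigma>\<close> enters the factor \<open>\<rho>\<close> only through its cardinality, so it is passed as
  an explicit type argument.\<close>

definition rhoM :: "real^'m^'d \<Rightarrow> real^'m^'m \<Rightarrow> 'n itself \<Rightarrow> real^'m^'d \<Rightarrow> real" where
  "rhoM A C n B = rho CARD('n) (Mmat A C B)"

lemma Qmat_eq: "Qmat A C B \<Sigma> = block (Mmat A C B) 0 0 (rhoM A C TYPE('n) B *\<^sub>R \<Sigma>)" for \<Sigma> :: "real^'n^'n"
  by (simp add: Qmat_def rhoM_def)

lemma linear_Mmat: "linear (Mmat A C)"
  unfolding Mmat_def by (rule linearI)
    (simp_all add: matrix_add_ldistrib matrix_add_rdistrib matrix_scaleR_left matrix_scaleR_right)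

lemma linear_Nmat: "linear (Nmat C V)"
  unfolding Nmat_def by (rule linearI)
    (simp_all add: matrix_add_ldistrib matrix_add_rdistrib matrix_scaleR_left matrix_scaleR_right)

lemma posdef_scaleR: "c > 0 \<Longrightarrow> posdef K \<Longrightarrow> posdef (c *\<^sub>R K)"
  by (simp add: posdef_def flip: scaleR_matrix_vector_assoc)

lemma rhoM_pos: "det (Mmat A C B) > 0 \<Longrightarrow> rhoM A C n B > 0"
  by (simp add: rhoM_def rho_def)

lemma rhoM_power: "det (Mmat A C B) > 0 \<Longrightarrow> rhoM A C TYPE('n::finite) B ^ CARD('n) = 1 / det (Mmat A C B)"
proof -
  assume d: "det (Mmat A C B) > 0"
  have "rhoM A C TYPE('n) B ^ CARD('n) = rhoM A C TYPE('n) B powr real CARD('n)"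
    by (simp add: powr_realpow rhoM_pos[OF d])
  also have "\<dots> = det (Mmat A C B) powr (- 1 / real CARD('n) * real CARD('n))"
    by (simp only: rhoM_def rho_def powr_powr)
  also have "\<dots> = det (Mmat A C B) powr (- 1)" by simp
  finally show ?thesis using d by (simp add: powr_minus divide_inverse)
qed

text \<open>An open neighborhood of \<^const>\<open>actions\<close> in the space of all \<open>B\<close>. The matrix \<open>M\<close> may lose its
  symmetry there; the conditions keep \<open>K\<close> in the domain of the logarithm and \<open>\<rho>\<close> smooth.\<close>

definition actions_nbhd :: "real^'m^'d \<Rightarrow> real^'m^'m \<Rightarrow> (real^'m^'d) set" where
  "actions_nbhd A C = {B. posdef (Mmat A C B) \<and> det (Mmat A C B) > 0}"

lemma open_actions_nbhd: "open (actions_nbhd A C)"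
proof -
  have c: "continuous_on UNIV (Mmat A C)"
    using linear_Mmat by (intro linear_continuous_on) (simp add: linear_conv_bounded_linear)
  have "continuous_on UNIV (\<lambda>P :: real^'a^'a. det P)"
    unfolding det_def by (intro continuous_intros)
  then have "open {P :: real^'a^'a. det P > 0}" by (intro open_Collect_less continuous_on_const)
  then have "open (Mmat A C -` {P. posdef P} \<inter> Mmat A C -` {P. det P > 0})"
    using c by (intro open_Int open_vimage open_posdef)
  moreover have "Mmat A C -` {P. posdef P} \<inter> Mmat A C -` {P. det P > 0} = actions_nbhd A C"
    by (auto simp: actions_nbhd_def)
  ultimately show ?thesis by simp
qed

lemma spd_Mmat:
  assumes C: "invertible C" and B: "B \<in> actions A"
  shows "spd (Mmat A C B)"
proof -
  have "spd (transpose (matrix_inv C) ** (transpose A ** B) ** transpose (transpose (matrix_inv C)))"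
    using B C by (intro spd_congruence invertible_transposeI invertible_matrix_inv) (simp_all add: actions_def)
  then show ?thesis by (simp add: Mmat_def matrix_mul_assoc)
qed

lemma actions_in_nbhd: "invertible C \<Longrightarrow> B \<in> actions A \<Longrightarrow> B \<in> actions_nbhd A C"
  using spd_Mmat[of C B A] spd_det_pos[of "Mmat A C B"] by (simp add: actions_nbhd_def spd_iff_posdef)

lemma posdef_Kmat: "B \<in> actions_nbhd A C \<Longrightarrow> posdef \<Sigma> \<Longrightarrow> posdef (Kmat A C V B \<Sigma>)"
  unfolding Kmat_def Lmat_lower_block Qmat_eq
  by (intro posdef_congruence_invertible invertible_lower_block)
    (simp add: posdef_block_diagonal actions_nbhd_def posdef_scaleR rhoM_pos)

lemma spd_scaleR: "c > 0 \<Longrightarrow> spd P \<Longrightarrow> spd (c *\<^sub>R P)"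
  by (simp add: spd_iff_posdef posdef_scaleR transpose_scalar)

lemma spd_Qmat: "invertible C \<Longrightarrow> B \<in> actions A \<Longrightarrow> spd \<Sigma> \<Longrightarrow> spd (Qmat A C B \<Sigma>)"
  unfolding Qmat_eq spd_block_diagonal
  by (simp add: spd_Mmat spd_scaleR rhoM_pos spd_det_pos)

lemma spd_Kmat: "invertible C \<Longrightarrow> B \<in> actions A \<Longrightarrow> spd \<Sigma> \<Longrightarrow> spd (Kmat A C V B \<Sigma>)"
  unfolding Kmat_def Lmat_lower_block
  by (intro spd_congruence invertible_lower_block spd_Qmat)

lemma dAI_mat_1: "dAI (mat 1) P = norm (spd_log P)"
proof -
  have "spd_powr (mat 1 :: real^'a^'a) (-1/2) = mat 1"
    using sym_fun_eq[OF orthogonal_matrix_id, of "\<lambda>x. x powr (-1/2)" "\<chi> i. 1"]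
    by (simp add: spd_powr_def diagm_one)
  then show ?thesis by (simp add: dAI_def)
qed

text \<open>With \<open>Z = R\<^sub>0\<^sup>-\<^sup>1\<^sup>/\<^sup>2\<close> the matrix \<open>L Z\<^sup>-\<^sup>1\<close> is orthogonal and conjugates \<open>Z Q Z\<close> into \<open>L Q L\<^sup>T\<close>. So the
  distance from \<open>R\<^sub>0\<close> to \<open>Q\<close> is the distance from the identity to \<open>L Q L\<^sup>T\<close>.\<close>

lemma dAI_R0mat:
  assumes Q: "transpose Q = Q"
  shows "dAI (R0mat A C V B) Q = norm (spd_log (Lmat A C V B ** Q ** transpose (Lmat A C V B)))"
proof -
  let ?L = "Lmat A C V B" and ?R0 = "R0mat A C V B"
  have L: "invertible ?L" by (simp add: Lmat_lower_block invertible_lower_block)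
  have "spd (matrix_inv ?L ** mat 1 ** transpose (matrix_inv ?L))"
    by (rule spd_congruence[OF _ invertible_matrix_inv[OF L]]) (simp add: spd_def)
  then have R0: "spd ?R0" by (simp add: R0mat_def)
  define Z where "Z = spd_powr ?R0 (-1/2)"
  have Z: "transpose Z = Z" "Z ** ?R0 ** Z = mat 1" "invertible Z"
    unfolding Z_def by (rule spd_powr_minus_half[OF R0])+
  define W where "W = ?L ** matrix_inv Z"
  have tZ: "transpose (matrix_inv Z) = matrix_inv Z" using matrix_inv_transpose[OF Z(3)] Z(1) by simp
  have "matrix_inv Z ** matrix_inv Z = matrix_inv Z ** (Z ** ?R0 ** Z) ** matrix_inv Z" by (simp add: Z)
  also have "\<dots> = ?R0" by (simp add: matrix_mul_assoc matrix_inv_left[OF Z(3)] matrix_inv_cancel[OF Z(3)])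
  finally have ZZ: "matrix_inv Z ** matrix_inv Z = ?R0" .
  have "W ** transpose W = ?L ** (matrix_inv Z ** matrix_inv Z) ** transpose ?L"
    by (simp add: W_def matrix_transpose_mul tZ matrix_mul_assoc)
  also have "\<dots> = (?L ** matrix_inv ?L) ** transpose (?L ** matrix_inv ?L)"
    by (simp add: ZZ R0mat_def matrix_transpose_mul matrix_mul_assoc)
  finally have WW: "W ** transpose W = mat 1" by (simp add: matrix_inv_right[OF L])
  then have WW': "transpose W ** W = mat 1" using matrix_left_right_inverse by blast
  have tq: "transpose (Z ** Q ** Z) = Z ** Q ** Z" by (simp add: matrix_transpose_mul Z Q matrix_mul_assoc)
  have "W ** (Z ** Q ** Z) ** transpose W = ?L ** (matrix_inv Z ** Z) ** Q ** (Z ** matrix_inv Z) ** transpose ?L"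
    by (simp add: W_def matrix_transpose_mul tZ matrix_mul_assoc)
  then have eq: "W ** (Z ** Q ** Z) ** transpose W = ?L ** Q ** transpose ?L"
    by (simp add: matrix_inv_left[OF Z(3)] matrix_inv_right[OF Z(3)])
  have "norm (spd_log (W ** (Z ** Q ** Z) ** transpose W)) = norm (spd_log (Z ** Q ** Z))"
    unfolding spd_log_def sym_fun_conjugate[OF tq WW' WW] by (rule norm_orthogonal_conjugate[OF WW'])
  then show ?thesis unfolding eq dAI_def Z_def[symmetric] by (rule sym)
qed

lemma fB_eq_log_energy:
  assumes "invertible C" "B \<in> actions A" "spd \<Sigma>"
  shows "fB A C V B \<Sigma> = log_energy (Kmat A C V B \<Sigma>)"
  using spd_Qmat[OF assms] spd_Kmat[OF assms, of V]
  by (simp add: fB_def dAI_R0mat spd_transpose log_energy_spd flip: Kmat_def)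

lemma dAI_Phi:
  assumes "invertible C" "B \<in> actions A" "spd \<Sigma>"
    and W: "transpose (hcat U V) ** hcat U V = mat 1" "hcat U V ** transpose (hcat U V) = mat 1"
  shows "1/2 * (dAI (mat 1) (Phi A U C V B \<Sigma>))\<^sup>2 = fB A C V B \<Sigma>"
proof -
  have K: "spd (Kmat A C V B \<Sigma>)" by (rule spd_Kmat[OF assms(1-3)])
  have "norm (spd_log (Phi A U C V B \<Sigma>)) = norm (spd_log (Kmat A C V B \<Sigma>))"
    unfolding Phi_eq spd_log_def sym_fun_conjugate[OF spd_transpose[OF K] W]
    by (rule norm_orthogonal_conjugate[OF W(1)])
  then show ?thesis by (simp add: dAI_mat_1 fB_eq_log_energy[OF assms(1-3)] log_energy_spd[OF K])
qed

text \<open>The gradient of \<^const>\<open>log_energy\<close> at \<open>K\<close> is \<open>(log K K\<^sup>-\<^sup>1)\<^sup>T\<close>. It is pulled back along the affine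
  map from \<open>\<Sigma>\<close> to \<open>K\<close>.\<close>

definition energy_grad :: "real^'m^'d \<Rightarrow> real^'m^'m \<Rightarrow> real^'n^'d \<Rightarrow> (real^'n^'n) \<times> (real^'m^'d) \<Rightarrow> real^'n^'n" where
  "energy_grad A C V z = (case z of (\<Sigma>, B) \<Rightarrow> rhoM A C TYPE('n) B *\<^sub>R
     lower_right (transpose (Lmat A C V B) **
       transpose (mlog (Kmat A C V B \<Sigma>) ** matrix_inv (Kmat A C V B \<Sigma>)) ** Lmat A C V B))"

lemma linear_block_lower_right: "linear (block 0 0 0)"
  by (rule linearI) (simp_all add: block_add block_scaleR)

lemma has_derivative_Kmat:
  fixes \<Sigma> :: "real^'n^'n"
  shows "(Kmat A C V B has_derivative
    (\<lambda>E. Lmat A C V B ** block 0 0 0 (rhoM A C TYPE('n) B *\<^sub>R E) ** transpose (Lmat A C V B))) (at \<Sigma>)"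
proof -
  let ?D = "\<lambda>E :: real^'n^'n. Lmat A C V B ** block 0 0 0 (rhoM A C TYPE('n) B *\<^sub>R E) ** transpose (Lmat A C V B)"
  have bl: "bounded_linear ?D"
    by (rule bounded_linear_compose[OF bounded_linear_sandwich bounded_linear_compose[OF _ bounded_linear_scaleR_right]])
      (rule linear_block_lower_right[unfolded linear_conv_bounded_linear])
  let ?c = "Lmat A C V B ** block (Mmat A C B) 0 0 0 ** transpose (Lmat A C V B)"
  have eq: "Kmat A C V B = (\<lambda>\<Sigma>. ?c + ?D \<Sigma>)"
    by (rule ext) (simp add: Kmat_def Qmat_eq block_add flip: matrix_add_ldistrib matrix_add_rdistrib)
  have "((\<lambda>\<Sigma>. ?c + ?D \<Sigma>) has_derivative (\<lambda>E. 0 + ?D E)) (at \<Sigma>)"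
    by (intro has_derivative_add has_derivative_const bounded_linear_imp_has_derivative bl)
  then show ?thesis unfolding eq by simp
qed

lemma inner_sandwich: "N \<bullet> (L ** Q ** transpose L) = Q \<bullet> (transpose L ** N ** L)" for N L Q :: "real^'n^'n"
proof -
  have "(L ** Q ** transpose L) \<bullet> N = (L ** Q) \<bullet> (N ** L)"
    using inner_matrix_mult_right[of "L ** Q" "transpose L" N] by simp
  also have "\<dots> = Q \<bullet> (transpose L ** (N ** L))" by (rule inner_matrix_mult_left)
  finally show ?thesis by (simp add: inner_commute[of N] matrix_mul_assoc)
qed

lemma energy_grad_inner:
  "energy_grad A C V (\<Sigma>, B) \<bullet> E = trace (mlog (Kmat A C V B \<Sigma>) ** matrix_inv (Kmat A C V B \<Sigma>) **
    (Lmat A C V B ** block 0 0 0 (rhoM A C TYPE('n) B *\<^sub>R E) ** transpose (Lmat A C V B)))"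
  for E :: "real^'n^'n"
proof -
  have tr: "trace (X ** Y) = transpose X \<bullet> Y" for X Y :: "real^'k^'k"
    by (simp add: inner_matrix_trace)
  show ?thesis
    unfolding tr inner_sandwich inner_lower_right by (simp add: energy_grad_def inner_commute)
qed

lemma has_derivative_energy:
  fixes \<Sigma> :: "real^'n^'n"
  assumes "B \<in> actions_nbhd A C" "posdef \<Sigma>"
  shows "((\<lambda>\<Sigma>. log_energy (Kmat A C V B \<Sigma>)) has_derivative (\<lambda>E. energy_grad A C V (\<Sigma>, B) \<bullet> E)) (at \<Sigma>)"
  unfolding energy_grad_inner
  by (rule has_derivative_compose[OF has_derivative_Kmat has_derivative_log_energy[OF posdef_Kmat[OF assms]]])

lemma has_derivative_fB:
  fixes \<Sigma> :: "real^'n^'n"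
  assumes C: "invertible C" and B: "B \<in> actions A" and \<Sigma>: "\<Sigma> \<in> spd1"
  shows "(fB A C V B has_derivative (\<lambda>E. energy_grad A C V (\<Sigma>, B) \<bullet> E)) (at \<Sigma> within spd1)"
proof -
  have "posdef \<Sigma>" using spd1_imp_spd[OF \<Sigma>] by (simp add: spd_iff_posdef)
  from has_derivative_energy[OF actions_in_nbhd[OF C B] this]
  have D: "((\<lambda>\<Sigma>. log_energy (Kmat A C V B \<Sigma>)) has_derivative (\<lambda>E. energy_grad A C V (\<Sigma>, B) \<bullet> E)) (at \<Sigma> within spd1)"
    by (rule has_derivative_at_withinI)
  have eq: "fB A C V B X = log_energy (Kmat A C V B X)" if "X \<in> spd1" for X
    using fB_eq_log_energy[OF C B spd1_imp_spd[OF that]] .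
  show ?thesis by (rule has_derivative_transform[OF \<Sigma> eq D])
qed

definition energy_domain :: "real^'m^'d \<Rightarrow> real^'m^'m \<Rightarrow> ((real^'n^'n) \<times> (real^'m^'d)) set" where
  "energy_domain A C = {\<Sigma>. posdef \<Sigma>} \<times> actions_nbhd A C"

lemma open_energy_domain: "open (energy_domain A C)"
  unfolding energy_domain_def by (intro open_Times open_posdef open_actions_nbhd)

lemma cont_diff_on_snd_linear: "linear g \<Longrightarrow> cont_diff_on (\<lambda>z. g (snd z)) U"
  by (rule cont_diff_on_linear_compose[OF _ cont_diff_on_bounded_linear[OF bounded_linear_snd]])

lemma cont_diff_on_Lmat: "cont_diff_on (\<lambda>z. Lmat A C V (snd z)) (energy_domain A C)"
proof -
  have T: "cont_diff_on (\<lambda>z. Tmat A C V (snd z)) (energy_domain A C)"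
    unfolding Tmat_def
    by (intro cont_diff_on_matrix_mult cont_diff_on_matrix_inv cont_diff_on_snd_linear linear_Nmat linear_Mmat)
      (auto simp: energy_domain_def actions_nbhd_def posdef_invertible)
  have "linear (\<lambda>T. block 0 0 T 0)" by (rule linearI) (simp_all add: block_add block_scaleR)
  from cont_diff_on_add[OF cont_diff_on_const cont_diff_on_linear_compose[OF this T], of "block (mat 1) 0 0 (mat 1)"]
  show ?thesis by (simp add: Lmat_def block_add)
qed

lemma cont_diff_on_rhoM: "cont_diff_on (\<lambda>z. rhoM A C n (snd z)) (energy_domain A C)"
  unfolding rhoM_def rho_def
  by (intro cont_diff_on_powr cont_diff_on_det cont_diff_on_snd_linear linear_Mmat)
    (auto simp: energy_domain_def actions_nbhd_def)

lemma cont_diff_on_Kmat: "cont_diff_on (\<lambda>z. Kmat A C V (snd z) (fst z)) (energy_domain A C)"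
proof -
  have 1: "linear (\<lambda>M. block M 0 0 0)" by (rule linearI) (simp_all add: block_add block_scaleR)
  have 2: "linear (\<lambda>W. block 0 0 0 W)" by (rule linearI) (simp_all add: block_add block_scaleR)
  have "cont_diff_on (\<lambda>z. block (Mmat A C (snd z)) 0 0 0 + block 0 0 0 (rhoM A C TYPE('a) (snd z) *\<^sub>R fst z))
      (energy_domain A C :: ((real^'a^'a) \<times> _) set)"
    by (intro cont_diff_on_add cont_diff_on_linear_compose[OF 1] cont_diff_on_linear_compose[OF 2]
        cont_diff_on_scaleR cont_diff_on_rhoM cont_diff_on_snd_linear linear_Mmat
        cont_diff_on_bounded_linear bounded_linear_fst)
  then have "cont_diff_on (\<lambda>z. Qmat A C (snd z) (fst z)) (energy_domain A C :: ((real^'a^'a) \<times> _) set)"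
    by (simp add: Qmat_eq block_add)
  then show ?thesis
    unfolding Kmat_def
    by (intro cont_diff_on_matrix_mult cont_diff_on_Lmat cont_diff_on_linear_compose[OF linear_transpose])
qed

lemma cont_diff_on_energy_grad: "cont_diff_on (energy_grad A C V) (energy_domain A C)"
proof -
  have pd: "posdef (Kmat A C V (snd z) (fst z))" if "z \<in> energy_domain A C" for z
    using that by (auto simp: energy_domain_def posdef_Kmat)
  have "cont_diff_on (\<lambda>z. mlog (Kmat A C V (snd z) (fst z))) (energy_domain A C)"
    by (rule cont_diff_on_compose[OF cont_diff_on_mlog cont_diff_on_Kmat]) (use pd in auto)
  moreover have "cont_diff_on (\<lambda>z. matrix_inv (Kmat A C V (snd z) (fst z))) (energy_domain A C)"
    by (intro cont_diff_on_matrix_inv cont_diff_on_Kmat posdef_invertible pd)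
  ultimately show ?thesis
    unfolding energy_grad_def case_prod_beta
    by (intro cont_diff_on_scaleR cont_diff_on_rhoM cont_diff_on_linear_compose[OF linear_lower_right]
        cont_diff_on_matrix_mult cont_diff_on_linear_compose[OF linear_transpose] cont_diff_on_Lmat)
qed


section \<open>Geodesic convexity of the energy\<close>

abbreviation geo_velocity :: "real^'n^'n \<Rightarrow> real^'n \<Rightarrow> real \<Rightarrow> real^'n^'n" where
  "geo_velocity G a t \<equiv> G ** diagm (\<chi> i. a $ i * exp (t * a $ i)) ** transpose G"

definition Kmat_velocity :: "real^'m^'d \<Rightarrow> real^'m^'m \<Rightarrow> real^'n^'d \<Rightarrow> real^'m^'d \<Rightarrow> real^'n^'n \<Rightarrow> real^'n \<Rightarrow> real \<Rightarrow> real^('m + 'n)^('m + 'n)" where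
  "Kmat_velocity A C V B G a t =
     Lmat A C V B ** block 0 0 0 (rhoM A C TYPE('n) B *\<^sub>R geo_velocity G a t) ** transpose (Lmat A C V B)"

text \<open>A closed form, free of the time, for \<open>K\<^sup>-\<^sup>1 K'\<close> along a geodesic.\<close>

definition log_velocity :: "real^'m^'d \<Rightarrow> real^'m^'m \<Rightarrow> real^'n^'d \<Rightarrow> real^'m^'d \<Rightarrow> real^'n^'n \<Rightarrow> real^'n \<Rightarrow> real^('m + 'n)^('m + 'n)" where
  "log_velocity A C V B G a = transpose (matrix_inv (Lmat A C V B)) **
     block 0 0 0 (transpose (matrix_inv G) ** diagm a ** transpose G) ** transpose (Lmat A C V B)"

lemma invertible_Lmat: "invertible (Lmat A C V B)"
  by (simp add: Lmat_lower_block invertible_lower_block)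

lemma matrix_inv_Qmat:
  fixes \<Sigma> :: "real^'n^'n"
  assumes B: "B \<in> actions_nbhd A C" and \<Sigma>: "invertible \<Sigma>"
  shows "matrix_inv (Qmat A C B \<Sigma>) = block (matrix_inv (Mmat A C B)) 0 0 ((1 / rhoM A C TYPE('n) B) *\<^sub>R matrix_inv \<Sigma>)"
proof (rule matrix_inv_unique)
  have M: "invertible (Mmat A C B)" and \<rho>: "rhoM A C TYPE('n) B > 0"
    using B by (auto simp: actions_nbhd_def posdef_invertible rhoM_pos)
  show "Qmat A C B \<Sigma> ** block (matrix_inv (Mmat A C B)) 0 0 ((1 / rhoM A C TYPE('n) B) *\<^sub>R matrix_inv \<Sigma>) = mat 1"
    using \<rho> by (simp add: Qmat_eq block_mult matrix_mult_0_left matrix_mult_0_right matrix_inv_right M \<Sigma>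
        matrix_scaleR_left matrix_scaleR_right block_mat_1)
qed

text \<open>Along a geodesic in \<open>\<Sigma>\<close> the matrices \<open>K\<close> form a geodesic as well: the logarithmic velocity
  \<open>K\<^sup>-\<^sup>1 K'\<close> does not depend on time.\<close>

lemma Kmat_log_velocity:
  fixes A B :: "real^'m^'d" and V :: "real^'n^'d" and G :: "real^'n^'n"
  assumes B: "B \<in> actions_nbhd A C" and G: "invertible G"
  shows "matrix_inv (Kmat A C V B (geo G a t)) ** Kmat_velocity A C V B G a t = log_velocity A C V B G a"
proof -
  let ?L = "Lmat A C V B" and ?\<rho> = "rhoM A C TYPE('n) B" and ?Q = "Qmat A C B (geo G a t)"
  have \<rho>: "?\<rho> > 0" using B by (simp add: actions_nbhd_def rhoM_pos)
  have L: "invertible ?L" by (rule invertible_Lmat)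
  have ig: "invertible (geo G a t)" using spd_geo[OF G] spd_invertible by blast
  have "posdef ?Q"
    using B spd_geo[OF G, of a t] by (simp add: Qmat_eq posdef_block_diagonal actions_nbhd_def posdef_scaleR rhoM_pos spd_iff_posdef)
  then have Q: "invertible ?Q" by (rule posdef_invertible)
  have "matrix_inv (?L ** ?Q ** transpose ?L) = matrix_inv (transpose ?L) ** (matrix_inv ?Q ** matrix_inv ?L)"
    by (simp add: matrix_inv_mult invertible_mult L Q invertible_transposeI)
  then have "matrix_inv (Kmat A C V B (geo G a t)) ** Kmat_velocity A C V B G a t =
      transpose (matrix_inv ?L) ** matrix_inv ?Q ** (matrix_inv ?L ** ?L) **
      block 0 0 0 (?\<rho> *\<^sub>R geo_velocity G a t) ** transpose ?L"
    by (simp add: Kmat_def Kmat_velocity_def matrix_inv_transpose[OF L] matrix_mul_assoc)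
  also have "\<dots> = transpose (matrix_inv ?L) ** (matrix_inv ?Q **
      block 0 0 0 (?\<rho> *\<^sub>R geo_velocity G a t)) ** transpose ?L"
    by (simp add: matrix_inv_left[OF L] matrix_mul_assoc)
  also have "matrix_inv ?Q ** block 0 0 0 (?\<rho> *\<^sub>R geo_velocity G a t) =
      block 0 0 0 (matrix_inv (geo G a t) ** geo_velocity G a t)"
    unfolding matrix_inv_Qmat[OF B ig] using \<rho>
    by (simp add: block_mult matrix_mult_0_left matrix_mult_0_right matrix_scaleR_left matrix_scaleR_right)
  also have "matrix_inv (geo G a t) ** geo_velocity G a t = transpose (matrix_inv G) ** diagm a ** transpose G"
    by (rule geo_log_velocity[OF G])
  finally show ?thesis by (simp add: log_velocity_def)
qed

lemma energy_grad_velocity: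
  fixes A B :: "real^'m^'d" and V :: "real^'n^'d" and G :: "real^'n^'n"
  assumes B: "B \<in> actions_nbhd A C" and G: "invertible G"
  shows "energy_grad A C V (geo G a t, B) \<bullet> geo_velocity G a t =
    trace (mlog (Kmat A C V B (geo G a t)) ** log_velocity A C V B G a)"
  unfolding energy_grad_inner Kmat_log_velocity[OF B G, of V a t, symmetric]
  by (simp add: Kmat_velocity_def matrix_mul_assoc)

lemma energy_second_derivative:
  fixes A B :: "real^'m^'d" and V :: "real^'n^'d" and G :: "real^'n^'n"
  assumes B: "B \<in> actions_nbhd A C" and G: "invertible G"
  shows "((\<lambda>t. trace (mlog (Kmat A C V B (geo G a t)) ** log_velocity A C V B G a)) has_real_derivative
    trace (dmlog (Kmat A C V B (geo G a t)) (Kmat_velocity A C V B G a t) ** log_velocity A C V B G a)) (at t)"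
proof -
  have pd: "posdef (Kmat A C V B (geo G a t))"
    using posdef_Kmat[OF B, of "geo G a t" V] spd_geo[OF G, of a t] by (simp add: spd_iff_posdef)
  have geo: "(geo G a has_derivative (\<lambda>h. h *\<^sub>R geo_velocity G a t)) (at t)"
    using geo_has_vector_derivative by (simp add: has_vector_derivative_def)
  have blt: "bounded_linear (\<lambda>X. trace (X ** log_velocity A C V B G a))"
    unfolding trace_mul_sym[of _ "log_velocity A C V B G a"] by (rule bounded_linear_trace_mult)
  let ?D = "\<lambda>E. Lmat A C V B ** block 0 0 0 (rhoM A C TYPE('n) B *\<^sub>R E) ** transpose (Lmat A C V B)"
  have "((\<lambda>t. trace (mlog (Kmat A C V B (geo G a t)) ** log_velocity A C V B G a)) has_derivative
      (\<lambda>h. trace (dmlog (Kmat A C V B (geo G a t)) (?D (h *\<^sub>R geo_velocity G a t)) ** log_velocity A C V B G a))) (at t)"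
    by (rule bounded_linear.has_derivative[OF blt])
      (rule has_derivative_compose[OF has_derivative_compose[OF geo has_derivative_Kmat] has_derivative_mlog[OF pd]])
  moreover have "?D (h *\<^sub>R geo_velocity G a t) = h *\<^sub>R Kmat_velocity A C V B G a t" for h
    using linear_cmul[OF has_derivative_linear[OF has_derivative_Kmat[of A C V B "geo G a t"]], of h "geo_velocity G a t"]
    by (simp add: Kmat_velocity_def)
  moreover have "dmlog (Kmat A C V B (geo G a t)) (h *\<^sub>R Kmat_velocity A C V B G a t) =
      h *\<^sub>R dmlog (Kmat A C V B (geo G a t)) (Kmat_velocity A C V B G a t)" for h
    by (rule linear_cmul[OF has_derivative_linear[OF has_derivative_mlog[OF pd]]])
  ultimately show ?thesis
    by (simp add: has_real_derivative_iff_has_vector_derivative has_vector_derivative_def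
        matrix_scaleR_left trace_scaleR)
qed

lemma energy_second_derivative_pos:
  fixes A B :: "real^'m^'d" and V :: "real^'n^'d" and G :: "real^'n^'n"
  assumes C: "invertible C" and B: "B \<in> actions A" and G: "invertible G" and a: "a \<noteq> 0"
  shows "trace (dmlog (Kmat A C V B (geo G a t)) (Kmat_velocity A C V B G a t) ** log_velocity A C V B G a) > 0"
proof -
  have gB: "B \<in> actions_nbhd A C" by (rule actions_in_nbhd[OF C B])
  have \<rho>: "rhoM A C TYPE('n) B > 0" using gB by (simp add: actions_nbhd_def rhoM_pos)
  have K: "spd (Kmat A C V B (geo G a t))" by (rule spd_Kmat[OF C B spd_geo[OF G]])
  let ?K' = "Kmat_velocity A C V B G a t" and ?L = "Lmat A C V B"
  have sym: "transpose ?K' = ?K'"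
    by (simp add: Kmat_velocity_def matrix_transpose_mul transpose_block transpose_scalar matrix_mul_assoc)
  have "?K' \<noteq> 0"
  proof
    assume "?K' = 0"
    then have "matrix_inv ?L ** ?K' ** transpose (matrix_inv ?L) = 0"
      by (simp add: matrix_mult_0_left matrix_mult_0_right)
    moreover have "matrix_inv ?L ** ?K' ** transpose (matrix_inv ?L) = (matrix_inv ?L ** ?L) **
        block 0 0 0 (rhoM A C TYPE('n) B *\<^sub>R geo_velocity G a t) ** transpose (matrix_inv ?L ** ?L)"
      by (simp add: Kmat_velocity_def matrix_transpose_mul matrix_mul_assoc)
    ultimately have "block 0 0 0 (rhoM A C TYPE('n) B *\<^sub>R geo_velocity G a t) = (0 :: real^('m + 'n)^('m + 'n))"
      by (simp add: matrix_inv_left[OF invertible_Lmat])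
    from arg_cong[OF this, of lower_right] have "geo_velocity G a t = 0"
      using \<rho> by (simp add: linear_0[OF linear_lower_right])
    then have "matrix_inv G ** geo_velocity G a t ** transpose (matrix_inv G) = 0"
      by (simp add: matrix_mult_0_left matrix_mult_0_right)
    moreover have "matrix_inv G ** geo_velocity G a t ** transpose (matrix_inv G) =
        (matrix_inv G ** G) ** diagm (\<chi> i. a $ i * exp (t * a $ i)) ** transpose (matrix_inv G ** G)"
      by (simp add: matrix_transpose_mul matrix_mul_assoc)
    ultimately have "diagm (\<chi> i. a $ i * exp (t * a $ i)) = 0" by (simp add: matrix_inv_left[OF G])
    then have "diagm (\<chi> i. a $ i * exp (t * a $ i)) $ i $ i = 0" for i by simp
    then have "a = 0" by (simp add: diagm_def vec_eq_iff)
    then show False using a by blast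
  qed
  from dmlog_pos[OF K sym this] show ?thesis by (simp only: Kmat_log_velocity[OF gB G])
qed

lemma geo_velocity_tangent:
  assumes "invertible G" "(\<Sum>i\<in>UNIV. a $ i) = 0"
  shows "geo_velocity G a t \<in> tangent1 (geo G a t)"
proof -
  have "trace (matrix_inv (geo G a t) ** geo_velocity G a t) =
      trace (transpose (matrix_inv G) ** (diagm a ** transpose G))"
    unfolding geo_log_velocity[OF assms(1)] by (simp add: matrix_mul_assoc)
  also have "\<dots> = trace (diagm a ** transpose (matrix_inv G ** G))"
    by (subst trace_mul_sym) (simp add: matrix_transpose_mul matrix_mul_assoc)
  also have "\<dots> = 0" by (simp add: matrix_inv_left[OF assms(1)] trace_diagm assms(2))
  finally show ?thesis
    by (simp add: tangent1_def matrix_transpose_mul matrix_mul_assoc)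
qed

text \<open>Between two critical points the derivative of the energy along the connecting geodesic would
  vanish at both ends, although it is strictly increasing.\<close>

lemma critical_point_unique:
  fixes P P' :: "real^'n^'n"
  assumes C: "invertible C" and B: "B \<in> actions A" and P: "P \<in> spd1" "P' \<in> spd1"
    and crit: "rgrad P (energy_grad A C V (P, B)) = 0" "rgrad P' (energy_grad A C V (P', B)) = 0"
  shows "P = P'"
proof (rule ccontr)
  assume ne: "P \<noteq> P'"
  have gB: "B \<in> actions_nbhd A C" by (rule actions_in_nbhd[OF C B])
  obtain G :: "real^'n^'n" and a where G: "invertible G" and G0: "geo G a 0 = P" and G1: "geo G a 1 = P'"
    and geo: "\<And>t. geo G a t \<in> spd1" and sum: "(\<Sum>i\<in>UNIV. a $ i) = 0"
    using spd1_connecting_geo[OF P] by blast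
  have a: "a \<noteq> 0"
  proof
    assume "a = 0"
    then have "geo G a 0 = geo G a 1" by (simp add: geo_def)
    then show False using ne G0 G1 by simp
  qed
  define \<psi> where "\<psi> = (\<lambda>t. trace (mlog (Kmat A C V B (geo G a t)) ** log_velocity A C V B G a))"
  have zero: "\<psi> t = 0" if "rgrad (geo G a t) (energy_grad A C V (geo G a t, B)) = 0" for t
    using airm_rgrad[OF geo geo_velocity_tangent[OF G sum], of t "energy_grad A C V (geo G a t, B)"] that
    by (simp add: \<psi>_def energy_grad_velocity[OF gB G, symmetric] linear_0[OF linear_airm_left])
  have "\<psi> 0 < \<psi> 1"
  proof (rule DERIV_pos_imp_increasing[of 0 1 \<psi>])
    show "\<exists>y. (\<psi> has_real_derivative y) (at t) \<and> 0 < y" for t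
      unfolding \<psi>_def
      using energy_second_derivative[OF gB G] energy_second_derivative_pos[OF C B G a] by blast
  qed simp
  then show False using zero[of 0] zero[of 1] crit by (simp add: G0 G1)
qed

text \<open>At a critical point the second derivative of the energy along the geodesic with velocity \<open>E\<close>
  can be computed in two ways: from the gradient field it is the value of the Hessian at \<open>E\<close>, and
  from the derivative of the logarithm it is positive.\<close>

lemma energy_hessian_pos:
  fixes S :: "real^'n^'n"
  assumes C: "invertible C" and B: "B \<in> actions A" and S: "S \<in> spd1"
    and crit: "rgrad S (energy_grad A C V (S, B)) = 0"
    and R: "((\<lambda>X. rgrad X (energy_grad A C V (X, B))) has_derivative R) (at S)"
    and E: "E \<in> tangent1 S" "E \<noteq> 0"
  shows "airm S (R E) E > 0"
proof -
  have gB: "B \<in> actions_nbhd A C" by (rule actions_in_nbhd[OF C B])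
  obtain G :: "real^'n^'n" and a where G: "invertible G" and G0: "geo G a 0 = S" and Ga: "G ** diagm a ** transpose G = E"
    and geo: "\<And>t. geo G a t \<in> spd1" and sum: "(\<Sum>i\<in>UNIV. a $ i) = 0"
    using tangent1_geo[OF S E(1)] by blast
  have a: "a \<noteq> 0"
  proof
    assume "a = 0"
    then have "diagm a = 0" by (simp add: diagm_def vec_eq_iff)
    then show False using E(2) Ga by (simp add: matrix_mult_0_left matrix_mult_0_right)
  qed
  define \<psi> where "\<psi> = (\<lambda>t. trace (mlog (Kmat A C V B (geo G a t)) ** log_velocity A C V B G a))"
  define c where "c = trace (dmlog (Kmat A C V B (geo G a 0)) (Kmat_velocity A C V B G a 0) ** log_velocity A C V B G a)"
  have c: "c > 0" unfolding c_def by (rule energy_second_derivative_pos[OF C B G a])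
  have \<psi>': "(\<psi> has_vector_derivative c) (at 0)"
    using energy_second_derivative[OF gB G, of V a 0]
    by (simp add: \<psi>_def c_def has_real_derivative_iff_has_vector_derivative)
  define r where "r = (\<lambda>X. rgrad X (energy_grad A C V (X, B)))"
  define Z where "Z = transpose (matrix_inv G) ** diagm a ** transpose G"
  have \<psi>_eq: "\<psi> t = trace ((matrix_inv (geo G a t) ** r (geo G a t)) ** Z)" for t
  proof -
    have "\<psi> t = airm (geo G a t) (r (geo G a t)) (geo_velocity G a t)"
      using airm_rgrad[OF geo geo_velocity_tangent[OF G sum], of t "energy_grad A C V (geo G a t, B)"]
      by (simp add: \<psi>_def r_def energy_grad_velocity[OF gB G])
    also have "\<dots> = trace ((matrix_inv (geo G a t) ** r (geo G a t)) ** (matrix_inv (geo G a t) ** geo_velocity G a t))"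
      by (simp add: airm_def matrix_mul_assoc)
    also have "\<dots> = trace ((matrix_inv (geo G a t) ** r (geo G a t)) ** Z)"
      by (simp only: geo_log_velocity[OF G] Z_def)
    finally show ?thesis .
  qed
  have gd: "(geo G a has_derivative (\<lambda>h. h *\<^sub>R E)) (at 0)"
    using geo_has_vector_derivative[of G a 0 UNIV] unfolding geo_velocity_0 Ga by (simp add: has_vector_derivative_def)
  have iS: "invertible (geo G a 0)" using spd_geo[OF G] spd_invertible by blast
  have 1: "((\<lambda>t. matrix_inv (geo G a t)) has_derivative
      (\<lambda>h. - (matrix_inv (geo G a 0) ** (h *\<^sub>R E) ** matrix_inv (geo G a 0)))) (at 0)"
    by (rule has_derivative_compose[OF gd has_derivative_matrix_inv[OF iS]])
  have 2: "((\<lambda>t. r (geo G a t)) has_derivative (\<lambda>h. R (h *\<^sub>R E))) (at 0)"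
    by (rule has_derivative_compose[OF gd]) (simp add: G0 r_def R)
  have r0: "r S = 0" by (simp add: r_def crit)
  have blt: "bounded_linear (\<lambda>X. trace (X ** Z))"
    unfolding trace_mul_sym[of _ Z] by (rule bounded_linear_trace_mult)
  have "(\<psi> has_derivative (\<lambda>h. trace ((matrix_inv (geo G a 0) ** R (h *\<^sub>R E) +
      - (matrix_inv (geo G a 0) ** (h *\<^sub>R E) ** matrix_inv (geo G a 0)) ** r (geo G a 0)) ** Z))) (at 0)"
    unfolding \<psi>_eq[abs_def]
    by (intro bounded_linear.has_derivative[OF blt] bounded_bilinear.FDERIV[OF bounded_bilinear_matrix_mult] 1 2)
  then have "(\<psi> has_vector_derivative trace (matrix_inv S ** R E ** Z)) (at 0)"
    by (simp add: r0 matrix_mult_0_right G0 has_vector_derivative_def linear_cmul[OF has_derivative_linear[OF R]]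
        matrix_scaleR_left matrix_scaleR_right trace_scaleR)
  then have "c = trace (matrix_inv S ** R E ** Z)"
    using \<psi>' vector_derivative_unique_at by blast
  also have "Z = matrix_inv S ** E"
    using geo_log_velocity[OF G, of a 0] by (simp add: Z_def G0 Ga)
  finally show ?thesis using c by (simp add: airm_def matrix_mul_assoc)
qed


section \<open>The minimizer and the canonical controller\<close>

lemma norm_le_exp_norm_log:
  fixes K :: "real^'n^'n"
  assumes "spd K"
  shows "norm K \<le> real CARD('n) * exp (norm (spd_log K))"
proof -
  obtain R v where R: "orthogonal_matrix R" and K: "K = R ** diagm v ** transpose R"
    and v: "\<And>i. v $ i > 0" using spd_diagonalization[OF assms] by blast
  let ?r = "norm (spd_log K)"
  have r: "?r = norm (diagm (\<chi> i. ln (v $ i)))"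
    unfolding spd_log_def K sym_fun_eq[OF R] by (rule norm_orthogonal_conjugate[OF orthogonal_matrixD(1)[OF R]])
  have v_le: "v $ i \<le> exp ?r" for i
  proof -
    have "(ln (v $ i))\<^sup>2 \<le> (\<Sum>i\<in>UNIV. (ln (v $ i))\<^sup>2)"
      by (rule member_le_sum) auto
    also have "\<dots> = ?r\<^sup>2" by (simp add: r norm_diagm_power2)
    finally have "ln (v $ i) \<le> ?r" by (simp add: power2_le_iff_abs_le)
    then show ?thesis using v[of i] by (metis exp_le_cancel_iff exp_ln)
  qed
  have n1: "real CARD('n) \<ge> 1" by (simp add: Suc_leI)
  have "(norm K)\<^sup>2 = (norm (diagm v))\<^sup>2"
    unfolding K by (simp add: norm_orthogonal_conjugate[OF orthogonal_matrixD(1)[OF R]])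
  also have "\<dots> \<le> (\<Sum>i\<in>(UNIV :: 'n set). (exp ?r)\<^sup>2)"
    unfolding norm_diagm_power2 using v v_le by (intro sum_mono power_mono) (auto simp: less_imp_le)
  also have "\<dots> = real CARD('n) * (exp ?r)\<^sup>2" by simp
  also have "\<dots> \<le> (real CARD('n))\<^sup>2 * (exp ?r)\<^sup>2"
    using n1 by (intro mult_right_mono) (auto simp: power2_eq_square)
  also have "\<dots> = (real CARD('n) * exp ?r)\<^sup>2" by (simp add: power_mult_distrib)
  finally show ?thesis by (rule power2_le_imp_le) simp
qed

text \<open>The norm of \<open>log K\<close> controls that of \<open>K\<close>, and \<open>\<Sigma>\<close> is a linear image of \<open>K\<close>.\<close>

lemma fB_sublevel_bounded:
  fixes A B :: "real^'m^'d" and V :: "real^'n^'d"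
  assumes C: "invertible C" and B: "B \<in> actions A"
  obtains \<beta> where "\<And>\<Sigma>. \<Sigma> \<in> spd1 \<Longrightarrow> fB A C V B \<Sigma> \<le> c \<Longrightarrow> norm \<Sigma> \<le> \<beta>"
proof -
  let ?L = "Lmat A C V B" and ?\<rho> = "rhoM A C TYPE('n) B"
  have \<rho>: "?\<rho> > 0" using actions_in_nbhd[OF C B] by (simp add: actions_nbhd_def rhoM_pos)
  define l where "l = (\<lambda>K. (1 / ?\<rho>) *\<^sub>R lower_right (matrix_inv ?L ** K ** transpose (matrix_inv ?L)))"
  have "bounded_linear (lower_right :: real^('m + 'n)^('m + 'n) \<Rightarrow> real^'n^'n)"
    using linear_lower_right linear_conv_bounded_linear by blast
  then have "bounded_linear l"
    unfolding l_def by (intro bounded_linear_compose[OF bounded_linear_scaleR_right]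
        bounded_linear_compose[OF _ bounded_linear_sandwich])
  then obtain k where k: "k \<ge> 0" "\<And>K. norm (l K) \<le> norm K * k" using bounded_linear.nonneg_bounded by metis
  have l: "l (Kmat A C V B \<Sigma>) = \<Sigma>" for \<Sigma>
  proof -
    have "matrix_inv ?L ** Kmat A C V B \<Sigma> ** transpose (matrix_inv ?L) =
        (matrix_inv ?L ** ?L) ** Qmat A C B \<Sigma> ** transpose (matrix_inv ?L ** ?L)"
      by (simp add: Kmat_def matrix_transpose_mul matrix_mul_assoc)
    then show ?thesis using \<rho> by (simp add: l_def matrix_inv_left[OF invertible_Lmat] Qmat_eq)
  qed
  show thesis
  proof (rule that)
    fix \<Sigma> :: "real^'n^'n" assume \<Sigma>: "\<Sigma> \<in> spd1" and le: "fB A C V B \<Sigma> \<le> c"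
    have K: "spd (Kmat A C V B \<Sigma>)" by (rule spd_Kmat[OF C B spd1_imp_spd[OF \<Sigma>]])
    have "(norm (spd_log (Kmat A C V B \<Sigma>)))\<^sup>2 \<le> 2 * c"
      using le by (simp add: fB_eq_log_energy[OF C B spd1_imp_spd[OF \<Sigma>]] log_energy_spd[OF K])
    then have "norm (spd_log (Kmat A C V B \<Sigma>)) \<le> sqrt (2 * c)" by (rule real_le_rsqrt)
    then have "norm (Kmat A C V B \<Sigma>) \<le> real CARD('m + 'n) * exp (sqrt (2 * c))"
      using norm_le_exp_norm_log[OF K] by (smt (verit) exp_le_cancel_iff mult_left_mono of_nat_0_le_iff)
    then show "norm \<Sigma> \<le> real CARD('m + 'n) * exp (sqrt (2 * c)) * k"
      using k(2)[of "Kmat A C V B \<Sigma>"] k(1) unfolding l by (meson mult_right_mono order_trans)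
  qed
qed

lemma continuous_on_fB: "invertible C \<Longrightarrow> B \<in> actions A \<Longrightarrow> continuous_on spd1 (fB A C V B)"
  unfolding continuous_on_eq_continuous_within
  using has_derivative_fB has_derivative_continuous by blast

lemma fB_minimizer:
  fixes V :: "real^'n^'d"
  assumes C: "invertible C" and B: "B \<in> actions A"
  obtains S where "S \<in> spd1" "\<And>\<Sigma>. \<Sigma> \<in> spd1 \<Longrightarrow> fB A C V B S \<le> fB A C V B \<Sigma>"
proof -
  let ?f = "fB A C V B"
  obtain \<beta> where \<beta>: "\<And>\<Sigma>. \<Sigma> \<in> spd1 \<Longrightarrow> ?f \<Sigma> \<le> ?f (mat 1) \<Longrightarrow> norm \<Sigma> \<le> \<beta>"
    using fB_sublevel_bounded[OF C B] by metis
  let ?X = "spd1 \<inter> cball 0 \<beta> :: (real^'n^'n) set"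
  have 1: "mat 1 \<in> ?X" using \<beta>[OF mat_1_spd1] mat_1_spd1 by simp
  have cp: "compact ?X" using closed_spd1 by (intro closed_Int_compact) auto
  have ct: "continuous_on ?X ?f" using continuous_on_fB[OF C B] continuous_on_subset by blast
  have ne: "?X \<noteq> {}" using 1 by blast
  from continuous_attains_inf[OF cp ne ct]
  obtain S where S: "S \<in> ?X" "\<forall>\<Sigma>\<in>?X. ?f S \<le> ?f \<Sigma>" ..
  show thesis
  proof (rule that)
    show "S \<in> spd1" using S by blast
    show "?f S \<le> ?f \<Sigma>" if "\<Sigma> \<in> spd1" for \<Sigma>
    proof (cases "?f \<Sigma> \<le> ?f (mat 1)")
      case True
      then show ?thesis using S(2) \<beta>[OF that True] that by simp
    next
      case False
      then show ?thesis using bspec[OF S(2) 1] by linarith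
    qed
  qed
qed

text \<open>A minimizer exists, every minimizer is critical, and there is only one critical point. So the
  minimizer is strict, and the definite description behind \<^const>\<open>Sigma_star\<close> denotes it.\<close>

lemma Sigma_star_properties:
  fixes V :: "real^'n^'d"
  assumes C: "invertible C" and B: "B \<in> actions A"
  shows "Sigma_star A C V B \<in> spd1"
    "\<Sigma> \<in> spd1 \<Longrightarrow> \<Sigma> \<noteq> Sigma_star A C V B \<Longrightarrow> fB A C V B (Sigma_star A C V B) < fB A C V B \<Sigma>"
    "\<Sigma> \<in> spd1 \<Longrightarrow> rgrad \<Sigma> (energy_grad A C V (\<Sigma>, B)) = 0 \<longleftrightarrow> \<Sigma> = Sigma_star A C V B"
proof -
  let ?f = "fB A C V B"
  obtain S where S: "S \<in> spd1" "\<And>\<Sigma>. \<Sigma> \<in> spd1 \<Longrightarrow> ?f S \<le> ?f \<Sigma>"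
    using fB_minimizer[OF C B, of V] by metis
  have crit: "rgrad \<Sigma> (energy_grad A C V (\<Sigma>, B)) = 0"
    if "\<Sigma> \<in> spd1" "\<And>P. P \<in> spd1 \<Longrightarrow> ?f \<Sigma> \<le> ?f P" for \<Sigma>
  proof -
    have "is_critical1 ?f \<Sigma>"
      by (rule local_min_critical1[OF has_derivative_fB[OF C B that(1)] that(1) open_UNIV UNIV_I]) (use that in auto)
    then show ?thesis using is_critical1_iff[OF has_derivative_fB[OF C B that(1)] that(1)] by blast
  qed
  have uniq: "\<Sigma> = S" if "\<Sigma> \<in> spd1" "rgrad \<Sigma> (energy_grad A C V (\<Sigma>, B)) = 0" for \<Sigma>
    by (rule critical_point_unique[OF C B that(1) S(1) that(2) crit[OF S]])
  have less: "?f S < ?f \<Sigma>" if "\<Sigma> \<in> spd1" "\<Sigma> \<noteq> S" for \<Sigma>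
  proof (rule ccontr)
    assume "\<not> ?f S < ?f \<Sigma>"
    then have "?f \<Sigma> \<le> ?f P" if "P \<in> spd1" for P using S(2)[OF that] by linarith
    from uniq[OF that(1) crit[OF that(1) this]] show False using that(2) by blast
  qed
  have eq: "Sigma_star A C V B = S"
    unfolding Sigma_star_def the_minimizer_def
  proof (rule the_equality)
    show "is_arg_min ?f (\<lambda>y. y \<in> spd1) S"
      using S by (auto simp: is_arg_min_def not_less)
    show "\<Sigma> = S" if "is_arg_min ?f (\<lambda>y. y \<in> spd1) \<Sigma>" for \<Sigma>
    proof (rule ccontr)
      assume "\<Sigma> \<noteq> S"
      then have "?f S < ?f \<Sigma>" using that by (intro less) (simp_all add: is_arg_min_def)
      then show False using that S(1) by (auto simp: is_arg_min_def)
    qed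
  qed
  have critS: "rgrad S (energy_grad A C V (S, B)) = 0" by (rule crit[OF S])
  show "Sigma_star A C V B \<in> spd1" unfolding eq by (rule S(1))
  show "\<Sigma> \<in> spd1 \<Longrightarrow> \<Sigma> \<noteq> Sigma_star A C V B \<Longrightarrow> fB A C V B (Sigma_star A C V B) < fB A C V B \<Sigma>"
    unfolding eq by (rule less)
  show "\<Sigma> \<in> spd1 \<Longrightarrow> rgrad \<Sigma> (energy_grad A C V (\<Sigma>, B)) = 0 \<longleftrightarrow> \<Sigma> = Sigma_star A C V B"
    unfolding eq using uniq[of \<Sigma>] critS by (intro iffI) simp_all
qed

lemma Kmat_block:
  fixes \<Sigma> :: "real^'n^'n"
  assumes C: "invertible C" and B: "B \<in> actions A"
  shows "Kmat A C V B \<Sigma> = block (Mmat A C B) (transpose (Nmat C V B)) (Nmat C V B)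
    (Nmat C V B ** matrix_inv (Mmat A C B) ** transpose (Nmat C V B) + rhoM A C TYPE('n) B *\<^sub>R \<Sigma>)"
proof -
  let ?M = "Mmat A C B" and ?N = "Nmat C V B"
  have M: "spd ?M" by (rule spd_Mmat[OF C B])
  have iM: "invertible ?M" using M by (rule spd_invertible)
  show ?thesis
    by (simp add: Kmat_def Lmat_def Qmat_eq transpose_block block_mult matrix_mult_0_left matrix_mult_0_right
        Tmat_def matrix_transpose_mul transpose_matrix_inv_spd[OF M] matrix_mul_assoc matrix_inv_cancel[OF iM]
        matrix_inv_right[OF iM])
qed

lemma det_Kmat:
  fixes A B :: "real^'m^'d" and V :: "real^'n^'d" and \<Sigma> :: "real^'n^'n"
  assumes C: "invertible C" and B: "B \<in> actions A" and \<Sigma>: "spd \<Sigma>"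
  shows "det (Kmat A C V B \<Sigma>) = det \<Sigma>"
proof -
  have M: "spd (Mmat A C B)" by (rule spd_Mmat[OF C B])
  have "det (Kmat A C V B \<Sigma>) = det (Qmat A C B \<Sigma>)"
    by (simp add: Kmat_def det_congruence Lmat_lower_block det_lower_block_square)
  also have "\<dots> = det (Mmat A C B) * det (rhoM A C TYPE('n) B *\<^sub>R \<Sigma>)"
    unfolding Qmat_eq by (intro det_block_diagonal) (simp_all add: M \<Sigma> spd_transpose transpose_scalar)
  also have "\<dots> = det \<Sigma>"
    using spd_det_pos[OF M] by (simp add: det_scaleR_matrix rhoM_power)
  finally show ?thesis .
qed

text \<open>In the frame \<open>[U, V]\<close> the equation \<open>P A = B\<close> fixes the first block column of \<open>P\<close>, and the remaining block
  is determined by its Schur complement \<open>\<rho> \<Sigma>\<close>.\<close>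

lemma feasible_controllers:
  fixes A U B :: "real^'m^'d" and V :: "real^'n^'d"
  assumes A: "A = U ** C" and C: "invertible C" and B: "B \<in> actions A"
    and W: "transpose (hcat U V) ** hcat U V = mat 1" "hcat U V ** transpose (hcat U V) = mat 1"
  shows "{P \<in> spd1. P ** A = B} = Phi A U C V B ` spd1"
proof -
  let ?W = "hcat U V" and ?M = "Mmat A C B" and ?N = "Nmat C V B"
  have "transpose ?W ** ?W = block (transpose U ** U) (transpose U ** V) (transpose V ** U) (transpose V ** V)"
    unfolding matrix_eq_entries split_sum_all by (simp add: matrix_matrix_mult_def hcat_def transpose_def)
  then have UV: "transpose U ** U = mat 1" "transpose V ** U = 0"
    unfolding W(1) block_mat_1[symmetric] block_eq_iff by auto
  have WU: "transpose ?W ** U = vcat (mat 1) 0" by (simp add: transpose_hcat_mult UV)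
  have M: "spd ?M" by (rule spd_Mmat[OF C B])
  have iM: "invertible ?M" using M by (rule spd_invertible)
  have \<rho>: "rhoM A C TYPE('n) B > 0" using spd_det_pos[OF M] by (rule rhoM_pos)
  have "?M = transpose (C ** matrix_inv C) ** transpose U ** B ** matrix_inv C"
    by (simp add: Mmat_def A matrix_transpose_mul matrix_mul_assoc)
  then have M_eq: "?M = transpose U ** (B ** matrix_inv C)"
    by (simp add: matrix_inv_right[OF C] matrix_mul_assoc)
  have MN: "vcat ?M ?N = transpose ?W ** (B ** matrix_inv C)"
    by (simp only: transpose_hcat_mult M_eq Nmat_def) (simp add: matrix_mul_assoc)
  have action: "?W ** block ?M X ?N Y ** transpose ?W ** A = B" for X Y
  proof -
    have "?W ** block ?M X ?N Y ** transpose ?W ** A = ?W ** (block ?M X ?N Y ** (transpose ?W ** U)) ** C"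
      by (simp add: A matrix_mul_assoc)
    also have "\<dots> = (?W ** transpose ?W) ** (B ** (matrix_inv C ** C))"
      by (simp add: WU block_mult_vcat matrix_mult_0_right MN matrix_mul_assoc)
    finally show ?thesis by (simp add: W matrix_inv_left[OF C])
  qed
  show ?thesis
  proof (intro set_eqI iffI)
    fix P assume "P \<in> Phi A U C V B ` spd1"
    then obtain \<Sigma> where \<Sigma>: "\<Sigma> \<in> spd1" and P: "P = ?W ** Kmat A C V B \<Sigma> ** transpose ?W"
      by (auto simp: Phi_eq)
    have K: "spd (Kmat A C V B \<Sigma>)" by (rule spd_Kmat[OF C B spd1_imp_spd[OF \<Sigma>]])
    have "det P = 1"
      unfolding P det_orthogonal_conjugate[OF spd_transpose[OF K] W] det_Kmat[OF C B spd1_imp_spd[OF \<Sigma>]]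
      by (rule spd1_det[OF \<Sigma>])
    moreover have "spd P" unfolding P by (rule spd_orthogonal_conjugate[OF K W(2)])
    moreover have "P ** A = B" unfolding P Kmat_block[OF C B] by (rule action)
    ultimately show "P \<in> {P \<in> spd1. P ** A = B}" by (simp add: spd1_def)
  next
    fix P assume "P \<in> {P \<in> spd1. P ** A = B}"
    then have P: "spd P" "det P = 1" "P ** A = B" by (simp_all add: spd1_def)
    have tW: "transpose ?W ** transpose (transpose ?W) = mat 1" "transpose (transpose ?W) ** transpose ?W = mat 1"
      by (simp_all add: W)
    define K where "K = transpose ?W ** P ** ?W"
    have K: "spd K" using spd_orthogonal_conjugate[OF P(1) tW(1)] by (simp add: K_def)
    have dK: "det K = 1"
      using det_orthogonal_conjugate[OF spd_transpose[OF P(1)] tW(2) tW(1)] by (simp add: K_def P(2))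
    have PK: "P = ?W ** K ** transpose ?W"
    proof -
      have "?W ** K ** transpose ?W = (?W ** transpose ?W) ** P ** (?W ** transpose ?W)"
        by (simp add: K_def matrix_mul_assoc)
      then show ?thesis by (simp add: W)
    qed
    obtain K1 K2 K3 K4 where K_eq: "K = block K1 K2 K3 K4" by (rule block_cases)
    have WUv: "?W ** vcat (mat 1) 0 = U" by (simp add: hcat_mult_vcat matrix_mult_0_right)
    have "A ** matrix_inv C = U" by (simp add: A matrix_inv_cancel[OF C])
    then have PU: "P ** U = B ** matrix_inv C" using P(3) by (metis matrix_mul_assoc)
    have "K ** vcat (mat 1) 0 = transpose ?W ** (P ** (?W ** vcat (mat 1) 0))"
      by (simp add: K_def matrix_mul_assoc)
    then have "K ** vcat (mat 1) 0 = transpose ?W ** (B ** matrix_inv C)"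
      by (simp only: WUv PU)
    then have "vcat K1 K3 = vcat ?M ?N"
      by (simp add: K_eq block_mult_vcat matrix_mult_0_right MN)
    then have K13: "K1 = ?M" "K3 = ?N" by (simp_all add: vcat_eq_iff)
    have "K2 = transpose ?N"
      using spd_transpose[OF K] by (auto simp: K_eq transpose_block block_eq_iff K13)
    define \<Sigma> where "\<Sigma> = (1 / rhoM A C TYPE('n) B) *\<^sub>R (K4 - ?N ** matrix_inv ?M ** transpose ?N)"
    have KK: "K = Kmat A C V B \<Sigma>"
      using \<rho> by (simp add: Kmat_block[OF C B] K_eq K13 \<open>K2 = transpose ?N\<close> \<Sigma>_def)
    let ?L = "Lmat A C V B"
    have "spd (matrix_inv ?L ** K ** transpose (matrix_inv ?L))"
      by (rule spd_congruence[OF K invertible_matrix_inv[OF invertible_Lmat]])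
    also have "matrix_inv ?L ** K ** transpose (matrix_inv ?L) =
        (matrix_inv ?L ** ?L) ** Qmat A C B \<Sigma> ** transpose (matrix_inv ?L ** ?L)"
      by (simp add: KK Kmat_def matrix_transpose_mul matrix_mul_assoc)
    finally have "spd (rhoM A C TYPE('n) B *\<^sub>R \<Sigma>)"
      by (simp add: matrix_inv_left[OF invertible_Lmat] Qmat_eq spd_block_diagonal)
    from spd_scaleR[OF _ this, of "1 / rhoM A C TYPE('n) B"] have s\<Sigma>: "spd \<Sigma>"
      using \<rho> by simp
    have "\<Sigma> \<in> spd1" using s\<Sigma> det_Kmat[OF C B s\<Sigma>, of V] dK by (simp add: spd1_def KK)
    then show "P \<in> Phi A U C V B ` spd1" using PK by (auto simp: Phi_eq KK)
  qed
qed

lemma canonical_controller_eq: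
  fixes A U B :: "real^'m^'d" and V :: "real^'n^'d"
  assumes A: "A = U ** C" and C: "invertible C" and B: "B \<in> actions A"
    and W: "transpose (hcat U V) ** hcat U V = mat 1" "hcat U V ** transpose (hcat U V) = mat 1"
  shows "canonical_controller A B = Phi A U C V B (Sigma_star A C V B)"
proof -
  let ?S = "Sigma_star A C V B" and ?d = "dAI (mat 1 :: real^'d^'d)"
  note star = Sigma_star_properties[OF C B, where V = V]
  have S: "?S \<in> spd1" using star(1) .
  have less: "?d (Phi A U C V B ?S) < ?d (Phi A U C V B \<Sigma>)" if \<Sigma>: "\<Sigma> \<in> spd1" "\<Sigma> \<noteq> ?S" for \<Sigma>
  proof -
    have "(?d (Phi A U C V B ?S))\<^sup>2 < (?d (Phi A U C V B \<Sigma>))\<^sup>2"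
      using star(2)[OF \<Sigma>] dAI_Phi[OF C B spd1_imp_spd[OF S] W] dAI_Phi[OF C B spd1_imp_spd[OF \<Sigma>(1)] W] by linarith
    then show ?thesis by (rule power_less_imp_less_base) (simp add: dAI_def)
  qed
  show ?thesis
    unfolding canonical_controller_def the_minimizer_def feasible_controllers[OF A C B W]
  proof (rule the_equality)
    show "is_arg_min ?d (\<lambda>y. y \<in> Phi A U C V B ` spd1) (Phi A U C V B ?S)"
      using S less unfolding is_arg_min_def by (force simp: not_less)
    fix P assume P: "is_arg_min ?d (\<lambda>y. y \<in> Phi A U C V B ` spd1) P"
    then obtain \<Sigma> where \<Sigma>: "\<Sigma> \<in> spd1" "P = Phi A U C V B \<Sigma>" by (auto simp: is_arg_min_def)
    show "P = Phi A U C V B ?S"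
    proof (rule ccontr)
      assume "P \<noteq> Phi A U C V B ?S"
      then have "\<Sigma> \<noteq> ?S" using \<Sigma>(2) by blast
      from less[OF \<Sigma>(1) this] show False using P S \<Sigma>(2) by (auto simp: is_arg_min_def)
    qed
  qed
qed


section \<open>Perturbations of a strict minimizer\<close>

lemma C2_on_gradient:
  fixes g :: "'a::euclidean_space \<Rightarrow> real"
  assumes "C2_on g W"
  obtains \<gamma> where "\<And>x. x \<in> W \<Longrightarrow> (g has_derivative (\<lambda>E. \<gamma> x \<bullet> E)) (at x)" "cont_diff_on \<gamma> W"
proof -
  obtain g' g'' where g': "\<And>x. x \<in> W \<Longrightarrow> (g has_derivative blinfun_apply (g' x)) (at x)"
    and g'': "\<And>x. x \<in> W \<Longrightarrow> (g' has_derivative blinfun_apply (g'' x)) (at x)"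
    and cont: "continuous_on W (g'' :: 'a \<Rightarrow> 'a \<Rightarrow>\<^sub>L ('a \<Rightarrow>\<^sub>L real))"
    using assms unfolding C2_on_def by blast
  define \<gamma> where "\<gamma> = (\<lambda>x. \<Sum>b\<in>Basis. blinfun_apply (g' x) b *\<^sub>R b)"
  have \<gamma>: "\<gamma> x \<bullet> E = blinfun_apply (g' x) E" for x E
  proof -
    have "blinfun_apply (g' x) E = blinfun_apply (g' x) (\<Sum>b\<in>Basis. (E \<bullet> b) *\<^sub>R b)"
      by (simp add: euclidean_representation)
    also have "\<dots> = (\<Sum>b\<in>Basis. (E \<bullet> b) * blinfun_apply (g' x) b)"
      by (simp add: blinfun.sum_right blinfun.scaleR_right)
    also have "\<dots> = \<gamma> x \<bullet> E"
      unfolding \<gamma>_def inner_sum_left by (rule sum.cong) (simp_all add: inner_commute)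
    finally show ?thesis by simp
  qed
  show thesis
  proof (rule that)
    show "(g has_derivative (\<lambda>E. \<gamma> x \<bullet> E)) (at x)" if "x \<in> W" for x
      using g'[OF that] by (simp add: \<gamma>)
    show "cont_diff_on \<gamma> W"
    proof (rule cont_diff_onI)
      show "(\<gamma> has_derivative (\<lambda>E. \<Sum>b\<in>Basis. blinfun_apply (blinfun_apply (g'' x) E) b *\<^sub>R b)) (at x)"
        if "x \<in> W" for x
        unfolding \<gamma>_def
        by (intro has_derivative_sum has_derivative_scaleR_left
            bounded_linear.has_derivative[OF blinfun.bounded_linear_left g''[OF that]])
      show "continuous_on W (\<lambda>x. \<Sum>b\<in>Basis. blinfun_apply (blinfun_apply (g'' x) E) b *\<^sub>R b)" for E
        by (intro continuous_intros cont)
    qed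
  qed
qed

lemma C2_near1_extension:
  fixes g :: "real^'n^'n \<Rightarrow> real"
  assumes "C2_near1 g S"
  shows "\<exists>W \<gamma> h. open W \<and> S \<in> W \<and> cont_diff_on \<gamma> W \<and>
    (\<forall>x\<in>W. (h has_derivative (\<lambda>E. \<gamma> x \<bullet> E)) (at x)) \<and> (\<forall>P\<in>W \<inter> spd1. h P = g P)"
proof -
  obtain W h where W: "open W" "S \<in> W" "C2_on h W" and eq: "\<forall>P\<in>W \<inter> spd1. h P = g P"
    using assms unfolding C2_near1_def by blast
  obtain \<gamma> where \<gamma>: "\<And>x. x \<in> W \<Longrightarrow> (h has_derivative (\<lambda>E. \<gamma> x \<bullet> E)) (at x)" "cont_diff_on \<gamma> W"
    using C2_on_gradient[OF W(3)] by blast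
  show ?thesis
    by (intro exI[of _ W] exI[of _ \<gamma>] exI[of _ h]) (simp add: W \<gamma> eq)
qed

lemma has_derivative_spd1_extension:
  assumes W: "open W" "P \<in> W \<inter> spd1" and h: "(h has_derivative D) (at P)"
    and eq: "\<forall>P\<in>W \<inter> spd1. h P = g P"
  shows "(g has_derivative D) (at P within spd1)"
proof -
  obtain e where e: "e > 0" "ball P e \<subseteq> W" using W openE by blast
  show ?thesis
  proof (rule has_derivative_transform_within[OF has_derivative_at_withinI[OF h] e(1)])
    show "h P' = g P'" if "P' \<in> spd1" "dist P' P < e" for P'
      using that e(2) eq by (auto simp: dist_commute subset_iff)
  qed (use W in auto)
qed

lemma perturbation_bound:
  fixes u :: "real^'p"
  shows "\<bar>\<Sum>i\<in>UNIV. u $ i * d i\<bar> \<le> norm u * (\<Sum>i\<in>UNIV. \<bar>d i\<bar>)"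
proof -
  have "\<bar>\<Sum>i\<in>UNIV. u $ i * d i\<bar> \<le> (\<Sum>i\<in>UNIV. \<bar>u $ i\<bar> * \<bar>d i\<bar>)"
    by (rule order_trans[OF sum_abs]) (simp add: abs_mult)
  also have "\<dots> \<le> (\<Sum>i\<in>UNIV. norm u * \<bar>d i\<bar>)"
    by (intro sum_mono mult_right_mono component_le_norm_cart) auto
  finally show ?thesis by (simp add: sum_distrib_left)
qed

text \<open>On the boundary of a small ball a strict minimum is exceeded by a fixed amount, which a small
  perturbation cannot compensate. So the minimum over the closed ball stays in the interior.\<close>

lemma strict_minimizer_persists:
  fixes f :: "real^'n^'n \<Rightarrow> real" and \<Delta> :: "'p::finite \<Rightarrow> real^'n^'n \<Rightarrow> real"
  assumes S: "S \<in> spd1" and strict: "\<And>\<Sigma>. \<Sigma> \<in> spd1 \<Longrightarrow> \<Sigma> \<noteq> S \<Longrightarrow> f S < f \<Sigma>" and \<epsilon>: "\<epsilon> > 0"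
    and cf: "continuous_on (cball S \<epsilon> \<inter> spd1) f" and c\<Delta>: "\<And>i. continuous_on (cball S \<epsilon> \<inter> spd1) (\<Delta> i)"
  obtains \<delta> where "\<delta> > 0" "\<And>u. norm u < \<delta> \<Longrightarrow> \<exists>m\<in>cball S \<epsilon> \<inter> spd1. \<forall>P\<in>cball S \<epsilon> \<inter> spd1. perturbed f \<Delta> m u \<le> perturbed f \<Delta> P u"
    "\<And>u m. norm u < \<delta> \<Longrightarrow> m \<in> cball S \<epsilon> \<inter> spd1 \<Longrightarrow> \<forall>P\<in>cball S \<epsilon> \<inter> spd1. perturbed f \<Delta> m u \<le> perturbed f \<Delta> P u \<Longrightarrow> m \<in> ball S \<epsilon>"
proof -
  let ?X = "cball S \<epsilon> \<inter> spd1"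
  have cX: "compact ?X" using closed_spd1 by (intro compact_Int_closed) auto
  have SX: "S \<in> ?X" using S \<epsilon> by simp
  have neX: "?X \<noteq> {}" using SX by blast
  define b where "b = (\<lambda>P. \<Sum>i\<in>UNIV. \<bar>\<Delta> i P\<bar>)"
  have cb: "continuous_on ?X b" unfolding b_def by (intro continuous_intros c\<Delta>)
  from continuous_attains_sup[OF cX neX cb]
  obtain q where q: "q \<in> ?X" "\<forall>P\<in>?X. b P \<le> b q" ..
  \<comment> \<open>The summand 1 makes \<open>D\<close> positive even if all perturbations vanish on the ball.\<close>
  define D where "D = b q + 1"
  have "b q \<ge> 0" unfolding b_def by (intro sum_nonneg) auto
  then have D: "D > 0" "\<And>P. P \<in> ?X \<Longrightarrow> b P \<le> D" using bspec[OF q(2)] by (fastforce simp: D_def)+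
  \<comment> \<open>The sphere may be empty: for \<open>n = 1\<close> the manifold is a single point.\<close>
  obtain \<eta> where \<eta>: "\<eta> > 0" "\<And>P. P \<in> sphere S \<epsilon> \<inter> spd1 \<Longrightarrow> f P \<ge> f S + 2 * \<eta>"
  proof (cases "sphere S \<epsilon> \<inter> spd1 = {}")
    case True
    then show thesis using that[of 1] by simp
  next
    case False
    have cY: "compact (sphere S \<epsilon> \<inter> spd1)" using closed_spd1 by (intro compact_Int_closed) auto
    have cfY: "continuous_on (sphere S \<epsilon> \<inter> spd1) f" by (rule continuous_on_subset[OF cf]) auto
    from continuous_attains_inf[OF cY False cfY]
    obtain q where q: "q \<in> sphere S \<epsilon> \<inter> spd1" "\<forall>P\<in>sphere S \<epsilon> \<inter> spd1. f q \<le> f P" ..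
    have "f S < f q" using q(1) \<epsilon> by (intro strict) auto
    show thesis
    proof (rule that)
      show "(f q - f S) / 2 > 0" using \<open>f S < f q\<close> by simp
      show "f P \<ge> f S + 2 * ((f q - f S) / 2)" if "P \<in> sphere S \<epsilon> \<inter> spd1" for P
        using bspec[OF q(2) that] by (simp add: field_simps)
    qed
  qed
  have pert: "\<bar>perturbed f \<Delta> P u - f P\<bar> < \<eta>" if "norm u < \<eta> / D" "P \<in> ?X" for u P
  proof -
    have "\<bar>perturbed f \<Delta> P u - f P\<bar> \<le> norm u * b P"
      using perturbation_bound[of u "\<lambda>i. \<Delta> i P"] by (simp add: perturbed_def b_def)
    also have "\<dots> \<le> norm u * D" using D(2)[OF that(2)] by (intro mult_left_mono) auto
    also have "\<dots> < \<eta>" using that(1) D(1) by (simp add: less_divide_eq)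
    finally show ?thesis .
  qed
  show thesis
  proof (rule that[of "\<eta> / D"])
    show "\<eta> / D > 0" using \<eta> D by simp
    fix u :: "real^'p" assume u: "norm u < \<eta> / D"
    have cp: "continuous_on ?X (\<lambda>P. perturbed f \<Delta> P u)"
      unfolding perturbed_def by (intro continuous_intros cf c\<Delta>)
    from continuous_attains_inf[OF cX neX cp]
    show "\<exists>m\<in>?X. \<forall>P\<in>?X. perturbed f \<Delta> m u \<le> perturbed f \<Delta> P u" .
    show "m \<in> ball S \<epsilon>" if m: "m \<in> ?X" "\<forall>P\<in>?X. perturbed f \<Delta> m u \<le> perturbed f \<Delta> P u" for m
    proof (rule ccontr)
      assume "m \<notin> ball S \<epsilon>"
      then have "f m \<ge> f S + 2 * \<eta>" using m(1) by (intro \<eta>(2)) auto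
      moreover have "perturbed f \<Delta> m u \<le> perturbed f \<Delta> S u" using m(2) SX by blast
      ultimately show False using pert[OF u m(1)] pert[OF u SX] by linarith
    qed
  qed
qed

text \<open>The value is an infimum of affine functions of the parameter. Comparing the minimizer of one
  parameter with that of another bounds the increment from both sides, and by continuity of the
  slopes \<open>d\<close> the two bounds agree to first order.\<close>

lemma affine_value_has_derivative:
  fixes v :: "real^'p \<Rightarrow> real" and d :: "'p::finite \<Rightarrow> real^'p \<Rightarrow> real"
  assumes T: "open T" "u \<in> T"
    and le: "\<And>u u'. u \<in> T \<Longrightarrow> u' \<in> T \<Longrightarrow> v u' \<le> v u + (\<Sum>i\<in>UNIV. (u' - u) $ i * d i u)"
    and cont: "\<And>i. continuous_on T (d i)"
  shows "(v has_derivative (\<lambda>b. \<Sum>i\<in>UNIV. b $ i * d i u)) (at u)"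
proof -
  obtain e where e: "e > 0" "ball u e \<subseteq> T" using T openE by blast
  let ?H = "\<lambda>u'. \<Sum>i\<in>UNIV. \<bar>d i u' - d i u\<bar>"
  show ?thesis
  proof (rule has_derivativeI_sandwich[OF e(1), where H = ?H])
    show "bounded_linear (\<lambda>b. \<Sum>i\<in>UNIV. b $ i * d i u)"
      by (intro bounded_linear_sum bounded_linear_mult_const bounded_linear_vec_nth)
  next
    fix u' assume u': "u' \<noteq> u" "dist u' u < e"
    then have T': "u' \<in> T" using e(2) by (auto simp: dist_commute)
    let ?s = "\<lambda>w. \<Sum>i\<in>UNIV. (u' - u) $ i * d i w"
    have "(\<Sum>i\<in>UNIV. (u - u') $ i * d i u') = - ?s u'"
      by (simp add: sum_negf[symmetric] algebra_simps)
    then have "?s u' \<le> v u' - v u" "v u' - v u \<le> ?s u"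
      using le[OF T' T(2)] le[OF T(2) T'] by simp_all
    then have "\<bar>v u' - v u - ?s u\<bar> \<le> \<bar>?s u' - ?s u\<bar>" by linarith
    also have "?s u' - ?s u = (\<Sum>i\<in>UNIV. (u' - u) $ i * (d i u' - d i u))"
      by (simp add: sum_subtractf[symmetric] algebra_simps)
    also have "\<bar>\<dots>\<bar> \<le> norm (u' - u) * ?H u'" by (rule perturbation_bound)
    finally show "norm (v u' - v u - ?s u) / norm (u' - u) \<le> ?H u'"
      using u'(1) by (simp add: divide_le_eq mult.commute)
  next
    have "isCont (d i) u" for i using cont continuous_on_eq_continuous_at T by blast
    then have "((\<lambda>u'. \<Sum>i\<in>UNIV. \<bar>d i u' - d i u\<bar>) \<longlongrightarrow> (\<Sum>i\<in>UNIV. \<bar>d i u - d i u\<bar>)) (at u)"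
      by (intro tendsto_intros) (simp add: isCont_def)
    then show "(?H \<longlongrightarrow> 0) (at u)" by simp
  qed
qed


section \<open>Calculus on the space of actions\<close>

lemma actions_diff: "B \<in> actions A \<Longrightarrow> B' \<in> actions A \<Longrightarrow> B' - B \<in> action_space A"
  by (simp add: actions_def action_space_def spd_def matrix_diff_ldistrib transpose_diff)

text \<open>As \<^const>\<open>actions\<close> is relatively open in the linear space \<^const>\<open>action_space\<close>, a derivative within
  it is determined exactly on that space.\<close>

lemma has_derivative_actions_unique:
  fixes g :: "real^'m^'d \<Rightarrow> 'b::real_normed_vector"
  assumes D: "(g has_derivative D) (at B within actions A)" and D': "(g has_derivative D') (at B within actions A)"
    and B: "B \<in> actions A" and Z: "Z \<in> action_space A"
  shows "D Z = D' Z"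
proof -
  let ?c = "\<lambda>t :: real. B + t *\<^sub>R Z"
  have blA: "bounded_linear (\<lambda>X :: real^'m^'d. transpose A ** X)"
    by (rule bounded_bilinear.bounded_linear_right[OF bounded_bilinear_matrix_mult])
  have "continuous_on UNIV (\<lambda>t. transpose A ** ?c t)"
    by (intro bounded_linear.continuous_on[OF blA] continuous_intros)
  then have op: "open ((\<lambda>t. transpose A ** ?c t) -` {P. posdef P})" by (rule open_vimage[OF open_posdef])
  have "0 \<in> (\<lambda>t. transpose A ** ?c t) -` {P. posdef P}"
    using B by (simp add: actions_def spd_iff_posdef)
  with op obtain e where e: "e > 0" "ball 0 e \<subseteq> (\<lambda>t. transpose A ** ?c t) -` {P. posdef P}"
    using openE by blast
  have sub: "?c ` ball 0 e \<subseteq> actions A"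
  proof
    fix X assume "X \<in> ?c ` ball 0 e"
    then obtain t where t: "t \<in> ball 0 e" "X = ?c t" by blast
    have "transpose (transpose A ** X) = transpose A ** X"
      using B Z by (simp add: t actions_def action_space_def spd_def matrix_add_ldistrib transpose_add
          matrix_scaleR_right transpose_scalar)
    moreover have "posdef (transpose A ** X)" using e(2) t by blast
    ultimately show "X \<in> actions A" by (simp add: actions_def spd_iff_posdef)
  qed
  have c: "(?c has_derivative (\<lambda>h. h *\<^sub>R Z)) (at 0 within ball 0 e)"
    by (auto intro!: derivative_eq_intros)
  have der: "((\<lambda>t. g (?c t)) has_vector_derivative D Z) (at 0)" if D: "(g has_derivative D) (at B within actions A)" for D
  proof -
    have "(g has_derivative D) (at (?c 0) within ?c ` ball 0 e)"
      using has_derivative_subset[OF D sub] by simp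
    from has_derivative_in_compose[OF c this]
    have "((\<lambda>t. g (?c t)) has_derivative (\<lambda>h. D (h *\<^sub>R Z))) (at 0 within ball 0 e)" .
    moreover have "at (0 :: real) within ball 0 e = at 0" using e(1) by (intro at_within_open) auto
    ultimately show ?thesis
      by (simp add: has_vector_derivative_def linear_cmul[OF has_derivative_linear[OF D]])
  qed
  show ?thesis by (rule vector_derivative_unique_at[OF der[OF D] der[OF D']])
qed

lemma frechet_derivative_actions:
  fixes g :: "real^'m^'d \<Rightarrow> 'b::real_normed_vector"
  assumes D: "(g has_derivative D) (at B within actions A)" and B: "B \<in> actions A" and Z: "Z \<in> action_space A"
  shows "frechet_derivative g (at B within actions A) Z = D Z"
proof -
  have "g differentiable (at B within actions A)" using D by (auto simp: differentiable_def)
  then show ?thesis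
    using has_derivative_actions_unique[OF _ D B Z] by (simp add: frechet_derivative_works)
qed

lemma has_derivative_actions_cong:
  fixes g :: "real^'m^'d \<Rightarrow> 'b::real_normed_vector"
  assumes D: "(g has_derivative D) (at B within actions A)" and B: "B \<in> actions A" and D': "bounded_linear D'"
    and eq: "\<And>Z. Z \<in> action_space A \<Longrightarrow> D' Z = D Z"
  shows "(g has_derivative D') (at B within actions A)"
proof -
  have lim: "((\<lambda>y. (1 / norm (y - B)) *\<^sub>R (g y - (g B + D (y - B)))) \<longlongrightarrow> 0) (at B within actions A)"
    using D unfolding has_derivative_within by blast
  have "\<forall>\<^sub>F y in at B within actions A. (1 / norm (y - B)) *\<^sub>R (g y - (g B + D (y - B))) =
      (1 / norm (y - B)) *\<^sub>R (g y - (g B + D' (y - B)))"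
    unfolding eventually_at_filter using eq actions_diff[OF B] by (intro always_eventually) simp
  from Lim_transform_eventually[OF lim this] show ?thesis
    unfolding has_derivative_within using D' by blast
qed


section \<open>Responses of the minimizer\<close>

lemma energy_hessian_exists:
  fixes V :: "real^'n^'d"
  assumes C: "invertible C" and B: "B \<in> actions A"
  defines "S \<equiv> Sigma_star A C V B"
  obtains R where "((\<lambda>X. rgrad X (energy_grad A C V (X, B))) has_derivative R) (at S)"
    "linear R" "\<And>E. R (symp E) \<in> tangent1 S"
    "\<And>E. E \<in> tangent1 S \<Longrightarrow> E \<noteq> 0 \<Longrightarrow> airm S (R E) E > 0"
    "\<And>X Y. X \<in> tangent1 S \<Longrightarrow> hess1 (fB A C V B) S X Y = airm S (R X) Y"
proof -
  note star = Sigma_star_properties[OF C B, where V = V, folded S_def]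
  have S: "S \<in> spd1" by (rule star(1))
  have crit: "rgrad S (energy_grad A C V (S, B)) = 0" using star(3)[OF S] by simp
  have mem: "(S, B) \<in> energy_domain A C"
    using spd1_imp_spd[OF S] actions_in_nbhd[OF C B] by (simp add: energy_domain_def spd_iff_posdef)
  have "cont_diff_on (\<lambda>z. rgrad (fst z) (energy_grad A C V z)) (energy_domain A C)"
    by (intro cont_diff_on_rgrad cont_diff_on_energy_grad cont_diff_on_bounded_linear bounded_linear_fst)
  from cont_diff_on_differentiable[OF this mem]
  obtain r' where r': "((\<lambda>z. rgrad (fst z) (energy_grad A C V z)) has_derivative r') (at (S, B))"
    unfolding differentiable_def ..
  have "((\<lambda>X. (X, B)) has_derivative (\<lambda>E. (E, 0))) (at S)"
    by (intro has_derivative_Pair has_derivative_const has_derivative_ident)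
  from has_derivative_compose[OF this r']
  have R: "((\<lambda>X. rgrad X (energy_grad A C V (X, B))) has_derivative (\<lambda>E. r' (E, 0))) (at S)" by simp
  show thesis
  proof (rule that[OF R has_derivative_linear[OF R]])
    show "r' (symp E, 0) \<in> tangent1 S" for E
      by (rule rgrad_derivative_tangent[where \<Gamma> = "\<lambda>X. energy_grad A C V (X, B)", OF S crit R])
    show "airm S (r' (E, 0)) E > 0" if "E \<in> tangent1 S" "E \<noteq> 0" for E
      by (rule energy_hessian_pos[OF C B S crit R that])
    show "hess1 (fB A C V B) S X Y = airm S (r' (X, 0)) Y" if "X \<in> tangent1 S" for X Y
      by (rule hess1_at_critical[where \<Gamma> = "\<lambda>X. energy_grad A C V (X, B)", OF S open_UNIV UNIV_I _ R crit that])
        (auto intro: has_derivative_fB[OF C B])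
  qed
qed

lemma hess_inv1_eqI:
  assumes S: "S \<in> spd1" and lin: "linear R"
    and pos: "\<And>E. E \<in> tangent1 S \<Longrightarrow> E \<noteq> 0 \<Longrightarrow> airm S (R E) E > 0"
    and hess: "\<And>X Y. X \<in> tangent1 S \<Longrightarrow> hess1 g S X Y = airm S (R X) Y"
    and X: "X \<in> tangent1 S" "\<And>Y. Y \<in> tangent1 S \<Longrightarrow> airm S (R X) Y = \<xi> Y"
  shows "hess_inv1 g S \<xi> = X"
  unfolding hess_inv1_def
proof (rule the_equality)
  show "X \<in> tangent1 S \<and> (\<forall>Y\<in>tangent1 S. hess1 g S X Y = \<xi> Y)" using X hess by simp
  fix Z assume Z: "Z \<in> tangent1 S \<and> (\<forall>Y\<in>tangent1 S. hess1 g S Z Y = \<xi> Y)"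
  then have ZX: "Z - X \<in> tangent1 S" using X(1) subspace_tangent1 subspace_diff by blast
  have "airm S (R (Z - X)) (Z - X) = 0"
    using Z X(2)[OF ZX] ZX hess[of Z "Z - X"] by (simp add: linear_diff[OF lin] linear_diff[OF linear_airm_left])
  then show "Z = X" using pos[OF ZX] by force
qed

lemma fB_hessian_bijective:
  fixes V :: "real^'n^'d"
  assumes C: "invertible C" and B: "B \<in> actions A" and \<xi>: "linear \<xi>"
  defines "S \<equiv> Sigma_star A C V B"
  shows "\<exists>!X. X \<in> tangent1 S \<and> (\<forall>Y\<in>tangent1 S. hess1 (fB A C V B) S X Y = \<xi> Y)"
proof -
  have S: "S \<in> spd1" unfolding S_def by (rule Sigma_star_properties(1)[OF C B])
  obtain R where "((\<lambda>X. rgrad X (energy_grad A C V (X, B))) has_derivative R) (at S)"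
    and R: "linear R" "\<And>E. R (symp E) \<in> tangent1 S"
    "\<And>E. E \<in> tangent1 S \<Longrightarrow> E \<noteq> 0 \<Longrightarrow> airm S (R E) E > 0"
    "\<And>X Y. X \<in> tangent1 S \<Longrightarrow> hess1 (fB A C V B) S X Y = airm S (R X) Y"
    by (rule energy_hessian_exists[OF C B, of V, folded S_def]) (rule that, assumption+)
  have "\<exists>!X. X \<in> tangent1 S \<and> (\<forall>Y\<in>tangent1 S. airm S (R X) Y = \<xi> Y)"
    by (rule hessian_equation_solvable[OF S R(1,2,3) \<xi>])
  moreover have "X \<in> tangent1 S \<and> (\<forall>Y\<in>tangent1 S. airm S (R X) Y = \<xi> Y) \<longleftrightarrow>
      X \<in> tangent1 S \<and> (\<forall>Y\<in>tangent1 S. hess1 (fB A C V B) S X Y = \<xi> Y)" for X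
    using R(4) by auto
  ultimately show ?thesis by simp
qed

text \<open>The branch comes from \<open>critical_branch\<close> for the gradient \<open>\<nabla>f\<^sub>B + \<Sum> u\<^sub>i \<nabla>\<Delta>\<^sub>i\<close>, where the gradients of
  the perturbations are those of local ambient extensions. Its minimality follows from
  \<open>strict_minimizer_persists\<close>, and the derivative of the value from \<open>affine_value_has_derivative\<close>.\<close>

theorem perturbed_minimizer_response:
  fixes V :: "real^'n^'d" and \<Delta> :: "'p::finite \<Rightarrow> real^'n^'n \<Rightarrow> real"
  assumes C: "invertible C" and B: "B \<in> actions A"
  defines "S \<equiv> Sigma_star A C V B" and "F \<equiv> perturbed (fB A C V B) \<Delta>"
    and "Hinv \<equiv> hess_inv1 (fB A C V B) (Sigma_star A C V B)"
  assumes \<Delta>: "\<And>i. C2_near1 (\<Delta> i) S"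
  shows "\<exists>W \<delta> \<sigma>. open W \<and> S \<in> W \<and> \<delta> > 0 \<and>
        (\<forall>u. norm u < \<delta> \<longrightarrow>
           \<sigma> u \<in> W \<and> is_critical1 (\<lambda>\<Sigma>. F \<Sigma> u) (\<sigma> u) \<and>
           (\<forall>\<Sigma>\<in>W. is_critical1 (\<lambda>\<Sigma>. F \<Sigma> u) \<Sigma> \<longrightarrow> \<Sigma> = \<sigma> u) \<and>
           strict_local_min1 (\<lambda>\<Sigma>. F \<Sigma> u) (\<sigma> u)) \<and>
        (\<sigma> has_derivative (\<lambda>a. - Hinv (pert_G \<Delta> S a))) (at 0) \<and>
        has_second_derivative (\<lambda>u. F (\<sigma> u) u) (\<lambda>a b. - pert_G_dual \<Delta> S (Hinv (pert_G \<Delta> S a)) b) 0"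
proof -
  let ?f = "fB A C V B"
  note star = Sigma_star_properties[OF C B, where V = V, folded S_def]
  have S: "S \<in> spd1" by (rule star(1))
  have crit: "rgrad S (energy_grad A C V (S, B)) = 0" using star(3)[OF S] by simp
  obtain R where R: "((\<lambda>X. rgrad X (energy_grad A C V (X, B))) has_derivative R) (at S)"
    "linear R" "\<And>E. R (symp E) \<in> tangent1 S"
    "\<And>E. E \<in> tangent1 S \<Longrightarrow> E \<noteq> 0 \<Longrightarrow> airm S (R E) E > 0"
    "\<And>X Y. X \<in> tangent1 S \<Longrightarrow> hess1 ?f S X Y = airm S (R X) Y"
    by (rule energy_hessian_exists[OF C B, of V, folded S_def]) (rule that, assumption+)
  have "\<forall>i. \<exists>W \<gamma> h. open W \<and> S \<in> W \<and> cont_diff_on \<gamma> W \<and>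
      (\<forall>x\<in>W. (h has_derivative (\<lambda>E. \<gamma> x \<bullet> E)) (at x)) \<and> (\<forall>P\<in>W \<inter> spd1. h P = \<Delta> i P)"
    using C2_near1_extension[OF \<Delta>] by (rule allI)
  from choice[OF this] obtain W0 where W0: "\<forall>i. \<exists>\<gamma> h. open (W0 i) \<and> S \<in> W0 i \<and> cont_diff_on \<gamma> (W0 i) \<and>
      (\<forall>x\<in>W0 i. (h has_derivative (\<lambda>E. \<gamma> x \<bullet> E)) (at x)) \<and> (\<forall>P\<in>W0 i \<inter> spd1. h P = \<Delta> i P)" ..
  from choice[OF this] obtain \<gamma> where "\<forall>i. \<exists>h. open (W0 i) \<and> S \<in> W0 i \<and> cont_diff_on (\<gamma> i) (W0 i) \<and>
      (\<forall>x\<in>W0 i. (h has_derivative (\<lambda>E. \<gamma> i x \<bullet> E)) (at x)) \<and> (\<forall>P\<in>W0 i \<inter> spd1. h P = \<Delta> i P)" ..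
  from choice[OF this] obtain h where h: "\<forall>i. open (W0 i) \<and> S \<in> W0 i \<and> cont_diff_on (\<gamma> i) (W0 i) \<and>
      (\<forall>x\<in>W0 i. (h i has_derivative (\<lambda>E. \<gamma> i x \<bullet> E)) (at x)) \<and> (\<forall>P\<in>W0 i \<inter> spd1. h i P = \<Delta> i P)" ..
  define W1 where "W1 = (\<Inter>i. W0 i)"
  have W1: "open W1" "S \<in> W1" unfolding W1_def using h by (auto intro: open_INT)
  have cd\<gamma>: "cont_diff_on (\<gamma> i) W1" for i
    using h cont_diff_on_subset[of "\<gamma> i" "W0 i" W1] by (auto simp: W1_def)
  have h': "(h i has_derivative (\<lambda>E. \<gamma> i x \<bullet> E)) (at x)" if "x \<in> W1" for i x
    using h that by (auto simp: W1_def)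
  have h_eq: "\<forall>P\<in>W1 \<inter> spd1. h i P = \<Delta> i P" for i using h by (auto simp: W1_def)
  have \<Delta>': "(\<Delta> i has_derivative (\<lambda>E. \<gamma> i P \<bullet> E)) (at P within spd1)" if "P \<in> W1 \<inter> spd1" for i P
    using has_derivative_spd1_extension[OF W1(1) that h' h_eq] that by blast
  define \<Gamma> where "\<Gamma> = (\<lambda>z :: (real^'n^'n) \<times> (real^'p). energy_grad A C V (fst z, B) + (\<Sum>i\<in>UNIV. snd z $ i *\<^sub>R \<gamma> i (fst z)))"
  define N where "N = ({X. posdef X} \<inter> W1) \<times> (UNIV :: (real^'p) set)"
  have N: "open N" "(S, 0) \<in> N"
    unfolding N_def using W1 spd1_imp_spd[OF S] by (auto intro!: open_Times open_Int open_posdef simp: spd_iff_posdef)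
  have cdfst: "cont_diff_on fst N" by (intro cont_diff_on_bounded_linear bounded_linear_fst)
  have cd1: "cont_diff_on (\<lambda>z. energy_grad A C V (fst z, B)) N"
    by (rule cont_diff_on_compose[OF cont_diff_on_energy_grad cont_diff_on_Pair[OF cdfst cont_diff_on_const]])
      (auto simp: N_def energy_domain_def actions_in_nbhd[OF C B])
  have cd2: "cont_diff_on (\<lambda>z. \<gamma> i (fst z)) N" for i
    by (rule cont_diff_on_compose[OF cd\<gamma> cdfst]) (auto simp: N_def)
  have cd3: "cont_diff_on (\<lambda>z. snd z $ i) N" for i :: 'p
    by (intro cont_diff_on_bounded_linear bounded_linear_compose[OF bounded_linear_vec_nth bounded_linear_snd])
  have cd\<Gamma>: "cont_diff_on \<Gamma> N"
    unfolding \<Gamma>_def by (intro cont_diff_on_add cont_diff_on_sum cont_diff_on_scaleR cd1 cd2 cd3)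
  have F': "((\<lambda>\<Sigma>. F \<Sigma> u) has_derivative (\<lambda>E. \<Gamma> (P, u) \<bullet> E)) (at P within spd1)"
    if P: "P \<in> W1 \<inter> spd1" for P u
  proof -
    have "((\<lambda>\<Sigma>. ?f \<Sigma> + (\<Sum>i\<in>UNIV. u $ i * \<Delta> i \<Sigma>)) has_derivative
        (\<lambda>E. energy_grad A C V (P, B) \<bullet> E + (\<Sum>i\<in>UNIV. u $ i * (\<gamma> i P \<bullet> E)))) (at P within spd1)"
      using P by (intro has_derivative_add has_derivative_sum has_derivative_mult_right \<Delta>' has_derivative_fB C B) auto
    then show ?thesis
      by (simp add: F_def perturbed_def \<Gamma>_def inner_add_left inner_sum_left)
  qed
  have crit_iff: "is_critical1 (\<lambda>\<Sigma>. F \<Sigma> u) P \<longleftrightarrow> rgrad P (\<Gamma> (P, u)) = 0" if "P \<in> W1 \<inter> spd1" for P u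
    using is_critical1_iff[OF F'[OF that]] that by blast
  have \<Gamma>0: "\<Gamma> (X, 0) = energy_grad A C V (X, B)" for X by (simp add: \<Gamma>_def)
  have K: "((\<lambda>u. \<Gamma> (S, u)) has_derivative (\<lambda>u. \<Sum>i\<in>UNIV. u $ i *\<^sub>R \<gamma> i S)) (at 0)"
  proof -
    have "((\<lambda>u :: real^'p. energy_grad A C V (S, B) + (\<Sum>i\<in>UNIV. u $ i *\<^sub>R \<gamma> i S)) has_derivative
        (\<lambda>u. 0 + (\<Sum>i\<in>UNIV. u $ i *\<^sub>R \<gamma> i S))) (at 0)"
      by (intro has_derivative_add has_derivative_const has_derivative_sum has_derivative_scaleR_left
          bounded_linear_imp_has_derivative bounded_linear_vec_nth)
    then show ?thesis by (simp add: \<Gamma>_def)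
  qed
  have crit0: "rgrad S (\<Gamma> (S, 0)) = 0" by (simp add: \<Gamma>0 crit)
  have R0: "((\<lambda>X. rgrad X (\<Gamma> (X, 0))) has_derivative R) (at S)" by (simp add: \<Gamma>0 R(1))
  obtain W \<delta>0 \<sigma> \<sigma>' where W: "open W" "S \<in> W" and \<delta>0: "\<delta>0 > 0"
    and WN: "\<And>X l. X \<in> W \<Longrightarrow> l \<in> ball 0 \<delta>0 \<Longrightarrow> X \<in> spd1 \<Longrightarrow> (X, l) \<in> N"
    and \<sigma>: "\<And>l. l \<in> ball 0 \<delta>0 \<Longrightarrow> \<sigma> l \<in> W \<and> \<sigma> l \<in> spd1 \<and> rgrad (\<sigma> l) (\<Gamma> (\<sigma> l, l)) = 0"
    and uniq: "\<And>X l. X \<in> W \<Longrightarrow> l \<in> ball 0 \<delta>0 \<Longrightarrow> X \<in> spd1 \<Longrightarrow> rgrad X (\<Gamma> (X, l)) = 0 \<Longrightarrow> X = \<sigma> l"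
    and cont\<sigma>: "continuous_on (ball 0 \<delta>0) \<sigma>" and \<sigma>': "(\<sigma> has_derivative \<sigma>') (at 0)" and \<sigma>0: "\<sigma> 0 = S"
    and tang: "\<And>h. \<sigma>' h \<in> tangent1 S"
    and eqn: "\<And>h Y. Y \<in> tangent1 S \<Longrightarrow> airm S (R (\<sigma>' h)) Y = - ((\<Sum>i\<in>UNIV. h $ i *\<^sub>R \<gamma> i S) \<bullet> Y)"
    by (rule critical_branch[OF S N cd\<Gamma> crit0 R0 K]) (erule (1) R(4), rule that, assumption+)
  have WW1: "X \<in> W1" if "X \<in> W" "X \<in> spd1" for X
    using WN[OF that(1) _ that(2), of 0] \<delta>0 by (simp add: N_def)
  \<comment> \<open>The branch is unique on \<open>W\<close>; minimality is tested on a closed ball inside \<open>W\<close>.\<close>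
  obtain \<epsilon> where \<epsilon>: "\<epsilon> > 0" "cball S \<epsilon> \<subseteq> W" using W open_contains_cball by blast
  let ?X = "cball S \<epsilon> \<inter> spd1"
  have XW1: "P \<in> W1 \<inter> spd1" if "P \<in> ?X" for P using that WW1 \<epsilon>(2) by blast
  have c\<Delta>: "continuous_on ?X (\<Delta> i)" for i
    unfolding continuous_on_eq_continuous_within
  proof
    fix P assume "P \<in> ?X"
    from has_derivative_continuous[OF \<Delta>'[OF XW1[OF this]]]
    show "continuous (at P within ?X) (\<Delta> i)" by (rule continuous_within_subset) auto
  qed
  have cf: "continuous_on ?X ?f" by (rule continuous_on_subset[OF continuous_on_fB[OF C B]]) auto
  obtain \<delta>1 where \<delta>1: "\<delta>1 > 0"
    and min: "\<And>u. norm u < \<delta>1 \<Longrightarrow> \<exists>m\<in>?X. \<forall>P\<in>?X. F m u \<le> F P u"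
    and int: "\<And>u m. norm u < \<delta>1 \<Longrightarrow> m \<in> ?X \<Longrightarrow> \<forall>P\<in>?X. F m u \<le> F P u \<Longrightarrow> m \<in> ball S \<epsilon>"
    by (rule strict_minimizer_persists[where \<Delta> = \<Delta> and f = "fB A C V B", OF S _ \<epsilon>(1) cf c\<Delta>, folded F_def]) (erule (1) star(2), rule that, assumption+)
  have "isCont \<sigma> 0" using has_derivative_continuous[OF \<sigma>'] .
  then obtain \<delta>2 where \<delta>2: "\<delta>2 > 0" "\<And>u. norm u < \<delta>2 \<Longrightarrow> \<sigma> u \<in> ball S \<epsilon>"
    using \<epsilon>(1) unfolding continuous_at_eps_delta by (auto simp: \<sigma>0 dist_commute)
  define \<delta> where "\<delta> = min \<delta>0 (min \<delta>1 \<delta>2)"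
  have \<delta>: "\<delta> > 0" "norm u < \<delta> \<Longrightarrow> norm u < \<delta>0 \<and> norm u < \<delta>1 \<and> norm u < \<delta>2" for u :: "real^'p"
    using \<delta>0 \<delta>1 \<delta>2(1) by (auto simp: \<delta>_def)
  \<comment> \<open>A minimizer over the closed ball lies in the interior, so it is critical and hence on the branch.\<close>
  have minimizer: "m = \<sigma> u" if u: "norm u < \<delta>" and m: "m \<in> ?X" "\<forall>P\<in>?X. F m u \<le> F P u" for u m
  proof -
    have mb: "m \<in> ball S \<epsilon>" using int[OF _ m] \<delta>(2)[OF u] by blast
    have "is_critical1 (\<lambda>\<Sigma>. F \<Sigma> u) m"
      by (rule local_min_critical1[OF F'[OF XW1[OF m(1)]] _ open_ball mb]) (use m in auto)
    then have "rgrad m (\<Gamma> (m, u)) = 0" using crit_iff[OF XW1[OF m(1)]] by blast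
    then show ?thesis using m(1) \<epsilon>(2) \<delta>(2)[OF u] by (intro uniq) auto
  qed
  have \<sigma>X: "\<sigma> u \<in> ball S \<epsilon>" "\<sigma> u \<in> spd1" "\<sigma> u \<in> ?X" if "norm u < \<delta>" for u
    using \<delta>2(2)[of u] \<delta>(2)[OF that] \<sigma>[of u] by auto
  have \<sigma>min: "F (\<sigma> u) u \<le> F P u" if u: "norm u < \<delta>" and P: "P \<in> ?X" for u P
  proof -
    obtain m where m: "m \<in> ?X" "\<forall>P\<in>?X. F m u \<le> F P u" using min \<delta>(2)[OF u] by blast
    then show ?thesis using minimizer[OF u m] P by blast
  qed
  have local: "\<sigma> u \<in> ball S \<epsilon> \<and> is_critical1 (\<lambda>\<Sigma>. F \<Sigma> u) (\<sigma> u) \<and>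
      (\<forall>\<Sigma>\<in>ball S \<epsilon>. is_critical1 (\<lambda>\<Sigma>. F \<Sigma> u) \<Sigma> \<longrightarrow> \<Sigma> = \<sigma> u) \<and>
      strict_local_min1 (\<lambda>\<Sigma>. F \<Sigma> u) (\<sigma> u)" if u: "norm u < \<delta>" for u
  proof (intro conjI ballI impI)
    show "\<sigma> u \<in> ball S \<epsilon>" by (rule \<sigma>X(1)[OF u])
    show "is_critical1 (\<lambda>\<Sigma>. F \<Sigma> u) (\<sigma> u)"
      using crit_iff[OF XW1[OF \<sigma>X(3)[OF u]]] \<sigma>[of u] \<delta>(2)[OF u] by simp
    show "\<Sigma> = \<sigma> u" if "\<Sigma> \<in> ball S \<epsilon>" "is_critical1 (\<lambda>\<Sigma>. F \<Sigma> u) \<Sigma>" for \<Sigma>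
    proof -
      have "\<Sigma> \<in> ?X" using that by (auto simp: is_critical1_def)
      then have "rgrad \<Sigma> (\<Gamma> (\<Sigma>, u)) = 0" using crit_iff[OF XW1] that(2) by blast
      then show ?thesis using \<open>\<Sigma> \<in> ?X\<close> \<epsilon>(2) \<delta>(2)[OF u] by (intro uniq) auto
    qed
    show "strict_local_min1 (\<lambda>\<Sigma>. F \<Sigma> u) (\<sigma> u)"
      unfolding strict_local_min1_def
    proof (intro conjI exI[of _ "ball S \<epsilon>"] ballI impI)
      fix P assume P: "P \<in> ball S \<epsilon> \<inter> spd1" "P \<noteq> \<sigma> u"
      then have PX: "P \<in> ?X" by auto
      show "F (\<sigma> u) u < F P u"
      proof (rule ccontr)
        assume "\<not> F (\<sigma> u) u < F P u"
        then have "\<forall>P'\<in>?X. F P u \<le> F P' u" using \<sigma>min[OF u] by force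
        from minimizer[OF u PX this] show False using P(2) by blast
      qed
    qed (use \<sigma>X[OF u] in auto)
  qed
  have G: "pert_G \<Delta> S a X = (\<Sum>i\<in>UNIV. a $ i * (\<gamma> i S \<bullet> X))" if "X \<in> tangent1 S" for a X
    unfolding pert_G_def using frechet_derivative_spd1[OF \<Delta>' S that] W1(2) S by simp
  have Hinv: "Hinv (pert_G \<Delta> S a) = - \<sigma>' a" for a
    unfolding Hinv_def S_def[symmetric]
  proof (rule hess_inv1_eqI[OF S R(2)])
    show "- \<sigma>' a \<in> tangent1 S" using tang subspace_tangent1 subspace_neg by blast
    show "airm S (R (- \<sigma>' a)) Y = pert_G \<Delta> S a Y" if "Y \<in> tangent1 S" for Y
      by (simp add: linear_neg[OF R(2)] linear_neg[OF linear_airm_left] eqn[OF that] G[OF that] inner_sum_left)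
  qed (use R(4,5) in auto)
  have c\<Delta>\<sigma>: "continuous_on (ball 0 \<delta>) (\<lambda>u. \<Delta> i (\<sigma> u))" for i
  proof (rule continuous_on_compose2[OF c\<Delta>])
    show "continuous_on (ball 0 \<delta>) \<sigma>" by (rule continuous_on_subset[OF cont\<sigma>]) (auto simp: \<delta>_def)
    show "\<sigma> ` ball 0 \<delta> \<subseteq> ?X" using \<sigma>X(3) by auto
  qed
  have V': "((\<lambda>u. F (\<sigma> u) u) has_derivative (\<lambda>b. \<Sum>i\<in>UNIV. b $ i * \<Delta> i (\<sigma> u))) (at u)"
    if u: "u \<in> ball 0 \<delta>" for u
  proof (rule affine_value_has_derivative[OF open_ball u _ c\<Delta>\<sigma>])
    fix u u' :: "real^'p" assume "u \<in> ball 0 \<delta>" "u' \<in> ball 0 \<delta>"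
    then have "F (\<sigma> u') u' \<le> F (\<sigma> u) u'" using \<sigma>X(3) by (intro \<sigma>min) auto
    also have "\<dots> = F (\<sigma> u) u + (\<Sum>i\<in>UNIV. (u' - u) $ i * \<Delta> i (\<sigma> u))"
      by (simp add: F_def perturbed_def left_diff_distrib sum_subtractf)
    finally show "F (\<sigma> u') u' \<le> F (\<sigma> u) u + (\<Sum>i\<in>UNIV. (u' - u) $ i * \<Delta> i (\<sigma> u))" .
  qed
  have \<Delta>\<sigma>': "((\<lambda>u. \<Delta> i (\<sigma> u)) has_derivative (\<lambda>a. \<gamma> i S \<bullet> \<sigma>' a)) (at 0)" for i
  proof -
    have "((\<lambda>u. h i (\<sigma> u)) has_derivative (\<lambda>a. \<gamma> i (\<sigma> 0) \<bullet> \<sigma>' a)) (at 0)"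
      using W1(2) \<sigma>0 by (intro has_derivative_compose[OF \<sigma>' h']) simp
    moreover have "h i (\<sigma> u) = \<Delta> i (\<sigma> u)" if "u \<in> ball 0 \<delta>" for u
      using h_eq XW1[OF \<sigma>X(3)[of u]] that by simp
    ultimately show ?thesis
      using has_derivative_transform_within_open[of "\<lambda>u. h i (\<sigma> u)" _ 0 UNIV "ball 0 \<delta>" "\<lambda>u. \<Delta> i (\<sigma> u)"] \<delta>(1)
      by (simp add: \<sigma>0)
  qed
  define g' where "g' = (\<lambda>u. \<Sum>i\<in>UNIV. \<Delta> i (\<sigma> u) *\<^sub>R blinfun_inner_left (axis i 1 :: real^'p))"
  define g'' where "g'' = (\<lambda>a. \<Sum>i\<in>UNIV. (\<gamma> i S \<bullet> \<sigma>' a) *\<^sub>R blinfun_inner_left (axis i 1 :: real^'p))"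
  have g'_apply: "blinfun_apply (g' u) b = (\<Sum>i\<in>UNIV. b $ i * \<Delta> i (\<sigma> u))" for u b
    by (simp add: g'_def blinfun.sum_left blinfun.scaleR_left inner_axis mult.commute)
  have g''_apply: "blinfun_apply (g'' a) b = (\<Sum>i\<in>UNIV. b $ i * (\<gamma> i S \<bullet> \<sigma>' a))" for a b
    by (simp add: g''_def blinfun.sum_left blinfun.scaleR_left inner_axis mult.commute)
  have "has_second_derivative (\<lambda>u. F (\<sigma> u) u) (\<lambda>a b. - pert_G_dual \<Delta> S (Hinv (pert_G \<Delta> S a)) b) 0"
    unfolding has_second_derivative_def
  proof (rule exI[of _ g'], rule exI[of _ g''], intro conjI)
    have "\<forall>\<^sub>F u in nhds 0. u \<in> ball (0 :: real^'p) \<delta>"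
      using \<delta>(1) by (intro eventually_nhds_in_open) auto
    then show "\<forall>\<^sub>F u in nhds 0. ((\<lambda>u. F (\<sigma> u) u) has_derivative blinfun_apply (g' u)) (at u)"
      by (rule eventually_mono) (use V' in \<open>simp add: g'_apply[abs_def]\<close>)
    show "(g' has_derivative g'') (at 0)"
      unfolding g'_def g''_def by (intro has_derivative_sum has_derivative_scaleR_left \<Delta>\<sigma>')
    have "- \<sigma>' a \<in> tangent1 S" for a using tang subspace_tangent1 subspace_neg by blast
    then show "(\<lambda>a b. - pert_G_dual \<Delta> S (Hinv (pert_G \<Delta> S a)) b) = (\<lambda>a b. blinfun_apply (g'' a) b)"
      by (intro ext) (simp add: pert_G_dual_def Hinv G g''_apply sum_negf)
  qed
  moreover have "(\<sigma> has_derivative (\<lambda>a. - Hinv (pert_G \<Delta> S a))) (at 0)" using \<sigma>' by (simp add: Hinv)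
  ultimately show ?thesis
    using local \<delta>(1) \<epsilon>(1) by (intro exI[of _ "ball S \<epsilon>"] exI[of _ \<delta>] exI[of _ \<sigma>]) simp
qed

text \<open>The map \<open>B \<mapsto> \<Sigma>\<^sub>\<star>(B)\<close> is a branch of critical points with parameter \<open>B\<close>, so the linearized
  equation of \<open>critical_branch\<close> applies to it; the parameter derivative of the gradient is the mixed
  derivative of the energy.\<close>

theorem Sigma_star_response:
  fixes A B :: "real^'m^'d" and V :: "real^'n^'d"
  assumes C: "invertible C" and B: "B \<in> actions A"
  defines "S \<equiv> Sigma_star A C V B"
  obtains DS where "(Sigma_star A C V has_derivative DS) (at B within actions A)"
    "\<And>Z. Z \<in> action_space A \<Longrightarrow> DS Z = - hess_inv1 (fB A C V B) S (mixed_deriv A C V B S Z)"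
    "\<And>Z. DS Z \<in> tangent1 S"
proof -
  note star = Sigma_star_properties[OF C, where V = V]
  have S: "S \<in> spd1" unfolding S_def by (rule star(1)[OF B])
  have crit: "rgrad S (energy_grad A C V (S, B)) = 0" using star(3)[OF B S] by (simp add: S_def)
  obtain R where R: "((\<lambda>X. rgrad X (energy_grad A C V (X, B))) has_derivative R) (at S)"
    "linear R" "\<And>E. R (symp E) \<in> tangent1 S"
    "\<And>E. E \<in> tangent1 S \<Longrightarrow> E \<noteq> 0 \<Longrightarrow> airm S (R E) E > 0"
    "\<And>X Y. X \<in> tangent1 S \<Longrightarrow> hess1 (fB A C V B) S X Y = airm S (R X) Y"
    by (rule energy_hessian_exists[OF C B, of V, folded S_def]) (rule that, assumption+)
  have mem: "(S, B) \<in> energy_domain A C"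
    using spd1_imp_spd[OF S] actions_in_nbhd[OF C B] by (simp add: energy_domain_def spd_iff_posdef)
  from cont_diff_on_differentiable[OF cont_diff_on_energy_grad mem, of V]
  obtain \<Gamma>' where \<Gamma>': "(energy_grad A C V has_derivative \<Gamma>') (at (S, B))"
    unfolding differentiable_def ..
  have "((\<lambda>B. (S, B)) has_derivative (\<lambda>Z. (0, Z))) (at B)"
    by (intro has_derivative_Pair has_derivative_const has_derivative_ident)
  from has_derivative_compose[OF this \<Gamma>']
  have K: "((\<lambda>B. energy_grad A C V (S, B)) has_derivative (\<lambda>Z. \<Gamma>' (0, Z))) (at B)" .
  obtain W \<delta> \<sigma> \<sigma>' where \<delta>: "\<delta> > 0"
    and \<sigma>: "\<And>l. l \<in> ball B \<delta> \<Longrightarrow> \<sigma> l \<in> W \<and> \<sigma> l \<in> spd1 \<and> rgrad (\<sigma> l) (energy_grad A C V (\<sigma> l, l)) = 0"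
    and \<sigma>': "(\<sigma> has_derivative \<sigma>') (at B)"
    and tang: "\<And>h. \<sigma>' h \<in> tangent1 S"
    and eqn: "\<And>h Y. Y \<in> tangent1 S \<Longrightarrow> airm S (R (\<sigma>' h)) Y = - (\<Gamma>' (0, h) \<bullet> Y)"
    by (rule critical_branch[OF S open_energy_domain mem cont_diff_on_energy_grad crit R(1) K])
      (erule (1) R(4), rule that, assumption+)
  \<comment> \<open>By global uniqueness of critical points the local branch is the minimizer itself.\<close>
  have branch: "\<sigma> B' = Sigma_star A C V B'" if "B' \<in> actions A" "dist B' B < \<delta>" for B'
  proof -
    have "B' \<in> ball B \<delta>" using that(2) by (simp add: dist_commute)
    then have s: "\<sigma> B' \<in> spd1" "rgrad (\<sigma> B') (energy_grad A C V (\<sigma> B', B')) = 0" using \<sigma> by blast+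
    show ?thesis by (rule iffD1[OF star(3)[OF that(1) s(1)] s(2)])
  qed
  have mixed: "mixed_deriv A C V B S Z X = \<Gamma>' (0, Z) \<bullet> X" if Z: "Z \<in> action_space A" and X: "X \<in> tangent1 S" for Z X
  proof -
    have D: "((\<lambda>B. energy_grad A C V (S, B) \<bullet> X) has_derivative (\<lambda>Z. \<Gamma>' (0, Z) \<bullet> X)) (at B within actions A)"
      by (rule has_derivative_inner_left[OF has_derivative_at_withinI[OF K]])
    have eq: "frechet_derivative (fB A C V B') (at S within spd1) X = energy_grad A C V (S, B') \<bullet> X"
      if "B' \<in> actions A" for B'
      by (rule frechet_derivative_spd1[OF has_derivative_fB[OF C that S] S X])
    have "((\<lambda>B'. frechet_derivative (fB A C V B') (at S within spd1) X) has_derivative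
        (\<lambda>Z. \<Gamma>' (0, Z) \<bullet> X)) (at B within actions A)"
      by (rule has_derivative_transform[OF B eq D])
    from frechet_derivative_actions[OF this B Z] show ?thesis by (simp add: mixed_deriv_def)
  qed
  show thesis
  proof (rule that)
    show "(Sigma_star A C V has_derivative \<sigma>') (at B within actions A)"
      by (rule has_derivative_transform_within[OF has_derivative_at_withinI[OF \<sigma>'] \<delta> B branch])
    show "\<sigma>' Z \<in> tangent1 S" for Z by (rule tang)
    fix Z assume Z: "Z \<in> action_space A"
    have "hess_inv1 (fB A C V B) S (mixed_deriv A C V B S Z) = - \<sigma>' Z"
    proof (rule hess_inv1_eqI[OF S R(2)])
      show "- \<sigma>' Z \<in> tangent1 S" using tang subspace_tangent1 subspace_neg by blast
      show "airm S (R (- \<sigma>' Z)) Y = mixed_deriv A C V B S Z Y" if "Y \<in> tangent1 S" for Y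
        by (simp add: linear_neg[OF R(2)] linear_neg[OF linear_airm_left] eqn[OF that] mixed[OF Z that])
    qed (use R(4,5) in auto)
    then show "\<sigma>' Z = - hess_inv1 (fB A C V B) S (mixed_deriv A C V B S Z)" by simp
  qed
qed

text \<open>The chain rule for \<open>B \<mapsto> \<Phi>\<^sub>A(B, \<Sigma>\<^sub>\<star>(B))\<close>. The two partial derivatives are choices outside
  \<^const>\<open>action_space\<close> and the tangent space; only their values on these spaces enter, and any bounded
  linear extension off \<^const>\<open>action_space\<close> is a derivative.\<close>

lemma canonical_controller_response:
  fixes A U B :: "real^'m^'d" and V :: "real^'n^'d"
  assumes A: "A = U ** C" and C: "invertible C" and B: "B \<in> actions A"
    and W: "transpose (hcat U V) ** hcat U V = mat 1" "hcat U V ** transpose (hcat U V) = mat 1"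
  defines "S \<equiv> Sigma_star A C V B"
  assumes DS: "(Sigma_star A C V has_derivative DS) (at B within actions A)" and tang: "\<And>Z. DS Z \<in> tangent1 S"
  shows "(canonical_controller A has_derivative
    (\<lambda>Z. frechet_derivative (\<lambda>B'. Phi A U C V B' S) (at B within actions A) Z
       + frechet_derivative (Phi A U C V B) (at S within spd1) (DS Z))) (at B within actions A)"
proof -
  have S: "S \<in> spd1" unfolding S_def by (rule Sigma_star_properties(1)[OF C B])
  have mem: "(S, B) \<in> energy_domain A C"
    using spd1_imp_spd[OF S] actions_in_nbhd[OF C B] by (simp add: energy_domain_def spd_iff_posdef)
  define \<Phi> where "\<Phi> = (\<lambda>z. Phi A U C V (snd z) (fst z))"
  have "cont_diff_on \<Phi> (energy_domain A C)"
    unfolding \<Phi>_def Phi_eq by (intro cont_diff_on_matrix_mult cont_diff_on_const cont_diff_on_Kmat)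
  from cont_diff_on_differentiable[OF this mem]
  obtain \<Phi>' where \<Phi>': "(\<Phi> has_derivative \<Phi>') (at (S, B))" unfolding differentiable_def ..
  have lin: "linear \<Phi>'" using \<Phi>' by (rule has_derivative_linear)
  have "((\<lambda>B'. (S, B')) has_derivative (\<lambda>Z. (0, Z))) (at B)" "((\<lambda>X. (X, B)) has_derivative (\<lambda>E. (E, 0))) (at S)"
    by (intro has_derivative_Pair has_derivative_const has_derivative_ident)+
  from has_derivative_compose[OF this(1) \<Phi>'] has_derivative_compose[OF this(2) \<Phi>']
  have "((\<lambda>B'. Phi A U C V B' S) has_derivative (\<lambda>Z. \<Phi>' (0, Z))) (at B)"
    and "(Phi A U C V B has_derivative (\<lambda>E. \<Phi>' (E, 0))) (at S)"
    by (simp_all add: \<Phi>_def)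
  from this[THEN has_derivative_at_withinI]
  have d1: "((\<lambda>B'. Phi A U C V B' S) has_derivative (\<lambda>Z. \<Phi>' (0, Z))) (at B within actions A)"
    and d2: "(Phi A U C V B has_derivative (\<lambda>E. \<Phi>' (E, 0))) (at S within spd1)" .
  have pair: "((\<lambda>B'. (Sigma_star A C V B', B')) has_derivative (\<lambda>Z. (DS Z, Z))) (at B within actions A)"
    by (intro has_derivative_Pair DS has_derivative_ident)
  have "(\<Phi> has_derivative \<Phi>') (at (Sigma_star A C V B, B))" using \<Phi>' by (simp only: S_def)
  from has_derivative_compose[OF pair this]
  have D: "((\<lambda>B'. Phi A U C V B' (Sigma_star A C V B')) has_derivative (\<lambda>Z. \<Phi>' (DS Z, Z))) (at B within actions A)"
    by (simp only: \<Phi>_def fst_conv snd_conv)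
  have total: "(canonical_controller A has_derivative (\<lambda>Z. \<Phi>' (DS Z, Z))) (at B within actions A)"
    by (rule has_derivative_transform[OF B _ D]) (rule canonical_controller_eq[OF A C _ W])
  let ?D1 = "frechet_derivative (\<lambda>B'. Phi A U C V B' S) (at B within actions A)"
  let ?D2 = "frechet_derivative (Phi A U C V B) (at S within spd1)"
  have D1: "bounded_linear ?D1"
    by (rule has_derivative_bounded_linear[OF iffD1[OF frechet_derivative_works differentiableI[OF d1]]])
  have D2: "bounded_linear ?D2"
    by (rule has_derivative_bounded_linear[OF iffD1[OF frechet_derivative_works differentiableI[OF d2]]])
  have bl: "bounded_linear (\<lambda>Z. ?D1 Z + ?D2 (DS Z))"
    by (rule bounded_linear_add[OF D1 bounded_linear_compose[OF D2 has_derivative_bounded_linear[OF DS]]])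
  show ?thesis
  proof (rule has_derivative_actions_cong[OF total B bl])
    fix Z assume Z: "Z \<in> action_space A"
    have "\<Phi>' (DS Z, Z) = \<Phi>' ((0, Z) + (DS Z, 0))" by simp
    also have "\<dots> = ?D1 Z + ?D2 (DS Z)"
      unfolding linear_add[OF lin]
      using frechet_derivative_actions[OF d1 B Z] frechet_derivative_spd1[OF d2 S tang, of Z] by simp
    finally show "?D1 Z + ?D2 (DS Z) = \<Phi>' (DS Z, Z)" by simp
  qed
qed

theorem corollary1:
  fixes A U B :: "real^'m^'d" and C :: "real^'m^'m" and V :: "real^'n^'d"
    and \<Delta> :: "'p::finite \<Rightarrow> real^'m^'d \<Rightarrow> real^'n^'n \<Rightarrow> real"
    and S :: "real^'n^'n"
    and F :: "real^'n^'n \<Rightarrow> real^'p \<Rightarrow> real"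
    and Hinv :: "(real^'n^'n \<Rightarrow> real) \<Rightarrow> real^'n^'n"
    and G :: "real^'p \<Rightarrow> real^'n^'n \<Rightarrow> real"
    and Gdual :: "real^'n^'n \<Rightarrow> real^'p \<Rightarrow> real"
  assumes dims: "CARD('m) < CARD('d)" "CARD('n) = CARD('d) - CARD('m)"
    and rank_A: "rank A = CARD('m)"
    and factor: "A = U ** C" "transpose U ** U = mat 1" "invertible C"
    and orth: "transpose (hcat U V) ** hcat U V = mat 1" "hcat U V ** transpose (hcat U V) = mat 1"
    and B: "B \<in> actions A"
    and S: "S = Sigma_star A C V B"
    and Delta: "\<And>i. C2_near1 (\<Delta> i B) S"
    and F: "F = perturbed (fB A C V B) (\<lambda>i. \<Delta> i B)"
    and Hinv: "Hinv = hess_inv1 (fB A C V B) S"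
    and G: "G = pert_G (\<lambda>i. \<Delta> i B) S"
    and Gdual: "Gdual = pert_G_dual (\<lambda>i. \<Delta> i B) S"
  shows
    "(\<forall>\<xi>. linear \<xi> \<longrightarrow>
        (\<exists>!X. X \<in> tangent1 S \<and> (\<forall>Y\<in>tangent1 S. hess1 (fB A C V B) S X Y = \<xi> Y))) \<and>
     (\<exists>W \<delta> \<sigma>. open W \<and> S \<in> W \<and> \<delta> > 0 \<and>
        (\<forall>u. norm u < \<delta> \<longrightarrow>
           \<sigma> u \<in> W \<and> is_critical1 (\<lambda>\<Sigma>. F \<Sigma> u) (\<sigma> u) \<and>
           (\<forall>\<Sigma>\<in>W. is_critical1 (\<lambda>\<Sigma>. F \<Sigma> u) \<Sigma> \<longrightarrow> \<Sigma> = \<sigma> u) \<and>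
           strict_local_min1 (\<lambda>\<Sigma>. F \<Sigma> u) (\<sigma> u)) \<and>
        (\<sigma> has_derivative (\<lambda>a. - Hinv (G a))) (at 0) \<and>
        has_second_derivative (\<lambda>u. F (\<sigma> u) u) (\<lambda>a b. - Gdual (Hinv (G a)) b) 0) \<and>
     (\<exists>DS. (Sigma_star A C V has_derivative DS) (at B within actions A) \<and>
        (\<forall>Z\<in>action_space A. DS Z = - Hinv (mixed_deriv A C V B S Z)) \<and>
        (canonical_controller A has_derivative
           (\<lambda>Z. frechet_derivative (\<lambda>B'. Phi A U C V B' S) (at B within actions A) Z
                + frechet_derivative (Phi A U C V B) (at S within spd1) (DS Z)))
          (at B within actions A))"
proof -
  note C = factor(3)
  obtain DS where DS: "(Sigma_star A C V has_derivative DS) (at B within actions A)"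
    "\<And>Z. Z \<in> action_space A \<Longrightarrow> DS Z = - hess_inv1 (fB A C V B) S (mixed_deriv A C V B S Z)"
    "\<And>Z. DS Z \<in> tangent1 S"
    by (rule Sigma_star_response[OF C B, where V = V, folded S]) (rule that, assumption+)
  have 1: "\<forall>\<xi>. linear \<xi> \<longrightarrow>
      (\<exists>!X. X \<in> tangent1 S \<and> (\<forall>Y\<in>tangent1 S. hess1 (fB A C V B) S X Y = \<xi> Y))"
    unfolding S by (intro allI impI fB_hessian_bijective[OF C B])
  note 2 = perturbed_minimizer_response[OF C B Delta[unfolded S]]
  have 3: "(canonical_controller A has_derivative
      (\<lambda>Z. frechet_derivative (\<lambda>B'. Phi A U C V B' S) (at B within actions A) Z
         + frechet_derivative (Phi A U C V B) (at S within spd1) (DS Z))) (at B within actions A)"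
    unfolding S by (rule canonical_controller_response[OF factor(1) C B orth DS(1) DS(3)[unfolded S]])
  show ?thesis
  proof (intro conjI 1 exI[of _ DS] ballI DS(1) 3)
    show "DS Z = - Hinv (mixed_deriv A C V B S Z)" if "Z \<in> action_space A" for Z
      unfolding Hinv by (rule DS(2)[OF that])
  qed (use 2 in \<open>simp only: S F Hinv G Gdual\<close>)
qed

end
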